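(* Let $X,Y$ be quasi-Banach spaces such that $X^*$ and $Y$ have cotype $2$. Then there is a constant $C$ (depending only on $X$ and $Y$) such that if $u:X\to Y$ is a strongly approximable operator, then $\gamma_2(u)\le C\|u\|$.
   Context: A quasi-Banach space is a complete quasi-normed space; it need not be locally convex. By the Aoki–Rolewicz theorem every quasi-norm is equivalent to an $r$-norm for some $0<r\le 1$, i.e. a quasi-norm satisfying $\|x+y\|^r\le\|x\|^r+\|y\|^r$. The dual $X^*$ is the space of all bounded linear functionals on $X$ with the usual norm; it is always a Banach space (possibly $\{0\}$). $\mathcal L(X,Y)$ is the space of bounded linear operators $X\to Y$. An operator $u:X\to Y$ is strongly approximable if it belongs to $\mathcal A(X,Y)$, the smallest linear subspace of $\mathcal L(X,Y)$ which contains the finite-rank operators and is closed under pointwise convergence of bounded nets (i.e. if $(u_\alpha)$ is a net in the subspace with $\sup_\alpha\|u_\alpha\|<\infty$ and $u_\alpha(x)\to u(x)$ for each $x\in X$, then $u$ is in the subspace). $\gamma_2(u)$ is the infimum of $\|v\|\|w\|$ over all factorizations $u=vw$ with $w:X\to H$, $v:H\to Y$ bounded linear and $H$ a Hilbert space ($\gamma_2(u)=\infty$ if there is no such factorization). Let $D_N=\{-1,+1\}^N$ with normalized counting measure $\lambda$ and let $\epsilon_i(t)=t_i$. A quasi-Banach space $Z$ has cotype $2$ if there is a constant $C'$ such that for all $N$ and all $x_1,\dots,x_N\in Z$, $\left(\sum_{i=1}^N\|x_i\|^2\right)^{1/2}\le C'\left(\int_{D_N}\|\sum_{i=1}^N\epsilon_i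 x_i\|^2\,d\lambda\right)^{1/2}$. *)

theory Defs
  imports "HOL-Analysis.Analysis" "HOL-Library.Function_Algebras"
begin

(* Scalars. The multiplicative norm and the additivity of conjugation make every
   instance a copy of the reals or of the complex numbers (Gelfand-Mazur), and the two
   axioms determine the conjugation; so a statement over this class is a
   statement for real and for complex scalars. *)

class rc_field = real_normed_field +
  fixes sconj :: "'a \<Rightarrow> 'a"
  assumes sconj_add: "sconj (x + y) = sconj x + sconj y"
    and mult_sconj: "x * sconj x = (norm x)\<^sup>2 *\<^sub>R 1"

instantiation real :: rc_field
begin
definition sconj_real :: "real \<Rightarrow> real" where "sconj_real x = x"
instance by standard (simp_all add: sconj_real_def power2_eq_square)
end

instantiation complex :: rc_field
begin
definition sconj_complex :: "complex \<Rightarrow> complex" where "sconj_complex = cnj"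
instance by standard (simp_all add: sconj_complex_def complex_norm_square [symmetric] scaleR_conv_of_real del: of_real_power)
end


(* A space is given by a scalar multiplication s, a carrier S inside an ambient
   abelian group, and a function q on it. *)

definition complete_for :: "'a::ab_group_add set \<Rightarrow> ('a \<Rightarrow> real) \<Rightarrow> bool" where
  "complete_for S q \<longleftrightarrow>
     (\<forall>f::nat \<Rightarrow> 'a.
        (\<forall>n. f n \<in> S) \<and> (\<forall>e>0. \<exists>N. \<forall>m\<ge>N. \<forall>n\<ge>N. q (f m - f n) < e)
        \<longrightarrow> (\<exists>l\<in>S. (\<lambda>n. q (f n - l)) \<longlonglongrightarrow> 0))"

definition quasi_norm ::
  "('k::rc_field \<Rightarrow> 'a::ab_group_add \<Rightarrow> 'a) \<Rightarrow> ('a \<Rightarrow> real) \<Rightarrow> bool" where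
  "quasi_norm s q \<longleftrightarrow>
     (\<forall>x. 0 \<le> q x) \<and> (\<forall>x. q x = 0 \<longleftrightarrow> x = 0) \<and>
     (\<forall>c x. q (s c x) = norm c * q x) \<and>
     (\<exists>K. \<forall>x y. q (x + y) \<le> K * (q x + q y))"

definition quasi_banach ::
  "('k::rc_field \<Rightarrow> 'a::ab_group_add \<Rightarrow> 'a) \<Rightarrow> ('a \<Rightarrow> real) \<Rightarrow> bool" where
  "quasi_banach s q \<longleftrightarrow> vector_space s \<and> quasi_norm s q \<and> complete_for UNIV q"


(* Operators are total functions on the ambient type; only their values on S matter. *)

definition bounded_op ::
  "('k \<Rightarrow> 'a::ab_group_add \<Rightarrow> 'a) \<Rightarrow> 'a set \<Rightarrow> ('a \<Rightarrow> real) \<Rightarrow>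
   ('k \<Rightarrow> 'b::ab_group_add \<Rightarrow> 'b) \<Rightarrow> 'b set \<Rightarrow> ('b \<Rightarrow> real) \<Rightarrow> ('a \<Rightarrow> 'b) \<Rightarrow> bool" where
  "bounded_op s S p t T q u \<longleftrightarrow>
     u ` S \<subseteq> T \<and>
     (\<forall>x\<in>S. \<forall>y\<in>S. u (x + y) = u x + u y) \<and>
     (\<forall>c. \<forall>x\<in>S. u (s c x) = t c (u x)) \<and>
     (\<exists>B. \<forall>x\<in>S. q (u x) \<le> B * p x)"

definition opnorm :: "'a set \<Rightarrow> ('a \<Rightarrow> real) \<Rightarrow> ('b \<Rightarrow> real) \<Rightarrow> ('a \<Rightarrow> 'b) \<Rightarrow> real" where
  "opnorm S p q u = (SUP x\<in>{x\<in>S. p x \<le> 1}. q (u x))"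

definition bounded_ops ::
  "('k \<Rightarrow> 'a::ab_group_add \<Rightarrow> 'a) \<Rightarrow> ('a \<Rightarrow> real) \<Rightarrow>
   ('k \<Rightarrow> 'b::ab_group_add \<Rightarrow> 'b) \<Rightarrow> ('b \<Rightarrow> real) \<Rightarrow> ('a \<Rightarrow> 'b) set" where
  "bounded_ops s p t q = {u. bounded_op s UNIV p t UNIV q u}"

definition fscale :: "('k \<Rightarrow> 'b \<Rightarrow> 'b) \<Rightarrow> 'k \<Rightarrow> ('a \<Rightarrow> 'b) \<Rightarrow> 'a \<Rightarrow> 'b" where
  "fscale t c f = (\<lambda>x. t c (f x))"

lemma vector_space_fscale:
  assumes "vector_space t"
  shows "vector_space (fscale t)"
proof -
  interpret vector_space t by fact
  show ?thesis
    by standard (auto simp: fscale_def fun_eq_iff scale_right_distrib scale_left_distrib)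
qed

definition dual :: "('k::rc_field \<Rightarrow> 'a::ab_group_add \<Rightarrow> 'a) \<Rightarrow> ('a \<Rightarrow> real) \<Rightarrow> ('a \<Rightarrow> 'k) set" where
  "dual s p = bounded_ops s p (*) norm"

definition dual_norm :: "('a \<Rightarrow> real) \<Rightarrow> ('a \<Rightarrow> 'k::rc_field) \<Rightarrow> real" where
  "dual_norm p = opnorm UNIV p norm"


definition finite_rank :: "('k::rc_field \<Rightarrow> 'b::ab_group_add \<Rightarrow> 'b) \<Rightarrow> ('a \<Rightarrow> 'b) \<Rightarrow> bool" where
  "finite_rank t u \<longleftrightarrow> (\<exists>B. finite B \<and> range u \<subseteq> module.span t B)"

(* Nets are rendered as proper filters on the set of operators: a net gives the image
   of its tail filter, and a filter F gives the net of all pairs (P, v) with P in F and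
   v in P, directed by reverse inclusion of P. *)

definition bounded_net_closed ::
  "('k::rc_field \<Rightarrow> 'a::ab_group_add \<Rightarrow> 'a) \<Rightarrow> ('a \<Rightarrow> real) \<Rightarrow>
   ('k \<Rightarrow> 'b::ab_group_add \<Rightarrow> 'b) \<Rightarrow> ('b \<Rightarrow> real) \<Rightarrow> ('a \<Rightarrow> 'b) set \<Rightarrow> bool" where
  "bounded_net_closed s p t q A \<longleftrightarrow>
     (\<forall>F M. \<forall>u\<in>bounded_ops s p t q.
        F \<noteq> bot \<and>
        (\<forall>\<^sub>F v in F. v \<in> A \<and> opnorm UNIV p q v \<le> M) \<and>
        (\<forall>x. ((\<lambda>v. q (v x - u x)) \<longlongrightarrow> 0) F)
        \<longrightarrow> u \<in> A)"

definition strongly_approximable ::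
  "('k::rc_field \<Rightarrow> 'a::ab_group_add \<Rightarrow> 'a) \<Rightarrow> ('a \<Rightarrow> real) \<Rightarrow>
   ('k \<Rightarrow> 'b::ab_group_add \<Rightarrow> 'b) \<Rightarrow> ('b \<Rightarrow> real) \<Rightarrow> ('a \<Rightarrow> 'b) set" where
  "strongly_approximable s p t q =
     \<Inter>{A. A \<subseteq> bounded_ops s p t q \<and> module.subspace (fscale t) A \<and>
          {u \<in> bounded_ops s p t q. finite_rank t u} \<subseteq> A \<and>
          bounded_net_closed s p t q A}"


definition ip_norm :: "('h \<Rightarrow> 'h \<Rightarrow> 'k::rc_field) \<Rightarrow> 'h \<Rightarrow> real" where
  "ip_norm ip h = sqrt (norm (ip h h))"

definition hilbert_space ::
  "('k::rc_field \<Rightarrow> 'h::ab_group_add \<Rightarrow> 'h) \<Rightarrow> 'h set \<Rightarrow> ('h \<Rightarrow> 'h \<Rightarrow> 'k) \<Rightarrow> bool" where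
  "hilbert_space s H ip \<longleftrightarrow>
     vector_space s \<and> module.subspace s H \<and>
     (\<forall>x\<in>H. \<forall>y\<in>H. \<forall>z\<in>H. ip (x + y) z = ip x z + ip y z) \<and>
     (\<forall>c. \<forall>x\<in>H. \<forall>y\<in>H. ip (s c x) y = c * ip x y) \<and>
     (\<forall>x\<in>H. \<forall>y\<in>H. ip y x = sconj (ip x y)) \<and>
     (\<forall>x\<in>H. x \<noteq> 0 \<longrightarrow> (\<exists>r>0. ip x x = of_real r)) \<and>
     complete_for H (ip_norm ip)"

(* The Hilbert spaces range over the linear subspaces H of the space of all scalar
   functions on X, each with an arbitrary complete inner product. This loses nothing:
   in a factorization u = v w the Hilbert space may be replaced by the closure of the
   range of w, and then h |-> (x |-> <h, w x>) is an injective linear map into the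
   functions on X, along which the inner product can be transported.
   The infimum of the empty set is infinity. *)

definition gamma2 ::
  "('k::rc_field \<Rightarrow> 'a::ab_group_add \<Rightarrow> 'a) \<Rightarrow> ('a \<Rightarrow> real) \<Rightarrow>
   ('k \<Rightarrow> 'b::ab_group_add \<Rightarrow> 'b) \<Rightarrow> ('b \<Rightarrow> real) \<Rightarrow> ('a \<Rightarrow> 'b) \<Rightarrow> ennreal" where
  "gamma2 s p t q u =
     Inf {ennreal (opnorm H (ip_norm ip) q v * opnorm UNIV p (ip_norm ip) w) | v w ip H.
            hilbert_space (fscale (*)) (H :: ('a \<Rightarrow> 'k) set) ip \<and>
            bounded_op s UNIV p (fscale (*)) H (ip_norm ip) w \<and>
            bounded_op (fscale (*)) H (ip_norm ip) t UNIV q v \<and>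
            u = v \<circ> w}"


definition sign_vectors :: "nat \<Rightarrow> (nat \<Rightarrow> real) set" where
  "sign_vectors N = {..<N} \<rightarrow>\<^sub>E {-1, 1}"

definition cotype2 ::
  "('k::rc_field \<Rightarrow> 'a::ab_group_add \<Rightarrow> 'a) \<Rightarrow> 'a set \<Rightarrow> ('a \<Rightarrow> real) \<Rightarrow> bool" where
  "cotype2 s S q \<longleftrightarrow>
     (\<exists>C. \<forall>N. \<forall>x::nat \<Rightarrow> 'a. (\<forall>i<N. x i \<in> S) \<longrightarrow>
        sqrt (\<Sum>i<N. (q (x i))\<^sup>2) \<le>
        C * sqrt (\<integral>\<epsilon>. (q (\<Sum>i<N. s (of_real (\<epsilon> i)) (x i)))\<^sup>2
                     \<partial>uniform_count_measure (sign_vectors N)))"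

end

theory Submission
  imports Defs "HOL-Probability.Probability" "HOL-Library.Poly_Mapping"
begin

text \<open>
  The theorem says that \<open>u\<close> factors through a Hilbert space with a good constant. Up to
  constants that depend on \<open>Y\<close> only, this amounts to a quadratic form \<open>\<phi>\<close> on \<open>X\<close> with
  \<open>\<parallel>u x\<parallel>\<^sup>2 \<le> \<phi> x \<le> \<gamma>\<^sup>2 \<parallel>x\<parallel>\<^sup>2\<close>: the completion of \<open>X\<close> for \<open>\<phi>\<close> is the Hilbert space, and
  \<open>\<gamma>\<close> is the constant. So the task is to find \<open>\<phi>\<close> with \<open>\<gamma>\<close> a multiple of \<open>\<parallel>u\<parallel>\<close>, the multiple
  depending only on the two spaces.

  The quantity that is followed is the type 2 constant of \<open>u\<close>, the least \<open>T\<close> such that the mean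
  of \<open>\<parallel>\<Sum>\<epsilon>\<^sub>i u x\<^sub>i\<parallel>\<^sup>2\<close> over all signs is at most \<open>T \<Sum>\<parallel>x\<^sub>i\<parallel>\<^sup>2\<close>. It and quadratic forms control
  each other.

  From type 2 to a form (\<open>type2_cotype2_quadratic_form\<close>). Cotype 2 of \<open>Y\<close> bounds the Gaussian
  average of \<open>\<parallel>\<Sum>g\<^sub>i u x\<^sub>i\<parallel>\<^sup>2\<close> from below by \<open>\<Sum>\<parallel>u x\<^sub>i\<parallel>\<^sup>2\<close>, type 2 of \<open>u\<close> bounds it from above by
  \<open>\<Sum>\<parallel>x\<^sub>i\<parallel>\<^sup>2\<close>, both up to constants. The average does not change when \<open>x, x, y, y\<close> is replaced
  by \<open>x + y, x - y\<close>, because Gaussian vectors are invariant under rotation. A Hahn-Banach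
  argument on the free abelian group over \<open>X\<close> (\<open>quadratic_form_between\<close>) then puts a function
  that satisfies the parallelogram law between the two bounds.

  From a form to type 2 (\<open>type2_improvement\<close>). The vectors \<open>x\<^sub>i\<close> are the linear Walsh
  coefficients of a function \<open>f\<close> on the group of signs whose mean square norm is controlled by
  \<open>\<Sum>\<parallel>x\<^sub>i\<parallel>\<^sup>2\<close>; this is the dual form of cotype 2 of the dual (\<open>lift_to_signs\<close>). Smoothing \<open>f\<close>
  with the odd part of a Riesz product of parameter \<open>\<delta>\<close> keeps \<open>\<delta> \<Sum>\<epsilon>\<^sub>i x\<^sub>i\<close> up to an error of
  size \<open>\<delta>\<^sup>3\<close> for the form \<open>\<phi>\<close>. Hence the old form enters the new estimate only with a small
  factor, and the rest is governed by the norm of \<open>u\<close>. Duality sees only the Banach envelope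
  of \<open>X\<close>, so \<open>u\<close> has to be bounded for the envelope norm. That is where missing local convexity
  has to be made up for: Maurey's empirical method replaces a convex combination by a mean
  of \<open>m\<close> vectors, with an error of order \<open>\<gamma> / \<surd>m\<close> in the form (\<open>bounded_on_envelope\<close>).

  One round trip gives: if \<open>T\<close> is a type 2 bound of \<open>u\<close>, so is \<open>a \<parallel>u\<parallel>\<^sup>2 + T / 4\<close>. Iterating, any
  finite \<open>T\<close> may be replaced by a multiple of \<open>\<parallel>u\<parallel>\<^sup>2\<close> (\<open>type2_bound_automatic\<close>).

  The operators with a finite type 2 bound form a linear space. It contains the operators of
  finite rank, and by the automatic bound it is closed under pointwise limits of bounded nets:
  along such a net the type 2 bounds are uniform, and each involves only finitely many vectors.
  So it contains every strongly approximable operator, and the form obtained from the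
  automatic bound has the required size.

  The estimates use real scalars only. At the end the form is averaged over multiplication by
  the imaginary unit, which makes it Hermitian (\<open>hermitian_form\<close>). The completion is realized
  by functions on \<open>X\<close> (\<open>hilbert_space_H\<close>).
\<close>

section \<open>Additive minorants of subadditive functions\<close>

definition subadditive_fun :: "('g::ab_group_add \<Rightarrow> real) \<Rightarrow> bool" where
  "subadditive_fun p \<longleftrightarrow> (\<forall>x y. p (x + y) \<le> p x + p y)"

definition nmult :: "nat \<Rightarrow> 'g::ab_group_add \<Rightarrow> 'g" where
  "nmult n x = (\<Sum>i<n. x)"

lemma nmult_0 [simp]: "nmult 0 x = 0"
  and nmult_Suc [simp]: "nmult (Suc n) x = x + nmult n x"
  by (simp_all add: nmult_def add.commute)

lemma nmult_add: "nmult (m + n) x = nmult m x + nmult n x"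
  by (induction m) (simp_all add: add.assoc)

lemma subadditive_funD: "subadditive_fun p \<Longrightarrow> p (x + y) \<le> p x + p y"
  by (simp add: subadditive_fun_def)

lemma subadditive_fun_zero: "subadditive_fun p \<Longrightarrow> 0 \<le> p 0"
  using subadditive_funD[of p 0 0] by simp

lemma subadditive_fun_minus: "subadditive_fun p \<Longrightarrow> - p (- x) \<le> p x"
  using subadditive_funD[of p x "-x"] subadditive_fun_zero[of p] by simp

lemma subadditive_fun_nmult: "subadditive_fun p \<Longrightarrow> p 0 = 0 \<Longrightarrow> p (nmult n x) \<le> real n * p x"
proof (induction n)
  case (Suc n)
  then show ?case
    using subadditive_funD[of p x "nmult n x"] by (simp add: algebra_simps)
qed simp

text \<open>The substitute for extending a functional by one dimension: along the ray of \<open>z\<close>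
  the new function is additive, and it still lies below the old one.\<close>

lemma subadditive_fun_shift:
  fixes p :: "'g::ab_group_add \<Rightarrow> real"
  assumes p: "subadditive_fun p" and z: "\<And>n. p (nmult n z) = real n * p z"
  obtains p' where "subadditive_fun p'" "\<And>x. p' x \<le> p x" "\<And>x. p' x \<le> p (x + z) - p z"
proof -
  define p' where "p' x = (INF n::nat. p (x + nmult n z) - real n * p z)" for x
  have low: "- p (- x) \<le> p (x + nmult n z) - real n * p z" for x n
    using subadditive_funD[OF p, of "x + nmult n z" "- x"] z[of n] by (simp add: algebra_simps)
  have bdd: "bdd_below (range (\<lambda>n::nat. p (x + nmult n z) - real n * p z))" for x
    using low by (intro bdd_belowI) auto
  have le: "p' x \<le> p (x + nmult n z) - real n * p z" for x n
    unfolding p'_def by (rule cINF_lower[OF bdd]) simp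
  have "p' (x + y) \<le> p' x + p' y" for x y
  proof -
    have *: "p' (x + y) \<le> (p (x + nmult m z) - real m * p z) + (p (y + nmult n z) - real n * p z)" for m n
      using le[of "x + y" "m + n"] subadditive_funD[OF p, of "x + nmult m z" "y + nmult n z"]
      by (simp add: nmult_add algebra_simps)
    have "p' (x + y) - (p (y + nmult n z) - real n * p z) \<le> p' x" for n
      unfolding p'_def[of x] by (rule cINF_greatest) (use *[of _ n] in \<open>auto simp: algebra_simps\<close>)
    then have "p' (x + y) - p' x \<le> p' y"
      unfolding p'_def[of y] by (intro cINF_greatest) (auto simp: algebra_simps)
    then show ?thesis by simp
  qed
  then have "subadditive_fun p'" by (simp add: subadditive_fun_def)
  then show ?thesis
    using that[of p'] le[of _ 0] le[of _ 1] by simp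
qed

text \<open>Neither homogenizing nor shifting can lower a minimal function, so the inequalities between
  the function and its modifications are equalities.\<close>

lemma minimal_subadditive_fun_additive:
  fixes m :: "'g::ab_group_add \<Rightarrow> real"
  assumes m: "subadditive_fun m"
    and min: "\<And>p x. subadditive_fun p \<Longrightarrow> (\<And>x. p x \<le> m x) \<Longrightarrow> p x = m x"
  shows "m (x + y) = m x + m y"
proof -
  \<comment> \<open>halving the value at the double is a subadditive minorant, so minimality makes \<open>m\<close> homogeneous\<close>
  have *: "subadditive_fun (\<lambda>x. m (x + x) / 2)"
    unfolding subadditive_fun_def
  proof (intro allI)
    fix x y
    show "m (x + y + (x + y)) / 2 \<le> m (x + x) / 2 + m (y + y) / 2"
      using subadditive_funD[OF m, of "x + x" "y + y"] by (simp add: algebra_simps)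
  qed
  have dbl: "m (x + x) = 2 * m x" for x
  proof -
    have "m (x + x) / 2 \<le> m x" for x
      using subadditive_funD[OF m, of x x] by simp
    from min[OF * this] have "m (x + x) / 2 = m x" .
    then show ?thesis by simp
  qed
  have m0: "m 0 = 0" using dbl[of 0] by simp
  have dbl': "m (nmult (2 ^ k) x) = 2 ^ k * m x" for k x
  proof (induction k)
    case (Suc k)
    have "nmult (2 ^ Suc k) x = nmult (2 ^ k) x + nmult (2 ^ k) x"
      by (simp add: nmult_add[symmetric] mult_2)
    then show ?case using dbl[of "nmult (2 ^ k) x"] Suc by simp
  qed simp
  have hom: "m (nmult n x) = real n * m x" for n x
  proof (rule antisym)
    show "m (nmult n x) \<le> real n * m x" by (rule subadditive_fun_nmult[OF m m0])
    have n: "n < 2 ^ n" by simp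
    then have "nmult (2 ^ n) x = nmult n x + nmult (2 ^ n - n) x"
      by (metis nmult_add le_add_diff_inverse less_imp_le)
    then have "2 ^ n * m x \<le> m (nmult n x) + real (2 ^ n - n) * m x"
      using subadditive_funD[OF m, of "nmult n x" "nmult (2 ^ n - n) x"] subadditive_fun_nmult[OF m m0, of "2 ^ n - n" x]
      by (simp add: dbl'[symmetric])
    moreover have "real (2 ^ n - n) = 2 ^ n - real n" using n by (simp add: of_nat_diff less_imp_le)
    ultimately show "real n * m x \<le> m (nmult n x)" by (simp add: algebra_simps)
  qed
  obtain p' where p': "subadditive_fun p'" "\<And>x. p' x \<le> m x" "\<And>x. p' x \<le> m (x + y) - m y"
    using subadditive_fun_shift[OF m hom] by blast
  have "m x \<le> m (x + y) - m y"
    using p'(3)[of x] min[OF p'(1) p'(2), of x] by simp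
  then show ?thesis using subadditive_funD[OF m, of x y] by simp
qed

text \<open>A Hahn-Banach theorem for abelian groups. In the absence of scalars the functional cannot be
  built by adjoining one vector after another; a minimal function below \<open>p\<close>, given by Zorn's
  lemma, is additive instead. Chains have lower bounds because a subadditive \<open>f \<le> p\<close> stays
  above \<open>- p (- x)\<close>.\<close>

lemma additive_minorant:
  fixes p :: "'g::ab_group_add \<Rightarrow> real"
  assumes p: "subadditive_fun p"
  obtains a where "\<And>x y. a (x + y) = a x + a y" "\<And>x. a x \<le> p x"
proof -
  define A where "A = {f. subadditive_fun f \<and> (\<forall>x. f x \<le> p x)}"
  define r where "r = relation_of (\<lambda>f g :: 'g \<Rightarrow> real. g \<le> f) A"
  have po: "partial_order_on A r"
    unfolding r_def
    by (rule partial_order_on_relation_ofI) auto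
  have "\<exists>m\<in>A. \<forall>f\<in>A. (m, f) \<in> r \<longrightarrow> f = m"
  proof (rule predicate_Zorn[OF po[unfolded r_def], folded r_def, simplified r_def relation_of_def mem_Collect_eq case_prod_conv, THEN bexE])
    fix C assume C: "C \<in> Chains {(a, b). (a, b) \<in> A \<times> A \<and> b \<le> a}"
    show "\<exists>u\<in>A. \<forall>a\<in>C. u \<le> a"
    proof (cases "C = {}")
      case True
      then show ?thesis using p by (auto simp: A_def)
    next
      case False
      have CA: "f \<in> A" if "f \<in> C" for f using C that by (auto simp: Chains_def)
      have tot: "f \<le> g \<or> g \<le> f" if "f \<in> C" "g \<in> C" for f g using C that by (auto simp: Chains_def)
      define u where "u x = (INF f\<in>C. f x)" for x
      have bdd: "bdd_below ((\<lambda>f. f x) ` C)" for x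
      proof (rule bdd_belowI)
        fix y assume "y \<in> (\<lambda>f. f x) ` C"
        then obtain f where f: "f \<in> C" "y = f x" by auto
        then have "subadditive_fun f" "f (- x) \<le> p (- x)" using CA by (auto simp: A_def)
        then show "- p (- x) \<le> y" using subadditive_fun_minus[of f x] f by simp
      qed
      have le: "u x \<le> f x" if "f \<in> C" for f x
        unfolding u_def by (rule cINF_lower[OF bdd that])
      have "u (x + y) \<le> u x + u y" for x y
      proof -
        have *: "u (x + y) \<le> f x + g y" if fg: "f \<in> C" "g \<in> C" for f g
        proof -
          obtain h where h: "h \<in> C" "h \<le> f" "h \<le> g" using tot[OF fg] fg by auto
          then have "u (x + y) \<le> h x + h y"
            using le[OF h(1), of "x + y"] CA[OF h(1)] subadditive_funD[of h x y] by (auto simp: A_def)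
          then show ?thesis using h(2,3) by (meson add_mono le_funD order_trans)
        qed
        have "u (x + y) - g y \<le> u x" if "g \<in> C" for g
          unfolding u_def[of x] using *[OF _ that] False by (intro cINF_greatest) (auto simp: algebra_simps)
        then have "u (x + y) - u x \<le> u y"
          unfolding u_def[of y] using False by (intro cINF_greatest) (auto simp: algebra_simps)
        then show ?thesis by simp
      qed
      moreover have "u x \<le> p x" for x
        using False le CA by (fastforce simp: A_def intro: order_trans)
      ultimately have "u \<in> A" by (simp add: A_def subadditive_fun_def)
      then show ?thesis using le by (auto simp: le_fun_def)
    qed
  next
    fix m assume "m \<in> A" "\<forall>a\<in>A. a \<le> m \<longrightarrow> a = m"
    then show ?thesis by (auto simp: r_def relation_of_def)
  qed
  then obtain m where m: "m \<in> A" "\<And>f. f \<in> A \<Longrightarrow> f \<le> m \<Longrightarrow> f = m"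
    by (auto simp: r_def relation_of_def)
  show thesis
  proof (rule that)
    show "m (x + y) = m x + m y" for x y
    proof (rule minimal_subadditive_fun_additive)
      show "subadditive_fun m" using m(1) by (simp add: A_def)
      fix p' x assume p': "subadditive_fun p'" "\<And>x. p' x \<le> m x"
      then have "p' \<in> A" using m(1) by (auto simp: A_def intro: order_trans)
      then show "p' x = m x" using m(2)[of p'] p'(2) by (auto simp: le_fun_def)
    qed
    show "m x \<le> p x" for x using m(1) by (simp add: A_def)
  qed
qed

text \<open>The shifted function takes a value of at most \<open>- p z\<close> at \<open>- z\<close>, which forces the value of
  any additive minorant at \<open>z\<close> up to \<open>p z\<close>.\<close>

lemma additive_minorant_touching:
  fixes p :: "'g::ab_group_add \<Rightarrow> real"
  assumes p: "subadditive_fun p" and z: "\<And>n. p (nmult n z) = real n * p z"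
  obtains a where "\<And>x y. a (x + y) = a x + a y" "\<And>x. a x \<le> p x" "a z = p z"
proof -
  obtain p' where p': "subadditive_fun p'" "\<And>x. p' x \<le> p x" "\<And>x. p' x \<le> p (x + z) - p z"
    using subadditive_fun_shift[OF p z] by blast
  obtain a where a: "\<And>x y. a (x + y) = a x + a y" "\<And>x. a x \<le> p' x"
    using additive_minorant[OF p'(1)] by blast
  have "a 0 = 0" using a(1)[of 0 0] by simp
  then have "a z = - a (- z)" using a(1)[of z "- z"] by simp
  moreover have "a (- z) \<le> - p z"
    using a(2)[of "- z"] p'(3)[of "- z"] z[of 0] by simp
  ultimately have "a z = p z" using a(2)[of z] p'(2)[of z] by simp
  then show thesis using that[of a] a p'(2) by (meson order_trans)
qed

section \<open>Quasi-norms over the real scalars\<close>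

locale real_vector_space = vector_space s for s :: "real \<Rightarrow> 'a::ab_group_add \<Rightarrow> 'a"

locale qnorm = real_vector_space s for s :: "real \<Rightarrow> 'a::ab_group_add \<Rightarrow> 'a" +
  fixes q :: "'a \<Rightarrow> real" and K :: real
  assumes q_nonneg [simp]: "0 \<le> q x"
    and q_eq_0 [simp]: "q x = 0 \<longleftrightarrow> x = 0"
    and q_scale [simp]: "q (s c x) = \<bar>c\<bar> * q x"
    and q_add: "q (x + y) \<le> K * (q x + q y)"
    and K_ge_1: "1 \<le> K"
begin

lemma q_0 [simp]: "q 0 = 0"
  by simp

lemma q_minus [simp]: "q (- x) = q x"
  using q_scale[of "-1" x] by simp

lemma q_diff: "q (x - y) \<le> K * (q x + q y)"
  using q_add[of x "- y"] by simp

lemma q_minus_commute: "q (x - y) = q (y - x)"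
  using q_minus[of "x - y"] by simp

lemma q_add_sq: "(q (x + y))\<^sup>2 \<le> 2 * K\<^sup>2 * ((q x)\<^sup>2 + (q y)\<^sup>2)"
proof -
  have "(q (x + y))\<^sup>2 \<le> (K * (q x + q y))\<^sup>2"
    by (intro power_mono q_add) simp
  also have "\<dots> = K\<^sup>2 * (q x + q y)\<^sup>2" by (simp add: power_mult_distrib)
  also have "\<dots> \<le> K\<^sup>2 * (2 * ((q x)\<^sup>2 + (q y)\<^sup>2))"
    using sum_squares_bound[of "q x" "q y"]
    by (intro mult_left_mono) (auto simp: power2_sum)
  finally show ?thesis by (simp add: algebra_simps)
qed

end

lemma list_split_at_level:
  fixes w :: "'a \<Rightarrow> real"
  assumes "0 \<le> c" "c \<le> (\<Sum>x\<leftarrow>xs. w x)" "xs \<noteq> []"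
  shows "\<exists>ys x zs. xs = ys @ x # zs \<and> (\<Sum>x\<leftarrow>ys. w x) \<le> c \<and> c \<le> (\<Sum>x\<leftarrow>ys. w x) + w x"
  using assms
proof (induction xs arbitrary: c)
  case (Cons a xs)
  show ?case
  proof (cases "c \<le> w a \<or> xs = []")
    case True
    then show ?thesis
      using Cons.prems by (intro exI[of _ "[]"] exI[of _ a] exI[of _ xs]) auto
  next
    case False
    then obtain ys x zs where "xs = ys @ x # zs" "(\<Sum>x\<leftarrow>ys. w x) \<le> c - w a"
        "c - w a \<le> (\<Sum>x\<leftarrow>ys. w x) + w x"
      using Cons.IH[of "c - w a"] Cons.prems by auto
    then show ?thesis
      by (intro exI[of _ "a # ys"] exI[of _ x] exI[of _ zs]) auto
  qed
qed simp

context qnorm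
begin

text \<open>With the exponent chosen so that three vectors cost a factor of two, a finite sum is
  handled by cutting it at its half-way point: both halves carry at most half of the total.\<close>

lemma powr_sum_list_le:
  assumes r: "0 < r" "(2 * K) powr (2 * r) = 2"
  shows "q (sum_list xs) powr r \<le> 2 * (\<Sum>x\<leftarrow>xs. q x powr r)"
proof -
  define k where "k = 2 * K"
  have k: "2 \<le> k" using K_ge_1 by (simp add: k_def)
  have two: "q (x + y) \<le> k * max (q x) (q y)" for x y
  proof -
    have "q (x + y) \<le> K * (q x + q y)" by (rule q_add)
    also have "\<dots> \<le> K * (2 * max (q x) (q y))"
      using K_ge_1 by (intro mult_left_mono) (auto simp: max_def)
    finally show ?thesis by (simp add: k_def)
  qed
  have three: "q (x + (y + z)) powr r \<le> 2 * B"
    if B: "q x powr r \<le> B" "q y powr r \<le> B" "q z powr r \<le> B" for x y z B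
  proof -
    define b where "b = max (q x) (max (q y) (q z))"
    have b0: "0 \<le> b" by (simp add: b_def le_max_iff_disj)
    have kmono: "k * u \<le> k * v" if "u \<le> v" for u v
      using that k by (intro mult_left_mono) auto
    have "max (q y) (q z) \<le> b" by (simp add: b_def)
    then have "q (y + z) \<le> k * b"
      using two[of y z] kmono by (meson order_trans)
    moreover have "q x \<le> k * b"
    proof -
      have "q x \<le> 1 * b" by (simp add: b_def)
      also have "\<dots> \<le> k * b" using k b0 by (intro mult_right_mono) auto
      finally show ?thesis .
    qed
    ultimately have "q (x + (y + z)) \<le> k * (k * b)"
      using order_trans[OF two[of x "y + z"] kmono[of "max (q x) (q (y + z))" "k * b"]] by simp
    then have "q (x + (y + z)) powr r \<le> (k * (k * b)) powr r"
      using r by (intro powr_mono2) auto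
    also have "\<dots> = k powr (2 * r) * b powr r"
    proof -
      have "k powr (2 * r) = k powr r * k powr r" unfolding mult_2 by (rule powr_add)
      then show ?thesis using k b0 by (simp add: powr_mult)
    qed
    also have "\<dots> = 2 * b powr r" using r by (simp add: k_def)
    also have "b powr r \<le> B" using B by (auto simp: b_def max_def)
    finally show ?thesis by simp
  qed
  show ?thesis
  proof (induction xs rule: length_induct)
    case (1 xs)
    show ?case
    proof (cases "xs = []")
      case False
      define S where "S = (\<Sum>x\<leftarrow>xs. q x powr r)"
      have S0: "0 \<le> S" by (auto simp: S_def intro!: sum_list_nonneg)
      have "0 \<le> S / 2" "S / 2 \<le> (\<Sum>x\<leftarrow>xs. q x powr r)" using S0 by (simp_all add: S_def)
      from list_split_at_level[OF this False]
      obtain ys x zs where xs: "xs = ys @ x # zs" and ys: "(\<Sum>x\<leftarrow>ys. q x powr r) \<le> S / 2"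
        and x: "S / 2 \<le> (\<Sum>x\<leftarrow>ys. q x powr r) + q x powr r"
        by blast
      have eq: "S = (\<Sum>x\<leftarrow>ys. q x powr r) + q x powr r + (\<Sum>x\<leftarrow>zs. q x powr r)"
        by (simp add: S_def xs)
      have nn: "0 \<le> (\<Sum>x\<leftarrow>ys. q x powr r)" "0 \<le> (\<Sum>x\<leftarrow>zs. q x powr r)"
        by (auto intro!: sum_list_nonneg)
      have "q (sum_list ys) powr r \<le> S" "q (sum_list zs) powr r \<le> S" "q x powr r \<le> S"
        using 1[rule_format, of ys] 1[rule_format, of zs] ys x eq nn by (auto simp: xs)
      from three[OF this(1,3,2)] show ?thesis by (simp add: xs S_def)
    qed simp
  qed
qed

text \<open>\<open>D\<close> is the \<open>r\<close>-th power of an \<open>r\<close>-norm: the infimum of \<open>\<Sum>q(x\<^sub>i)\<^sup>r\<close> over all ways to write a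
  vector as a sum.\<close>

lemma Aoki_Rolewicz:
  obtains r D where "0 < r" "\<And>x y. D (x + y) \<le> D x + D y" "\<And>c x. D (s c x) = \<bar>c\<bar> powr r * D x"
    "\<And>x. D x \<le> q x powr r" "\<And>x. q x powr r \<le> 2 * D x"
proof -
  define r where "r = ln 2 / (2 * ln (2 * K))"
  have lnK: "0 < ln (2 * K)" using K_ge_1 by simp
  then have r0: "0 < r" by (simp add: r_def)
  have "(2 * K) powr (2 * r) = exp (ln 2)" using K_ge_1 lnK by (simp add: powr_def r_def)
  then have r2: "(2 * K) powr (2 * r) = 2" by simp
  define W where "W xs = (\<Sum>x\<leftarrow>xs. q x powr r)" for xs
  define D where "D x = Inf (W ` {xs. sum_list xs = x})" for x
  have W0: "0 \<le> W xs" for xs by (auto simp: W_def intro!: sum_list_nonneg)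
  have bdd: "bdd_below (W ` A)" for A using W0 by (intro bdd_belowI[of _ 0]) auto
  have ne: "{xs. sum_list xs = x} \<noteq> {}" for x :: 'a
  proof -
    have "sum_list [x] = x" by simp
    then show ?thesis by blast
  qed
  have D_le: "D (sum_list xs) \<le> W xs" for xs
    unfolding D_def by (rule cINF_lower[OF bdd]) simp
  have D_ge: "b \<le> D x" if "\<And>xs. sum_list xs = x \<Longrightarrow> b \<le> W xs" for b x
    unfolding D_def by (rule cINF_greatest[OF ne]) (use that in auto)
  have D_add: "D (x + y) \<le> D x + D y" for x y
  proof -
    have *: "D (x + y) \<le> W xs + W ys" if "sum_list xs = x" "sum_list ys = y" for xs ys
      using D_le[of "xs @ ys"] that by (simp add: W_def)
    have "D (x + y) - D x \<le> D y"
    proof (rule D_ge)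
      fix ys assume ys: "sum_list ys = y"
      have "D (x + y) - W ys \<le> D x"
        by (rule D_ge) (use *[OF _ ys] in \<open>auto simp: algebra_simps\<close>)
      then show "D (x + y) - D x \<le> W ys" by simp
    qed
    then show ?thesis by simp
  qed
  have D_low: "q x powr r \<le> 2 * D x" for x
  proof -
    have "q x powr r / 2 \<le> D x"
      by (rule D_ge) (use powr_sum_list_le[OF r0 r2] in \<open>auto simp: W_def mult.commute\<close>)
    then show ?thesis by simp
  qed
  have D_up: "D x \<le> q x powr r" for x
    using D_le[of "[x]"] by (simp add: W_def)
  have D_sc: "D (s c x) \<le> \<bar>c\<bar> powr r * D x" if c: "c \<noteq> 0" for c x
  proof -
    have "D (s c x) / \<bar>c\<bar> powr r \<le> D x"
    proof (rule D_ge)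
      fix xs assume xs: "sum_list xs = x"
      have "sum_list (map (s c) xs) = s c (sum_list xs)" for xs
        by (induction xs) (simp_all add: scale_right_distrib)
      moreover have "W (map (s c) xs) = \<bar>c\<bar> powr r * W xs" for xs
        by (induction xs) (simp_all add: W_def powr_mult algebra_simps)
      ultimately have "D (s c x) \<le> \<bar>c\<bar> powr r * W xs"
        using D_le[of "map (s c) xs"] xs by simp
      then show "D (s c x) / \<bar>c\<bar> powr r \<le> W xs"
        using c by (simp add: field_simps)
    qed
    then show ?thesis using c by (simp add: field_simps)
  qed
  have D_0: "D 0 = 0" using D_up[of 0] D_low[of 0] r0 by simp
  have D_scale: "D (s c x) = \<bar>c\<bar> powr r * D x" for c x
  proof (cases "c = 0")
    case True
    then show ?thesis using D_0 r0 by simp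
  next
    case False
    have "D (s (1/c) (s c x)) \<le> \<bar>1/c\<bar> powr r * D (s c x)" using False by (intro D_sc) simp
    then have "D x \<le> \<bar>1/c\<bar> powr r * D (s c x)" using False by simp
    then have "\<bar>c\<bar> powr r * D x \<le> D (s c x)"
      using False by (simp add: powr_divide field_simps)
    then show ?thesis using D_sc[OF False, of x] by simp
  qed
  show thesis by (rule that[OF r0 D_add D_scale D_up D_low])
qed

text \<open>A quasi-norm may be discontinuous, even in dimension two. Continuity in the
  coefficients of finite combinations makes Gaussian averages of its square meaningful.\<close>

definition continuous_combinations :: bool where
  "continuous_combinations \<longleftrightarrow>
     (\<forall>n z w. continuous_on UNIV (\<lambda>t::nat \<Rightarrow> real. q (z + (\<Sum>k<n. s (t k) (w k)))))"

text \<open>The triangle inequality gives \<open>\<bar>D x - D y\<bar> \<le> D (x - y)\<close>, so that the functional \<open>D\<close> of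
  Aoki and Rolewicz depends continuously on the coefficients.\<close>

theorem continuous_renorming:
  obtains q' c where "1 \<le> c" "qnorm s q' c" "\<And>x. q' x \<le> q x" "\<And>x. q x \<le> c * q' x"
    "qnorm.continuous_combinations s q'"
proof -
  obtain r D where r: "0 < r" and D_add: "\<And>x y. D (x + y) \<le> D x + D y"
    and D_scale: "\<And>c x. D (s c x) = \<bar>c\<bar> powr r * D x"
    and D_up: "\<And>x. D x \<le> q x powr r" and D_low: "\<And>x. q x powr r \<le> 2 * D x"
    using Aoki_Rolewicz by blast
  define q' where "q' x = D x powr (1 / r)" for x
  define c where "c = (2::real) powr (1 / r)"
  have c: "1 \<le> c" unfolding c_def using r by (intro ge_one_powr_ge_zero) auto
  have D0: "0 \<le> D x" for x using D_low[of x] powr_ge_zero[of "q x" r] by linarith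
  have D_0: "D x = 0 \<longleftrightarrow> x = 0" for x
    using D_up[of x] D_low[of x] D0[of x] r by (auto simp: )
  have q'_up: "q' x \<le> q x" for x
  proof -
    have "q' x \<le> (q x powr r) powr (1 / r)"
      unfolding q'_def using r D0 D_up by (intro powr_mono2) auto
    then show ?thesis using r by (simp add: powr_powr)
  qed
  have q'_low: "q x \<le> c * q' x" for x
  proof -
    have "(q x powr r) powr (1 / r) \<le> (2 * D x) powr (1 / r)"
      using r D_low by (intro powr_mono2) auto
    then show ?thesis using r D0 by (simp add: powr_powr c_def q'_def powr_mult)
  qed
  have norm: "qnorm s q' c"
  proof unfold_locales
    fix x y :: 'a and a :: real
    show "0 \<le> q' x" by (simp add: q'_def)
    show "q' x = 0 \<longleftrightarrow> x = 0" by (simp add: q'_def D_0)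
    show "q' (s a x) = \<bar>a\<bar> * q' x"
      using r D0[of x] by (simp add: q'_def D_scale powr_mult powr_powr)
    have mono: "D u powr (1 / r) \<le> D v powr (1 / r)" if "D u \<le> D v" for u v
      using that r D0 by (intro powr_mono2) auto
    have "q' (x + y) \<le> (2 * max (D x) (D y)) powr (1 / r)"
      unfolding q'_def using r D0 D_add[of x y] by (intro powr_mono2) auto
    also have "\<dots> = c * (max (D x) (D y)) powr (1 / r)"
      using D0 by (simp add: c_def powr_mult le_max_iff_disj)
    also have "\<dots> \<le> c * (q' x + q' y)"
      using c by (intro mult_left_mono) (auto simp: q'_def max_def)
    finally show "q' (x + y) \<le> c * (q' x + q' y)" .
    show "1 \<le> c" by (rule c)
  qed
  have D_diff: "\<bar>D x - D y\<bar> \<le> D (x - y)" for x y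
  proof -
    have "D (y - x) = D (x - y)" using D_scale[of "-1" "x - y"] by simp
    then show ?thesis using D_add[of "x - y" y] D_add[of "y - x" x] by auto
  qed
  have D_sum: "D (\<Sum>k<n. f k) \<le> (\<Sum>k<n. D (f k))" for f and n :: nat
  proof (induction n)
    case (Suc n)
    then show ?case using D_add[of "\<Sum>k<n. f k" "f n"] by simp
  next
    case 0
    show ?case using D_0[of 0] by simp
  qed
  have "continuous_on UNIV (\<lambda>t::nat \<Rightarrow> real. D (z + (\<Sum>k<n. s (t k) (w k))))" for n z w
    unfolding continuous_on_def
  proof
    fix t0 :: "nat \<Rightarrow> real"
    let ?f = "\<lambda>t. z + (\<Sum>k<n. s (t k) (w k))"
    have proj: "((\<lambda>t::nat \<Rightarrow> real. t k) \<longlongrightarrow> t0 k) (at t0)" for k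
      by (rule continuous_on_product_coordinates[where i = k, unfolded continuous_on_def, rule_format, OF UNIV_I])
    have "((\<lambda>t. \<Sum>k<n. \<bar>t k - t0 k\<bar> powr r * D (w k)) \<longlongrightarrow> (\<Sum>k<n. \<bar>t0 k - t0 k\<bar> powr r * D (w k))) (at t0)"
      using r by (intro tendsto_intros proj) auto
    then have lim: "((\<lambda>t. \<Sum>k<n. \<bar>t k - t0 k\<bar> powr r * D (w k)) \<longlongrightarrow> 0) (at t0)" using r by simp
    have "\<bar>D (?f t) - D (?f t0)\<bar> \<le> (\<Sum>k<n. \<bar>t k - t0 k\<bar> powr r * D (w k))" for t
    proof -
      have "?f t - ?f t0 = (\<Sum>k<n. s (t k - t0 k) (w k))"
        by (simp add: scale_left_diff_distrib sum_subtractf)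
      then show ?thesis
        using D_diff[of "?f t" "?f t0"] D_sum[of "\<lambda>k. s (t k - t0 k) (w k)" n] by (simp add: D_scale)
    qed
    then have "((\<lambda>t. D (?f t) - D (?f t0)) \<longlongrightarrow> 0) (at t0)"
      by (intro tendsto_0_le[OF lim, of _ 1] always_eventually) (auto intro: order_trans[OF _ abs_ge_self])
    then show "((\<lambda>t. D (?f t)) \<longlongrightarrow> D (?f t0)) (at t0 within UNIV)"
      by (simp add: LIM_zero_iff)
  qed
  then have "qnorm.continuous_combinations s q'"
    unfolding qnorm.continuous_combinations_def[OF norm] q'_def
    using r D0 by (intro allI continuous_on_powr' continuous_on_const) auto
  then show thesis using that[OF c norm q'_up q'_low] by blast
qed

end

section \<open>Rademacher and Gaussian averages\<close>

abbreviation half :: ennreal where "half \<equiv> ennreal (1/2)"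

lemma half_mult_add_self: "half * (a + a) = a"
proof -
  have "half * (a + a) = (half + half) * a" by (simp only: distrib_left distrib_right)
  also have "half + half = 1" by (subst ennreal_plus[symmetric]) auto
  finally show ?thesis by simp
qed

text \<open>The offset \<open>z\<close> lets the vectors be absorbed one at a time, so that statements about averages
  become inductions on lists.\<close>

primrec rademacher_mean :: "('a::ab_group_add \<Rightarrow> ennreal) \<Rightarrow> 'a list \<Rightarrow> 'a \<Rightarrow> ennreal" where
  "rademacher_mean F [] z = F z"
| "rademacher_mean F (x # xs) z =
     half * (rademacher_mean F xs (z + x) + rademacher_mean F xs (z - x))"

lemma rademacher_mean_snoc:
  "rademacher_mean F (xs @ [y]) z =
     half * (rademacher_mean F xs (z + y) + rademacher_mean F xs (z - y))"
  by (induction xs arbitrary: z) (simp_all add: algebra_simps)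

lemma finite_sign_vectors [simp]: "finite (sign_vectors N)"
  by (simp add: sign_vectors_def finite_PiE)

lemma card_sign_vectors [simp]: "card (sign_vectors N) = 2 ^ N"
  by (simp add: sign_vectors_def card_PiE numeral_2_eq_2[symmetric])

lemma sum_sign_vectors_Suc:
  "(\<Sum>\<epsilon>\<in>sign_vectors (Suc N). G \<epsilon>) = (\<Sum>\<epsilon>\<in>sign_vectors N. G (\<epsilon>(N := 1)) + G (\<epsilon>(N := -1)))"
proof -
  let ?h = "\<lambda>(y, g). g(N := y)"
  have "sign_vectors (Suc N) = ?h ` ({-1, 1} \<times> sign_vectors N)"
    by (simp add: sign_vectors_def lessThan_Suc PiE_insert_eq)
  moreover have "inj_on ?h ({-1, 1} \<times> sign_vectors N)"
    unfolding sign_vectors_def by (rule inj_combinator) simp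
  ultimately have "(\<Sum>\<epsilon>\<in>sign_vectors (Suc N). G \<epsilon>) = (\<Sum>yg\<in>{-1, 1} \<times> sign_vectors N. G (?h yg))"
    by (simp add: sum.reindex)
  also have "\<dots> = (\<Sum>y\<in>{-1, 1}. \<Sum>g\<in>sign_vectors N. G (g(N := y)))"
    by (subst sum.cartesian_product) (simp add: case_prod_unfold)
  finally show ?thesis by (simp add: sum.distrib add.commute)
qed

lemma rademacher_mean_eq_sum:
  "rademacher_mean F (map w [0..<N]) z =
     half ^ N * (\<Sum>\<epsilon>\<in>sign_vectors N. F (z + (\<Sum>i<N. if \<epsilon> i = 1 then w i else - w i)))"
proof (induction N arbitrary: z)
  case 0
  then show ?case by (simp add: sign_vectors_def)
next
  case (Suc N)
  have eq: "(\<Sum>i<N. if (\<epsilon>(N := c)) i = 1 then w i else - w i) = (\<Sum>i<N. if \<epsilon> i = 1 then w i else - w i)"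
    for \<epsilon> and c :: real
    by (rule sum.cong) auto
  have eqs: "(\<Sum>\<epsilon>\<in>sign_vectors (Suc N). F (z + (\<Sum>i<Suc N. if \<epsilon> i = 1 then w i else - w i))) =
      (\<Sum>\<epsilon>\<in>sign_vectors N. F (z + w N + (\<Sum>i<N. if \<epsilon> i = 1 then w i else - w i))) +
      (\<Sum>\<epsilon>\<in>sign_vectors N. F (z - w N + (\<Sum>i<N. if \<epsilon> i = 1 then w i else - w i)))"
    unfolding sum_sign_vectors_Suc sum.lessThan_Suc eq
    by (simp add: sum.distrib algebra_simps)
  show ?case
    unfolding eqs by (simp add: rademacher_mean_snoc Suc algebra_simps)
qed

definition gauss :: "real measure" where
  "gauss = density lborel (\<lambda>t. ennreal (std_normal_density t))"

lemma sets_gauss [measurable_cong, simp]: "sets gauss = sets borel"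
  and space_gauss [simp]: "space gauss = UNIV"
  by (simp_all add: gauss_def)

interpretation gauss: prob_space gauss
  unfolding gauss_def by (rule prob_space_normal_density) simp

lemma nn_integral_gauss:
  "f \<in> borel_measurable borel \<Longrightarrow> (\<integral>\<^sup>+t. f t \<partial>gauss) = (\<integral>\<^sup>+t. ennreal (std_normal_density t) * f t \<partial>lborel)"
  by (simp add: gauss_def nn_integral_density)

lemma nn_integral_gauss_minus:
  assumes [measurable]: "f \<in> borel_measurable borel"
  shows "(\<integral>\<^sup>+t. f (- t) \<partial>gauss) = (\<integral>\<^sup>+t. f t \<partial>gauss)"
proof -
  have "(\<integral>\<^sup>+t. f t \<partial>gauss) = (\<integral>\<^sup>+t. ennreal (std_normal_density t) * f t \<partial>lborel)"
    by (rule nn_integral_gauss) simp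
  also have "\<dots> = (\<integral>\<^sup>+t. ennreal (std_normal_density (0 + (-1) * t)) * f (0 + (-1) * t) \<partial>lborel)"
    by (subst nn_integral_real_affine[where c = "-1" and t = 0]) auto
  also have "\<dots> = (\<integral>\<^sup>+t. f (- t) \<partial>gauss)"
    by (subst nn_integral_gauss) (auto simp: std_normal_density_def)
  finally show ?thesis ..
qed

lemma nn_integral_gauss_symmetrize:
  assumes [measurable]: "f \<in> borel_measurable borel"
  shows "(\<integral>\<^sup>+t. half * (f t + f (- t)) \<partial>gauss) = (\<integral>\<^sup>+t. f t \<partial>gauss)"
proof -
  have "(\<integral>\<^sup>+t. half * (f t + f (- t)) \<partial>gauss) =
      half * ((\<integral>\<^sup>+t. f t \<partial>gauss) + (\<integral>\<^sup>+t. f (- t) \<partial>gauss))"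
    by (subst nn_integral_cmult, measurable) (subst nn_integral_add, auto)
  then show ?thesis by (simp only: nn_integral_gauss_minus[OF assms] half_mult_add_self)
qed

text \<open>The density of the plane Gaussian measure depends only on \<open>t\<^sup>2 + r\<^sup>2\<close>. The rotation by a
  quarter of \<open>\<pi>\<close>, preceded by a reflection, is carried out as two affine substitutions in one
  variable each, whose Jacobians \<open>\<surd>2\<close> compensate each other.\<close>

lemma nn_integral_gauss_rotate:
  fixes f :: "real \<Rightarrow> real \<Rightarrow> ennreal"
  assumes f [measurable]: "(\<lambda>(t, r). f t r) \<in> borel_measurable (borel \<Otimes>\<^sub>M borel)"
  shows "(\<integral>\<^sup>+t. \<integral>\<^sup>+r. f ((t + r) / sqrt 2) ((t - r) / sqrt 2) \<partial>gauss \<partial>gauss) =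
    (\<integral>\<^sup>+t. \<integral>\<^sup>+r. f t r \<partial>gauss \<partial>gauss)"
proof -
  define g where "g t r = ennreal (std_normal_density t) * (ennreal (std_normal_density r) * f t r)" for t r
  have g [measurable]: "(\<lambda>(t, r). g t r) \<in> borel_measurable (borel \<Otimes>\<^sub>M borel)"
    unfolding g_def by measurable
  have dens: "(\<integral>\<^sup>+t. \<integral>\<^sup>+r. h t r \<partial>gauss \<partial>gauss) =
     (\<integral>\<^sup>+t. \<integral>\<^sup>+r. ennreal (std_normal_density t) * (ennreal (std_normal_density r) * h t r) \<partial>lborel \<partial>lborel)"
    if [measurable]: "(\<lambda>(t, r). h t r) \<in> borel_measurable (borel \<Otimes>\<^sub>M borel)" for h :: "real \<Rightarrow> real \<Rightarrow> ennreal"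
    by (simp add: nn_integral_gauss nn_integral_cmult)
  have rot: "std_normal_density t * std_normal_density r =
      std_normal_density ((t + r) / sqrt 2) * std_normal_density ((t - r) / sqrt 2)" for t r
  proof -
    have "((t + r) / sqrt 2)\<^sup>2 / 2 + ((t - r) / sqrt 2)\<^sup>2 / 2 = t\<^sup>2 / 2 + r\<^sup>2 / 2"
      by (simp add: power_divide power2_sum power2_diff field_simps)
    then have "exp (- (((t + r) / sqrt 2)\<^sup>2 / 2)) * exp (- (((t - r) / sqrt 2)\<^sup>2 / 2)) =
        exp (- (t\<^sup>2 / 2)) * exp (- (r\<^sup>2 / 2))"
      unfolding exp_add[symmetric] by (intro arg_cong[of _ _ exp]) linarith
    then show ?thesis
      by (simp add: std_normal_density_def)
  qed
  have "(\<integral>\<^sup>+t. \<integral>\<^sup>+r. f ((t + r) / sqrt 2) ((t - r) / sqrt 2) \<partial>gauss \<partial>gauss) =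
    (\<integral>\<^sup>+t. \<integral>\<^sup>+r. g ((t + r) / sqrt 2) ((t - r) / sqrt 2) \<partial>lborel \<partial>lborel)"
  proof (subst dens)
    show "(\<lambda>(t, r). f ((t + r) / sqrt 2) ((t - r) / sqrt 2)) \<in> borel_measurable (borel \<Otimes>\<^sub>M borel)"
      by measurable
    have "ennreal (std_normal_density t) * ennreal (std_normal_density r) =
        ennreal (std_normal_density ((t + r) / sqrt 2)) * ennreal (std_normal_density ((t - r) / sqrt 2))" for t r
      using arg_cong[OF rot[of t r], of ennreal] by (simp add: ennreal_mult)
    then have g_rot: "ennreal (std_normal_density t) * (ennreal (std_normal_density r) *
             f ((t + r) / sqrt 2) ((t - r) / sqrt 2)) = g ((t + r) / sqrt 2) ((t - r) / sqrt 2)" for t r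
      unfolding g_def mult.assoc[symmetric] by metis
    show "(\<integral>\<^sup>+t. \<integral>\<^sup>+r. ennreal (std_normal_density t) * (ennreal (std_normal_density r) *
             f ((t + r) / sqrt 2) ((t - r) / sqrt 2)) \<partial>lborel \<partial>lborel) =
      (\<integral>\<^sup>+t. \<integral>\<^sup>+r. g ((t + r) / sqrt 2) ((t - r) / sqrt 2) \<partial>lborel \<partial>lborel)"
      unfolding g_rot ..
  qed
  also have "\<dots> = (\<integral>\<^sup>+t. \<integral>\<^sup>+a. ennreal (sqrt 2) * g a (- a + sqrt 2 * t) \<partial>lborel \<partial>lborel)"
  proof (rule nn_integral_cong)
    fix t :: real
    have "t - (- t + sqrt 2 * a) = sqrt 2 * (- a + sqrt 2 * t)" for a
      by (simp add: algebra_simps)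
    then have e: "(t + (- t + sqrt 2 * a)) / sqrt 2 = a" "(t - (- t + sqrt 2 * a)) / sqrt 2 = - a + sqrt 2 * t" for a
      by simp_all
    have "(\<integral>\<^sup>+r. g ((t + r) / sqrt 2) ((t - r) / sqrt 2) \<partial>lborel) =
        ennreal \<bar>sqrt 2\<bar> * (\<integral>\<^sup>+a. g ((t + (- t + sqrt 2 * a)) / sqrt 2) ((t - (- t + sqrt 2 * a)) / sqrt 2) \<partial>lborel)"
      by (rule nn_integral_real_affine) auto
    then show "(\<integral>\<^sup>+r. g ((t + r) / sqrt 2) ((t - r) / sqrt 2) \<partial>lborel) =
        (\<integral>\<^sup>+a. ennreal (sqrt 2) * g a (- a + sqrt 2 * t) \<partial>lborel)"
      unfolding e by (simp add: nn_integral_cmult)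
  qed
  also have "\<dots> = (\<integral>\<^sup>+a. \<integral>\<^sup>+t. ennreal (sqrt 2) * g a (- a + sqrt 2 * t) \<partial>lborel \<partial>lborel)"
    by (rule lborel_pair.Fubini') measurable
  also have "\<dots> = (\<integral>\<^sup>+a. \<integral>\<^sup>+b. g a b \<partial>lborel \<partial>lborel)"
  proof (rule nn_integral_cong)
    fix a :: real
    have "(\<integral>\<^sup>+b. g a b \<partial>lborel) = ennreal \<bar>sqrt 2\<bar> * (\<integral>\<^sup>+t. g a (- a + sqrt 2 * t) \<partial>lborel)"
      by (rule nn_integral_real_affine) auto
    then show "(\<integral>\<^sup>+t. ennreal (sqrt 2) * g a (- a + sqrt 2 * t) \<partial>lborel) = (\<integral>\<^sup>+b. g a b \<partial>lborel)"
      by (simp add: nn_integral_cmult)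
  qed
  also have "\<dots> = (\<integral>\<^sup>+t. \<integral>\<^sup>+r. f t r \<partial>gauss \<partial>gauss)"
    unfolding g_def by (rule dens[OF f, symmetric])
  finally show ?thesis .
qed

lemma emeasure_gauss_UNIV [simp]: "emeasure gauss UNIV = 1"
  using gauss.emeasure_space_1 by simp

lemma nn_integral_gauss_square [simp]: "(\<integral>\<^sup>+t. ennreal (t\<^sup>2) \<partial>gauss) = 1"
proof -
  have *: "has_bochner_integral lborel (\<lambda>t. std_normal_density t * t\<^sup>2) 1"
    using std_normal_moment_even[of 1] by (simp add: fact_numeral)
  have "(\<integral>\<^sup>+t. ennreal (t\<^sup>2) \<partial>gauss) = (\<integral>\<^sup>+t. ennreal (std_normal_density t * t\<^sup>2) \<partial>lborel)"
    by (simp add: nn_integral_gauss ennreal_mult)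
  also have "\<dots> = ennreal (\<integral>t. std_normal_density t * t\<^sup>2 \<partial>lborel)"
    using * by (intro nn_integral_eq_integral) (auto simp: has_bochner_integral_iff)
  finally show ?thesis using * by (simp add: has_bochner_integral_iff)
qed

context real_vector_space
begin

text \<open>Measurability on finite-dimensional slices is all that iterated Gaussian integrals ask for, and
  it requires no measurable structure on the space itself.\<close>

definition line_measurable :: "('a \<Rightarrow> ennreal) \<Rightarrow> bool" where
  "line_measurable F \<longleftrightarrow>
     (\<forall>n z w. (\<lambda>t::nat \<Rightarrow> real. F (z + (\<Sum>k<n. s (t k) (w k)))) \<in> borel_measurable borel)"

primrec gauss_mean :: "('a \<Rightarrow> ennreal) \<Rightarrow> 'a list \<Rightarrow> 'a \<Rightarrow> ennreal" where
  "gauss_mean F [] z = F z"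
| "gauss_mean F (x # xs) z = (\<integral>\<^sup>+t. gauss_mean F xs (z + s t x) \<partial>gauss)"

lemma line_measurable2:
  assumes "line_measurable F"
  shows "(\<lambda>(t, r). F (z + s t x + s r y)) \<in> borel_measurable (borel \<Otimes>\<^sub>M borel)"
proof -
  let ?c = "\<lambda>p::real \<times> real. \<lambda>i::nat. if i = 0 then fst p else snd p"
  let ?w = "\<lambda>i::nat. if i = 0 then x else y"
  have [measurable]: "?c \<in> borel_measurable (borel \<Otimes>\<^sub>M borel)"
    by (rule measurable_coordinatewise_then_product) measurable
  have "(\<lambda>t::nat \<Rightarrow> real. F (z + (\<Sum>k<2. s (t k) (?w k)))) \<in> borel_measurable borel"
    using assms by (simp add: line_measurable_def)
  then have "(\<lambda>p. F (z + (\<Sum>k<2. s (?c p k) (?w k)))) \<in> borel_measurable (borel \<Otimes>\<^sub>M borel)"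
    by measurable
  moreover have "(\<Sum>k<2. s (?c p k) (?w k)) = s (fst p) x + s (snd p) y" for p
    by (simp add: numeral_2_eq_2)
  ultimately show ?thesis by (simp add: case_prod_unfold add.assoc)
qed

lemma line_measurable1:
  assumes "line_measurable F"
  shows "(\<lambda>t. F (z + s t x)) \<in> borel_measurable borel"
proof -
  have "(\<lambda>t. (t, 0::real)) \<in> borel \<rightarrow>\<^sub>M borel \<Otimes>\<^sub>M borel" by measurable
  from measurable_compose[OF this line_measurable2[OF assms, of z x 0]]
  show ?thesis by simp
qed

lemma line_measurable_gauss_integral:
  assumes "line_measurable F"
  shows "line_measurable (\<lambda>z. \<integral>\<^sup>+t. F (z + s t x) \<partial>gauss)"
  unfolding line_measurable_def
proof (intro allI)
  fix n z and w :: "nat \<Rightarrow> 'a"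
  let ?c = "\<lambda>p::(nat \<Rightarrow> real) \<times> real. \<lambda>i::nat. case i of 0 \<Rightarrow> snd p | Suc j \<Rightarrow> fst p j"
  let ?w = "case_nat x w"
  have [measurable]: "(\<lambda>p. fst p j) \<in> borel_measurable (borel \<Otimes>\<^sub>M borel)" for j :: nat
    by (rule measurable_compose[OF measurable_fst measurable_product_coordinates])
  have [measurable]: "?c \<in> borel_measurable (borel \<Otimes>\<^sub>M borel)"
  proof (rule measurable_coordinatewise_then_product)
    fix i show "(\<lambda>p. ?c p i) \<in> borel_measurable (borel \<Otimes>\<^sub>M borel)"
      by (cases i) auto
  qed
  have "(\<lambda>t::nat \<Rightarrow> real. F (z + (\<Sum>k<Suc n. s (t k) (?w k)))) \<in> borel_measurable borel"
    using assms unfolding line_measurable_def by blast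
  then have "(\<lambda>p. F (z + (\<Sum>k<Suc n. s (?c p k) (?w k)))) \<in> borel_measurable (borel \<Otimes>\<^sub>M borel)"
    by measurable
  moreover have "(\<Sum>k<Suc n. s (?c p k) (?w k)) = (\<Sum>k<n. s (fst p k) (w k)) + s (snd p) x" for p
    unfolding sum.lessThan_Suc_shift by (simp add: add.commute)
  ultimately have "(\<lambda>p. F (z + (\<Sum>k<n. s (fst p k) (w k)) + s (snd p) x)) \<in> borel_measurable (borel \<Otimes>\<^sub>M borel)"
    by (simp add: add.assoc)
  then have [measurable]: "(\<lambda>(\<tau>, t). F (z + (\<Sum>k<n. s (\<tau> k) (w k)) + s t x)) \<in> borel_measurable (borel \<Otimes>\<^sub>M gauss)"
    by (simp add: case_prod_unfold cong: measurable_cong_sets)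
  show "(\<lambda>\<tau>::nat \<Rightarrow> real. \<integral>\<^sup>+t. F (z + (\<Sum>k<n. s (\<tau> k) (w k)) + s t x) \<partial>gauss) \<in> borel_measurable borel"
    by measurable
qed

lemma line_measurable_gauss_mean:
  "line_measurable F \<Longrightarrow> line_measurable (gauss_mean F xs)"
proof (induction xs)
  case Nil
  have "gauss_mean F [] = F" by (rule ext) simp
  then show ?case using Nil by simp
next
  case (Cons x xs)
  have "gauss_mean F (x # xs) = (\<lambda>z. \<integral>\<^sup>+t. gauss_mean F xs (z + s t x) \<partial>gauss)" by (rule ext) simp
  then show ?case using line_measurable_gauss_integral[of "gauss_mean F xs" x] Cons by simp
qed

lemma gauss_mean_swap:
  assumes "line_measurable F"
  shows "gauss_mean F (x # y # zs) z = gauss_mean F (y # x # zs) z"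
proof -
  interpret pair_sigma_finite gauss gauss ..
  let ?H = "gauss_mean F zs"
  have "(\<lambda>(t, r). ?H (z + s t x + s r y)) \<in> borel_measurable (gauss \<Otimes>\<^sub>M gauss)"
    using line_measurable2[OF line_measurable_gauss_mean[OF assms], of zs z x y]
    by (simp cong: measurable_cong_sets)
  from Fubini'[OF this]
  show ?thesis by (simp add: algebra_simps)
qed

lemma gauss_mean_append_Cons:
  assumes "line_measurable F"
  shows "gauss_mean F (xs @ y # ys) z = gauss_mean F (y # xs @ ys) z"
proof (induction xs arbitrary: z)
  case (Cons x xs)
  then have "gauss_mean F ((x # xs) @ y # ys) z = gauss_mean F (x # y # xs @ ys) z" by simp
  also have "\<dots> = gauss_mean F (y # x # xs @ ys) z" by (rule gauss_mean_swap[OF assms])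
  finally show ?case by simp
qed simp

lemma gauss_mean_mset:
  assumes "line_measurable F" "mset xs = mset ys"
  shows "gauss_mean F xs z = gauss_mean F ys z"
  using assms(2)
proof (induction xs arbitrary: ys z)
  case (Cons x xs)
  then have "x \<in> set ys" by (metis list.set_intros(1) mset_eq_setD)
  then obtain ys1 ys2 where ys: "ys = ys1 @ x # ys2" by (meson split_list)
  then have "mset xs = mset (ys1 @ ys2)" using Cons.prems by simp
  then show ?case
    unfolding ys gauss_mean_append_Cons[OF assms(1)] gauss_mean.simps
    using Cons.IH[of "ys1 @ ys2"] by simp
qed simp

lemma gauss_mean_rotate:
  assumes "line_measurable F"
  shows "gauss_mean F (x # y # zs) z = gauss_mean F (s (1 / sqrt 2) (x + y) # s (1 / sqrt 2) (x - y) # zs) z"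
proof -
  let ?H = "gauss_mean F zs"
  have "(\<lambda>(t, r). ?H (z + s t x + s r y)) \<in> borel_measurable (borel \<Otimes>\<^sub>M borel)"
    by (rule line_measurable2[OF line_measurable_gauss_mean[OF assms]])
  from nn_integral_gauss_rotate[OF this, symmetric]
  show ?thesis
    by (simp add: scale_right_distrib scale_right_diff_distrib scale_left_distrib scale_left_diff_distrib
        add_divide_distrib diff_divide_distrib algebra_simps)
qed

lemma gauss_mean_zero [simp]: "gauss_mean F (0 # zs) z = gauss_mean F zs z"
  by simp

text \<open>Two copies of \<open>x\<close> and two of \<open>y\<close> have the same Gaussian average as the single pair
  \<open>x + y\<close>, \<open>x - y\<close>: rotate \<open>(x, x)\<close> into \<open>(\<surd>2 x, 0)\<close> and \<open>(y, y)\<close> into \<open>(\<surd>2 y, 0)\<close>, and then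
  rotate \<open>(\<surd>2 x, \<surd>2 y)\<close>.\<close>

lemma gauss_mean_parallelogram:
  assumes F: "line_measurable F"
  shows "gauss_mean F (x # x # y # y # zs) z = gauss_mean F ((x + y) # (x - y) # zs) z"
proof -
  have two: "gauss_mean F (v # v # vs) z' = gauss_mean F (s (sqrt 2) v # vs) z'" for v vs z'
  proof -
    have "s (1 / sqrt 2) (v + v) = s (sqrt 2) v"
      by (simp add: scale_right_distrib scale_left_distrib[symmetric] real_sqrt_divide real_div_sqrt)
    then have "gauss_mean F (v # v # vs) z' = gauss_mean F (s (sqrt 2) v # 0 # vs) z'"
      using gauss_mean_rotate[OF F, of v v vs z'] by simp
    also have "\<dots> = gauss_mean F (s (sqrt 2) v # vs) z'"
      unfolding gauss_mean_swap[OF F, of _ 0] by simp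
    finally show ?thesis .
  qed
  have "gauss_mean F (x # x # y # y # zs) z = gauss_mean F (s (sqrt 2) x # s (sqrt 2) y # zs) z"
    unfolding two[of x] gauss_mean.simps(2)[of F "s (sqrt 2) x"] two[of y] ..
  also have "\<dots> = gauss_mean F ((x + y) # (x - y) # zs) z"
  proof -
    have "s (1 / sqrt 2) (s (sqrt 2) x + s (sqrt 2) y) = x + y"
      "s (1 / sqrt 2) (s (sqrt 2) x - s (sqrt 2) y) = x - y"
      by (simp_all add: scale_right_distrib scale_right_diff_distrib)
    then show ?thesis
      using gauss_mean_rotate[OF F, of "s (sqrt 2) x" "s (sqrt 2) y" zs z] by simp
  qed
  finally show ?thesis .
qed

text \<open>Gaussian weights are symmetric, so random signs may be inserted into a Gaussian average;
  \<open>mixed_mean\<close> is the average in which this has been done. For fixed weights \<open>t\<^sub>i\<close> an inequality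
  for Rademacher averages applies to the vectors \<open>t\<^sub>i x\<^sub>i\<close>; since \<open>t\<^sub>i\<^sup>2\<close> has mean 1, integration
  yields the same inequality for Gaussian averages.\<close>

primrec mixed_mean :: "('a \<Rightarrow> ennreal) \<Rightarrow> 'a list \<Rightarrow> 'a list \<Rightarrow> 'a \<Rightarrow> ennreal" where
  "mixed_mean F [] ys z = rademacher_mean F ys z"
| "mixed_mean F (x # xs) ys z = (\<integral>\<^sup>+t. mixed_mean F xs (s t x # ys) z \<partial>gauss)"

lemma rademacher_mean_gauss_integral:
  assumes G: "line_measurable G"
  shows "(\<lambda>t. rademacher_mean G ys (z + s t x)) \<in> borel_measurable borel"
    and "(\<integral>\<^sup>+t. rademacher_mean G ys (z + s t x) \<partial>gauss) = rademacher_mean (\<lambda>z. \<integral>\<^sup>+t. G (z + s t x) \<partial>gauss) ys z"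
proof (induction ys arbitrary: z)
  case Nil
  { case 1 then show ?case using line_measurable1[OF G] by simp }
  { case 2 then show ?case by simp }
next
  case (Cons y ys)
  have e: "z + s t x + y = z + y + s t x" "z + s t x - y = z - y + s t x" for z t
    by (simp_all add: algebra_simps)
  note [measurable] = Cons(1)
  { case 1 show ?case unfolding rademacher_mean.simps e by measurable }
  { case 2 show ?case
      unfolding rademacher_mean.simps e
      by (simp add: nn_integral_cmult nn_integral_add Cons(2) cong: measurable_cong_sets) }
qed

lemma mixed_mean_eq:
  assumes F: "line_measurable F"
  shows "mixed_mean F xs ys z = rademacher_mean (gauss_mean F xs) ys z"
proof (induction xs arbitrary: ys)
  case Nil
  have "gauss_mean F [] = F" by (rule ext) simp
  then show ?case by simp
next
  case (Cons x xs)
  let ?G = "gauss_mean F xs"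
  let ?R = "\<lambda>t. rademacher_mean ?G ys (z + s t x)"
  note G = line_measurable_gauss_mean[OF F, of xs]
  have [measurable]: "?R \<in> borel_measurable borel"
    by (rule rademacher_mean_gauss_integral[OF G])
  have "mixed_mean F (x # xs) ys z = (\<integral>\<^sup>+t. half * (?R t + ?R (- t)) \<partial>gauss)"
    by (simp add: Cons)
  also have "\<dots> = (\<integral>\<^sup>+t. ?R t \<partial>gauss)"
    by (rule nn_integral_gauss_symmetrize) measurable
  also have "\<dots> = rademacher_mean (gauss_mean F (x # xs)) ys z"
  proof -
    have "gauss_mean F (x # xs) = (\<lambda>z. \<integral>\<^sup>+t. ?G (z + s t x) \<partial>gauss)" by (rule ext) simp
    then show ?thesis using rademacher_mean_gauss_integral(2)[OF G, of ys z x] by simp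
  qed
  finally show ?case .
qed

lemma mixed_mean_le:
  assumes le: "\<And>ys. rademacher_mean F (map u ys) 0 \<le> (\<Sum>y\<leftarrow>ys. B y)"
    and u: "\<And>t x. u (sx t x) = s t (u x)"
    and B: "\<And>t x. B (sx t x) = ennreal (t\<^sup>2) * B x"
  shows "mixed_mean F (map u xs) (map u ys) 0 \<le> (\<Sum>x\<leftarrow>xs. B x) + (\<Sum>y\<leftarrow>ys. B y)"
proof (induction xs arbitrary: ys)
  case Nil
  then show ?case using le by simp
next
  case (Cons x xs)
  have "mixed_mean F (map u (x # xs)) (map u ys) 0 = (\<integral>\<^sup>+t. mixed_mean F (map u xs) (map u (sx t x # ys)) 0 \<partial>gauss)"
    by (simp add: u)
  also have "\<dots> \<le> (\<integral>\<^sup>+t. ennreal (t\<^sup>2) * B x + ((\<Sum>x\<leftarrow>xs. B x) + (\<Sum>y\<leftarrow>ys. B y)) \<partial>gauss)"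
    by (intro nn_integral_mono order_trans[OF Cons]) (simp add: B algebra_simps)
  also have "\<dots> = B x + ((\<Sum>x\<leftarrow>xs. B x) + (\<Sum>y\<leftarrow>ys. B y))"
    by (subst nn_integral_add) (auto simp: nn_integral_multc cong: measurable_cong_sets)
  finally show ?case by (simp add: algebra_simps)
qed

lemma mixed_mean_ge:
  assumes ge: "\<And>ys. (\<Sum>y\<leftarrow>ys. B y) \<le> rademacher_mean F ys 0"
    and B: "\<And>t x. B (s t x) = ennreal (t\<^sup>2) * B x"
  shows "(\<Sum>x\<leftarrow>xs. B x) + (\<Sum>y\<leftarrow>ys. B y) \<le> mixed_mean F xs ys 0"
proof (induction xs arbitrary: ys)
  case Nil
  then show ?case using ge by simp
next
  case (Cons x xs)
  have "(\<Sum>x\<leftarrow>x # xs. B x) + (\<Sum>y\<leftarrow>ys. B y) =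
      B x + ((\<Sum>x\<leftarrow>xs. B x) + (\<Sum>y\<leftarrow>ys. B y))"
    by (simp add: algebra_simps)
  also have "\<dots> = (\<integral>\<^sup>+t. ennreal (t\<^sup>2) * B x + ((\<Sum>x\<leftarrow>xs. B x) + (\<Sum>y\<leftarrow>ys. B y)) \<partial>gauss)"
    by (subst nn_integral_add) (auto simp: nn_integral_multc cong: measurable_cong_sets)
  also have "\<dots> \<le> (\<integral>\<^sup>+t. mixed_mean F xs (s t x # ys) 0 \<partial>gauss)"
    by (intro nn_integral_mono order_trans[OF _ Cons]) (simp add: B algebra_simps)
  finally show ?case by simp
qed

lemma gauss_mean_le:
  assumes "line_measurable F" "\<And>ys. rademacher_mean F (map u ys) 0 \<le> (\<Sum>y\<leftarrow>ys. B y)"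
    "\<And>t x. u (sx t x) = s t (u x)" "\<And>t x. B (sx t x) = ennreal (t\<^sup>2) * B x"
  shows "gauss_mean F (map u xs) 0 \<le> (\<Sum>x\<leftarrow>xs. B x)"
  using mixed_mean_le[OF assms(2-), of xs "[]"] by (simp add: mixed_mean_eq[OF assms(1)])

lemma gauss_mean_ge:
  assumes "line_measurable F" "\<And>ys. (\<Sum>y\<leftarrow>ys. B y) \<le> rademacher_mean F ys 0"
    "\<And>t x. B (s t x) = ennreal (t\<^sup>2) * B x"
  shows "(\<Sum>x\<leftarrow>xs. B x) \<le> gauss_mean F xs 0"
  using mixed_mean_ge[OF assms(2-), of xs "[]"] by (simp add: mixed_mean_eq[OF assms(1)])

end

context qnorm
begin

definition rad_sq :: "nat \<Rightarrow> (nat \<Rightarrow> 'a) \<Rightarrow> real" where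
  "rad_sq N x = (\<Sum>\<epsilon>\<in>sign_vectors N. (q (\<Sum>i<N. s (\<epsilon> i) (x i)))\<^sup>2) / 2 ^ N"

definition has_cotype2 :: "real \<Rightarrow> bool" where
  "has_cotype2 C \<longleftrightarrow> (\<forall>N x. (\<Sum>i<N. (q (x i))\<^sup>2) \<le> C\<^sup>2 * rad_sq N x)"

lemma rademacher_mean_sq:
  assumes "0 \<le> c"
  shows "rademacher_mean (\<lambda>y. ennreal (c * (q y)\<^sup>2)) (map w [0..<N]) 0 = ennreal (c * rad_sq N w)"
proof -
  have "(\<Sum>i<N. if \<epsilon> i = 1 then w i else - w i) = (\<Sum>i<N. s (\<epsilon> i) (w i))"
    if "\<epsilon> \<in> sign_vectors N" for \<epsilon>
  proof (rule sum.cong[OF refl])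
    fix i assume "i \<in> {..<N}"
    then have "\<epsilon> i \<in> {-1, 1}" using that by (auto simp: sign_vectors_def PiE_def)
    then show "(if \<epsilon> i = 1 then w i else - w i) = s (\<epsilon> i) (w i)" by auto
  qed
  then have "(\<Sum>\<epsilon>\<in>sign_vectors N. ennreal (c * (q (0 + (\<Sum>i<N. if \<epsilon> i = 1 then w i else - w i)))\<^sup>2)) =
      (\<Sum>\<epsilon>\<in>sign_vectors N. ennreal (c * (q (\<Sum>i<N. s (\<epsilon> i) (w i)))\<^sup>2))"
    by (intro sum.cong) auto
  also have "\<dots> = ennreal (\<Sum>\<epsilon>\<in>sign_vectors N. c * (q (\<Sum>i<N. s (\<epsilon> i) (w i)))\<^sup>2)"
    using assms by (intro sum_ennreal) auto
  finally have *: "(\<Sum>\<epsilon>\<in>sign_vectors N. ennreal (c * (q (0 + (\<Sum>i<N. if \<epsilon> i = 1 then w i else - w i)))\<^sup>2)) =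
     ennreal (\<Sum>\<epsilon>\<in>sign_vectors N. c * (q (\<Sum>i<N. s (\<epsilon> i) (w i)))\<^sup>2)" .
  have "half ^ N = ennreal ((1/2) ^ N)" by (subst ennreal_power) auto
  moreover have "0 \<le> (\<Sum>\<epsilon>\<in>sign_vectors N. c * (q (\<Sum>i<N. s (\<epsilon> i) (w i)))\<^sup>2)"
    using assms by (intro sum_nonneg) auto
  ultimately show ?thesis
    unfolding rademacher_mean_eq_sum * rad_sq_def
    by (simp only: ennreal_mult[symmetric] zero_le_power zero_le_divide_1_iff zero_le_numeral)
      (simp add: sum_distrib_left[symmetric] power_one_over)
qed

lemma rad_sq_nonneg [simp]: "0 \<le> rad_sq N x"
  by (simp add: rad_sq_def sum_nonneg)

lemma line_measurable_sq:
  assumes "continuous_combinations"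
  shows "line_measurable (\<lambda>y. ennreal (c * (q y)\<^sup>2))"
  unfolding line_measurable_def
proof (intro allI)
  fix n z w
  have "continuous_on UNIV (\<lambda>t::nat \<Rightarrow> real. q (z + (\<Sum>k<n. s (t k) (w k))))"
    using assms by (simp add: continuous_combinations_def)
  then have [measurable]: "(\<lambda>t::nat \<Rightarrow> real. q (z + (\<Sum>k<n. s (t k) (w k)))) \<in> borel_measurable borel"
    by (rule borel_measurable_continuous_onI)
  show "(\<lambda>t::nat \<Rightarrow> real. ennreal (c * (q (z + (\<Sum>k<n. s (t k) (w k))))\<^sup>2)) \<in> borel_measurable borel"
    by measurable
qed

end

section \<open>Quadratic forms between two bounds\<close>

definition parallelogram_law :: "('a::ab_group_add \<Rightarrow> real) \<Rightarrow> bool" where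
  "parallelogram_law \<phi> \<longleftrightarrow> (\<forall>x y. \<phi> (x + y) + \<phi> (x - y) = 2 * \<phi> x + 2 * \<phi> y)"

text \<open>The free abelian group on the vectors: a functional on it is an arbitrary function of one
  vector, and the parallelogram law is a linear condition on such functionals.\<close>

definition formal_sum :: "'a list \<Rightarrow> 'a \<Rightarrow>\<^sub>0 int" where
  "formal_sum xs = (\<Sum>x\<leftarrow>xs. Poly_Mapping.single x 1)"

lemma formal_sum_simps [simp]:
  "formal_sum [] = 0" "formal_sum (x # xs) = Poly_Mapping.single x 1 + formal_sum xs"
  "formal_sum (xs @ ys) = formal_sum xs + formal_sum ys"
  by (simp_all add: formal_sum_def)

lemma lookup_formal_sum: "Poly_Mapping.lookup (formal_sum xs) x = int (count (mset xs) x)"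
  by (induction xs) (auto simp: lookup_add lookup_single when_def)

lemma formal_sum_eq_iff: "formal_sum xs = formal_sum ys \<longleftrightarrow> mset xs = mset ys"
  by (auto simp: poly_mapping_eq_iff fun_eq_iff lookup_formal_sum multiset_eq_iff)

lemma formal_sum_replicate: "formal_sum (replicate n x) = Poly_Mapping.single x (int n)"
  by (induction n) (auto simp: single_add[symmetric] algebra_simps)

lemma formal_sum_surj: "\<exists>xs ys. g = formal_sum xs - formal_sum ys"
proof (induction g rule: update_induct)
  case const
  have "0 = formal_sum [] - formal_sum ([] :: 'a list)" by simp
  then show ?case by blast
next
  case (update f a b)
  have "Poly_Mapping.update a b f = Poly_Mapping.single a b + f"
    using update(1) by (intro poly_mapping_eqI) (auto simp: lookup_update lookup_add lookup_single in_keys_iff when_def)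
  moreover have "Poly_Mapping.single a b =
      formal_sum (replicate (nat b) a) - formal_sum (replicate (nat (- b)) a)"
    by (simp add: formal_sum_replicate single_diff[symmetric])
  moreover obtain xs ys where "f = formal_sum xs - formal_sum ys" using update(3) by blast
  ultimately have "Poly_Mapping.update a b f =
      formal_sum (replicate (nat b) a @ xs) - formal_sum (replicate (nat (- b)) a @ ys)"
    by simp
  then show ?case by blast
qed

text \<open>The two inequalities are compared along the congruence generated by the parallelogram law:
  after \<open>M\<close>-fold repetition the part \<open>L\<close> that was added on both sides is negligible.\<close>

theorem quadratic_form_between:
  fixes a b :: "'a::ab_group_add \<Rightarrow> real" and G :: "'a list \<Rightarrow> ennreal"
  assumes G_mset: "\<And>xs ys. mset xs = mset ys \<Longrightarrow> G xs = G ys"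
    and G_par: "\<And>x y zs. G (x # x # y # y # zs) = G ((x + y) # (x - y) # zs)"
    and a0: "\<And>x. 0 \<le> a x" and b0: "\<And>x. 0 \<le> b x"
    and aG: "\<And>xs. ennreal (\<Sum>x\<leftarrow>xs. a x) \<le> G xs" and Gb: "\<And>xs. G xs \<le> ennreal (\<Sum>x\<leftarrow>xs. b x)"
  obtains \<phi> where "parallelogram_law \<phi>" "\<And>x. a x \<le> \<phi> x" "\<And>x. \<phi> x \<le> b x"
proof -
  define A where "A xs = (\<Sum>x\<leftarrow>xs. a x)" for xs
  define B where "B xs = (\<Sum>x\<leftarrow>xs. b x)" for xs
  have B_nonneg: "0 \<le> B xs" for xs by (auto simp: B_def intro!: sum_list_nonneg b0)
  \<comment> \<open>\<open>inv L L'\<close>: the two lists may be exchanged inside \<open>G\<close>; \<open>R\<close> collects the resulting relations\<close>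
  define inv where "inv L L' \<longleftrightarrow> (\<forall>zs. G (L @ zs) = G (L' @ zs))" for L L'
  define R where "R = {formal_sum L - formal_sum L' | L L'. inv L L'}"
  have inv_app: "inv (L @ M) (L' @ M')" if "inv L L'" "inv M M'" for L L' M M'
    unfolding inv_def
  proof
    fix zs
    have "G ((L @ M) @ zs) = G (L' @ M @ zs)" using that(1) by (simp add: inv_def)
    also have "\<dots> = G (M @ L' @ zs)" by (rule G_mset) simp
    also have "\<dots> = G (M' @ L' @ zs)" using that(2) by (simp add: inv_def)
    also have "\<dots> = G ((L' @ M') @ zs)" by (rule G_mset) simp
    finally show "G ((L @ M) @ zs) = G ((L' @ M') @ zs)" .
  qed
  have R_I: "formal_sum L - formal_sum L' \<in> R" if "inv L L'" for L L'
    unfolding R_def using that by blast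
  have R_add: "r + r' \<in> R" if rr: "r \<in> R" "r' \<in> R" for r r'
  proof -
    obtain L L' where r: "r = formal_sum L - formal_sum L'" "inv L L'"
      using rr(1) unfolding R_def by blast
    obtain M M' where r': "r' = formal_sum M - formal_sum M'" "inv M M'"
      using rr(2) unfolding R_def by blast
    have "r + r' = formal_sum (L @ M) - formal_sum (L' @ M')"
      unfolding r(1) r'(1) formal_sum_simps by (rule add_diff_add[symmetric])
    then show ?thesis using R_I[OF inv_app[OF r(2) r'(2)]] by (simp only:)
  qed
  have R_0: "0 \<in> R"
    using R_I[of "[]" "[]"] by (simp add: inv_def)
  have key: "A ys \<le> B xs" if in_R: "formal_sum ys - formal_sum xs \<in> R" for xs ys
  proof -
    obtain L L' where inv: "inv L L'" and eq: "formal_sum ys - formal_sum xs = formal_sum L - formal_sum L'"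
      using in_R unfolding R_def by blast
    have "formal_sum ys + formal_sum L' = (formal_sum ys - formal_sum xs) + (formal_sum xs + formal_sum L')"
      by simp
    also have "\<dots> = formal_sum xs + formal_sum L" unfolding eq by simp
    finally have "formal_sum (ys @ L') = formal_sum (xs @ L)" by simp
    then have m: "mset (ys @ L') = mset (xs @ L)" by (simp only: formal_sum_eq_iff)
    have step: "G (ys @ L' @ Z) = G (xs @ L' @ Z)" for Z
    proof -
      have "G (ys @ L' @ Z) = G (L @ xs @ Z)"
        using m by (intro G_mset) (simp add: ac_simps)
      also have "\<dots> = G (L' @ xs @ Z)" using inv by (simp add: inv_def)
      also have "\<dots> = G (xs @ L' @ Z)" by (rule G_mset) simp
      finally show ?thesis .
    qed
    have copies: "G (concat (replicate M ys) @ L' @ Z) = G (concat (replicate M xs) @ L' @ Z)" for M Z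
    proof (induction M arbitrary: Z)
      case (Suc M)
      have "G (concat (replicate (Suc M) ys) @ L' @ Z) = G (concat (replicate M ys) @ L' @ (ys @ Z))"
        by (rule G_mset) simp
      also have "\<dots> = G (concat (replicate M xs) @ L' @ (ys @ Z))" by (rule Suc)
      also have "\<dots> = G (ys @ L' @ (concat (replicate M xs) @ Z))" by (rule G_mset) simp
      also have "\<dots> = G (xs @ L' @ (concat (replicate M xs) @ Z))" by (rule step)
      also have "\<dots> = G (concat (replicate (Suc M) xs) @ L' @ Z)" by (rule G_mset) simp
      finally show ?case .
    qed simp
    have A_rep: "A (concat (replicate M ys) @ zs) = real M * A ys + A zs" for M zs
      by (induction M) (simp_all add: A_def algebra_simps)
    have B_rep: "B (concat (replicate M xs) @ zs) = real M * B xs + B zs" for M zs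
      by (induction M) (simp_all add: B_def algebra_simps)
    have A_L: "0 \<le> A L'" by (auto simp: A_def intro!: sum_list_nonneg a0)
    have "real M * A ys \<le> real M * B xs + B L'" for M
    proof -
      have "ennreal (A (concat (replicate M ys) @ L')) \<le> ennreal (B (concat (replicate M xs) @ L'))"
        using aG[of "concat (replicate M ys) @ L'"] Gb[of "concat (replicate M xs) @ L'"] copies[of M "[]"]
        unfolding A_def B_def by simp
      then have "A (concat (replicate M ys) @ L') \<le> B (concat (replicate M xs) @ L')"
        using B_nonneg by (simp add: ennreal_le_iff)
      then show ?thesis using A_rep B_rep A_L by simp
    qed
    then have M: "real M * (A ys - B xs) \<le> B L'" for M by (simp add: algebra_simps)
    show ?thesis
    proof (rule ccontr)
      assume "\<not> ?thesis"
      then have "0 < A ys - B xs" by simp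
      then obtain M where "B L' < real M * (A ys - B xs)" using reals_Archimedean3 by blast
      then show False using M[of M] by simp
    qed
  qed
  \<comment> \<open>Below the infimum of \<open>V g\<close> an additive function vanishes on \<open>R\<close>, is at most \<open>b x\<close> at the
    generator \<open>x\<close> and at most \<open>- a x\<close> at its negative; \<open>key\<close> says that the infimum is finite.\<close>
  define V where "V g = {B xs - A ys | xs ys. g + formal_sum ys - formal_sum xs \<in> R}" for g
  have V_I: "B xs - A ys \<in> V g" if "g + formal_sum ys - formal_sum xs \<in> R" for g xs ys
    unfolding V_def using that by blast
  have V_add: "v + w \<in> V (g + h)" if vw: "v \<in> V g" "w \<in> V h" for v w g h
  proof -
    obtain xs ys xs' ys' where v: "v = B xs - A ys" "g + formal_sum ys - formal_sum xs \<in> R"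
      and w: "w = B xs' - A ys'" "h + formal_sum ys' - formal_sum xs' \<in> R"
      using vw by (auto simp: V_def)
    have "(g + h) + formal_sum (ys @ ys') - formal_sum (xs @ xs') \<in> R"
      using R_add[OF v(2) w(2)] by (simp add: algebra_simps)
    moreover have "v + w = B (xs @ xs') - A (ys @ ys')" by (simp add: v w A_def B_def)
    ultimately show ?thesis using V_I by simp
  qed
  have V_0: "0 \<le> v" if "v \<in> V 0" for v
    using that key by (auto simp: V_def)
  have V_ne: "V g \<noteq> {}" for g
  proof -
    obtain xs ys where "g = formal_sum xs - formal_sum ys" using formal_sum_surj by blast
    then have "g + formal_sum ys - formal_sum xs = 0" by simp
    then have "g + formal_sum ys - formal_sum xs \<in> R" using R_0 by (simp only:)
    from V_I[OF this] show ?thesis by blast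
  qed
  have V_bdd: "bdd_below (V g)" for g
  proof -
    obtain w where w: "w \<in> V (- g)" using V_ne[of "- g"] by blast
    have "- w \<le> v" if "v \<in> V g" for v
      using V_0[of "v + w"] V_add[OF that w] by simp
    then show ?thesis by (rule bdd_belowI)
  qed
  define P where "P g = Inf (V g)" for g
  have P_le: "P g \<le> v" if "v \<in> V g" for g v unfolding P_def by (rule cInf_lower[OF that V_bdd])
  have "P (g + h) \<le> P g + P h" for g h
  proof -
    have "P (g + h) - w \<le> P g" if "w \<in> V h" for w
      unfolding P_def[of g]
    proof (rule cInf_greatest[OF V_ne])
      fix v assume "v \<in> V g"
      then show "P (g + h) - w \<le> v" using P_le[OF V_add[OF _ that]] by fastforce
    qed
    then have "P (g + h) - P g \<le> P h"
      unfolding P_def[of h] by (intro cInf_greatest[OF V_ne]) fastforce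
    then show ?thesis by simp
  qed
  then have "subadditive_fun P" by (simp add: subadditive_fun_def)
  then obtain f where f_add: "\<And>g h. f (g + h) = f g + f h" and f_le: "\<And>g. f g \<le> P g"
    using additive_minorant by blast
  have f_0: "f 0 = 0" using f_add[of 0 0] by simp
  have f_minus: "f (- g) = - f g" for g using f_add[of g "- g"] f_0 by simp
  have f_diff: "f (g - h) = f g - f h" for g h using f_add[of g "- h"] f_minus[of h] by simp
  have f_R: "f r \<le> 0" if "r \<in> R" for r
  proof -
    have "0 \<in> V r" using V_I[of r "[]" "[]"] that by (simp add: A_def B_def)
    from P_le[OF this] show ?thesis using f_le[of r] by simp
  qed
  define \<phi> where "\<phi> x = f (Poly_Mapping.single x 1)" for x
  show thesis
  proof
    show "parallelogram_law \<phi>"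
      unfolding parallelogram_law_def
    proof (intro allI)
      fix x y :: 'a
      have inv: "inv [x, x, y, y] [x + y, x - y]" by (simp add: inv_def G_par)
      then have inv': "inv [x + y, x - y] [x, x, y, y]" by (simp add: inv_def)
      have "f (formal_sum [x, x, y, y]) = f (formal_sum [x + y, x - y])"
        using f_R[OF R_I[OF inv]] f_R[OF R_I[OF inv']] unfolding f_diff by linarith
      then show "\<phi> (x + y) + \<phi> (x - y) = 2 * \<phi> x + 2 * \<phi> y"
        unfolding formal_sum_simps f_add f_0 \<phi>_def by linarith
    qed
    fix x
    have "- a x \<in> V (- Poly_Mapping.single x 1)"
      using V_I[of "- Poly_Mapping.single x 1" "[x]" "[]"] R_0 by (simp add: A_def B_def)
    from P_le[OF this] show "a x \<le> \<phi> x"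
      using f_le[of "- Poly_Mapping.single x 1"] f_minus[of "Poly_Mapping.single x 1"]
      unfolding \<phi>_def by simp
    have "b x \<in> V (Poly_Mapping.single x 1)"
      using V_I[of "Poly_Mapping.single x 1" "[]" "[x]"] R_0 by (simp add: A_def B_def)
    from P_le[OF this] show "\<phi> x \<le> b x"
      using f_le[of "Poly_Mapping.single x 1"] unfolding \<phi>_def by simp
  qed
qed

locale real_operator = X: qnorm sx p Kx + Y: qnorm sy q Ky
  for sx :: "real \<Rightarrow> 'a::ab_group_add \<Rightarrow> 'a" and p Kx
    and sy :: "real \<Rightarrow> 'b::ab_group_add \<Rightarrow> 'b" and q Ky +
  fixes u :: "'a \<Rightarrow> 'b"
  assumes u_add: "u (x + y) = u x + u y"
    and u_scale: "u (sx c x) = sy c (u x)"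
begin

definition has_type2 :: "real \<Rightarrow> bool" where
  "has_type2 \<tau> \<longleftrightarrow> (\<forall>N x. Y.rad_sq N (\<lambda>i. u (x i)) \<le> \<tau>\<^sup>2 * (\<Sum>i<N. (p (x i))\<^sup>2))"

lemma u_minus: "u (- x) = - u x"
  using u_scale[of "-1" x] by simp

lemma u_diff: "u (x - y) = u x - u y"
  using u_add[of x "- y"] by (simp add: u_minus)

lemma u_0 [simp]: "u 0 = 0"
  using u_scale[of 0 0] by simp

lemma u_sum: "u (\<Sum>i\<in>A. f i) = (\<Sum>i\<in>A. u (f i))"
  by (induction A rule: infinite_finite_induct) (simp_all add: u_add)

text \<open>The Gaussian average of the square of the norm takes the part of \<open>G\<close>: unlike the Rademacher
  average it is invariant under the parallelogram moves.\<close>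

theorem type2_cotype2_quadratic_form:
  assumes cont: "Y.continuous_combinations" and C: "Y.has_cotype2 C" and \<tau>: "has_type2 \<tau>"
  obtains \<phi> where "parallelogram_law \<phi>" "\<And>x. (q (u x))\<^sup>2 \<le> \<phi> x" "\<And>x. \<phi> x \<le> (C * \<tau> * p x)\<^sup>2"
proof -
  define F where "F = (\<lambda>y. ennreal (C\<^sup>2 * (q y)\<^sup>2))"
  have F: "Y.line_measurable F" unfolding F_def by (rule Y.line_measurable_sq[OF cont])
  have list: "map (\<lambda>i. f (xs ! i)) [0..<length xs] = map f xs" for f :: "'c \<Rightarrow> 'd" and xs
    by (rule nth_equalityI) auto
  have sum_list_nth: "(\<Sum>x\<leftarrow>xs. f x) = (\<Sum>i<length xs. f (xs ! i))" for f :: "'c \<Rightarrow> real" and xs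
    by (simp add: sum_list_sum_nth atLeast0LessThan)
  have ennreal_list: "(\<Sum>x\<leftarrow>xs. ennreal (f x)) = ennreal (\<Sum>x\<leftarrow>xs. f x)" if "\<And>x. 0 \<le> f x" for f :: "'c \<Rightarrow> real" and xs
  proof (induction xs)
    case (Cons a xs)
    have "0 \<le> (\<Sum>x\<leftarrow>xs. f x)" using that by (auto intro!: sum_list_nonneg)
    then show ?case using Cons that[of a] by simp
  qed simp
  have up: "rademacher_mean F (map u xs) 0 \<le> (\<Sum>x\<leftarrow>xs. ennreal ((C * \<tau> * p x)\<^sup>2))" for xs
  proof -
    have "rademacher_mean F (map u xs) 0 = ennreal (C\<^sup>2 * Y.rad_sq (length xs) (\<lambda>i. u (xs ! i)))"
      unfolding F_def by (subst Y.rademacher_mean_sq[symmetric]) (simp_all add: list)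
    also have "\<dots> \<le> ennreal (C\<^sup>2 * (\<tau>\<^sup>2 * (\<Sum>i<length xs. (p (xs ! i))\<^sup>2)))"
      using \<tau> by (intro ennreal_leI mult_left_mono) (auto simp: has_type2_def)
    also have "\<dots> = ennreal (\<Sum>x\<leftarrow>xs. (C * \<tau> * p x)\<^sup>2)"
      by (simp add: sum_list_nth power_mult_distrib sum_distrib_left mult.assoc)
    finally show ?thesis by (simp add: ennreal_list)
  qed
  have low: "(\<Sum>y\<leftarrow>ys. ennreal ((q y)\<^sup>2)) \<le> rademacher_mean F ys 0" for ys
  proof -
    have "(\<Sum>y\<leftarrow>ys. ennreal ((q y)\<^sup>2)) = ennreal (\<Sum>i<length ys. (q (ys ! i))\<^sup>2)"
      by (simp add: ennreal_list sum_list_nth)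
    also have "\<dots> \<le> ennreal (C\<^sup>2 * Y.rad_sq (length ys) (\<lambda>i. ys ! i))"
      using C by (intro ennreal_leI) (auto simp: Y.has_cotype2_def)
    also have "\<dots> = rademacher_mean F ys 0"
      unfolding F_def by (subst Y.rademacher_mean_sq[symmetric]) (simp_all add: map_nth)
    finally show ?thesis .
  qed
  show thesis
  proof (rule quadratic_form_between)
    show "Y.gauss_mean F (map u xs) 0 = Y.gauss_mean F (map u ys) 0" if "mset xs = mset ys" for xs ys
      using that by (intro Y.gauss_mean_mset[OF F]) simp
    show "Y.gauss_mean F (map u (x # x # y # y # zs)) 0 = Y.gauss_mean F (map u ((x + y) # (x - y) # zs)) 0" for x y zs
      using Y.gauss_mean_parallelogram[OF F] by (simp only: list.map u_add u_diff)
    show "Y.gauss_mean F (map u xs) 0 \<le> ennreal (\<Sum>x\<leftarrow>xs. (C * \<tau> * p x)\<^sup>2)" for xs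
      using Y.gauss_mean_le[OF F up, where sx = sx and xs = xs]
      by (simp add: u_scale ennreal_list power_mult_distrib ennreal_mult[symmetric] mult_ac)
    show "ennreal (\<Sum>x\<leftarrow>xs. (q (u x))\<^sup>2) \<le> Y.gauss_mean F (map u xs) 0" for xs
      using Y.gauss_mean_ge[OF F low, where xs = "map u xs"]
      by (simp add: ennreal_list power_mult_distrib ennreal_mult[symmetric] comp_def)
  qed (use that in auto)
qed

end

section \<open>Quadratic forms on a quasi-normed space\<close>

text \<open>After a linear function has been subtracted, \<open>g\<close> vanishes at the integers. It is then periodic,
  hence bounded on the whole line, and a bounded additive function is zero.\<close>

lemma additive_bounded_linear:
  fixes g :: "real \<Rightarrow> real"
  assumes add: "\<And>s t. g (s + t) = g s + g t" and bdd: "\<And>t. \<bar>t\<bar> \<le> 1 \<Longrightarrow> \<bar>g t\<bar> \<le> M"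
  shows "g t = t * g 1"
proof -
  define h where "h t = g t - t * g 1" for t
  have h_add: "h (s + t) = h s + h t" for s t by (simp add: h_def add algebra_simps)
  have h_0: "h 0 = 0" using h_add[of 0 0] by simp
  have h_minus: "h (- t) = - h t" for t using h_add[of t "- t"] h_0 by simp
  have h_1: "h 1 = 0" by (simp add: h_def)
  have h_nat: "h (real n * t) = real n * h t" for n t
    by (induction n) (simp_all add: h_0 h_add algebra_simps)
  have h_int: "h (of_int k) = 0" for k
  proof (cases k)
    case (nonneg n)
    then show ?thesis using h_nat[of n 1] h_1 by simp
  next
    case (neg n)
    then show ?thesis using h_nat[of "Suc n" 1] h_1 h_minus[of "of_nat (Suc n)"] by simp
  qed
  have h_bdd: "\<bar>h t\<bar> \<le> M + \<bar>g 1\<bar>" for t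
  proof -
    have "h t = h (frac t)" using h_add[of "of_int \<lfloor>t\<rfloor>" "frac t"] h_int by (simp add: frac_def)
    moreover have "\<bar>g (frac t)\<bar> \<le> M" by (rule bdd) (use frac_ge_0[of t] frac_lt_1[of t] in linarith)
    moreover have "\<bar>frac t * g 1\<bar> \<le> 1 * \<bar>g 1\<bar>"
      unfolding abs_mult by (intro mult_right_mono) (simp_all add: frac_lt_1 less_imp_le)
    ultimately show ?thesis unfolding h_def by linarith
  qed
  have "h t = 0"
  proof (rule ccontr)
    assume "h t \<noteq> 0"
    then obtain n where "M + \<bar>g 1\<bar> < real n * \<bar>h t\<bar>" using reals_Archimedean3[of "\<bar>h t\<bar>"] by auto
    then show False using h_bdd[of "real n * t"] by (simp add: h_nat abs_mult)
  qed
  then show ?thesis by (simp add: h_def)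
qed

locale quadratic_form = qnorm s p K for s :: "real \<Rightarrow> 'a::ab_group_add \<Rightarrow> 'a" and p K +
  fixes \<phi> :: "'a \<Rightarrow> real" and \<gamma> :: real
  assumes par: "parallelogram_law \<phi>"
    and form_nonneg [simp]: "0 \<le> \<phi> x"
    and form_le: "\<phi> x \<le> (\<gamma> * p x)\<^sup>2"
    and \<gamma>_nonneg: "0 \<le> \<gamma>"
begin

definition B :: "'a \<Rightarrow> 'a \<Rightarrow> real" where "B x y = (\<phi> (x + y) - \<phi> x - \<phi> y) / 2"

lemma parallelogram: "\<phi> (x + y) + \<phi> (x - y) = 2 * \<phi> x + 2 * \<phi> y"
  using par by (simp add: parallelogram_law_def)

lemma form_0 [simp]: "\<phi> 0 = 0"
  using parallelogram[of 0 0] by simp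

lemma form_minus [simp]: "\<phi> (- x) = \<phi> x"
  using parallelogram[of 0 x] by simp

lemma form_add: "\<phi> (x + y) = \<phi> x + 2 * B x y + \<phi> y"
  by (simp add: B_def field_simps)

lemma B_commute: "B x y = B y x"
  by (simp add: B_def add.commute)

lemma B_add_left: "B (x + y) z = B x z + B y z"
proof -
  have "\<phi> (x + z + y) + \<phi> (x + z - y) = 2 * \<phi> (x + z) + 2 * \<phi> y"
    "\<phi> (x + (z - y)) + \<phi> (x - (z - y)) = 2 * \<phi> x + 2 * \<phi> (z - y)"
    "\<phi> (x + y + z) + \<phi> (x + y - z) = 2 * \<phi> (x + y) + 2 * \<phi> z"
    "\<phi> (z + y) + \<phi> (z - y) = 2 * \<phi> z + 2 * \<phi> y"
    by (rule parallelogram)+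
  moreover have "x + (z - y) = x + z - y" "x - (z - y) = x + y - z" "x + z + y = x + y + z" "z + y = y + z"
    by (simp_all add: algebra_simps)
  ultimately show ?thesis unfolding B_def by (simp add: field_simps)
qed

lemma B_scale_left: "B (s t x) y = t * B x y"
proof -
  define b where "b = \<gamma>\<^sup>2 * (2 * K\<^sup>2 * ((p x)\<^sup>2 + (p y)\<^sup>2))"
  define a1 where "a1 = \<gamma>\<^sup>2 * (p x)\<^sup>2"
  define a2 where "a2 = \<gamma>\<^sup>2 * (p y)\<^sup>2"
  define M where "M = b + a1 + a2"
  have le: "\<phi> v \<le> \<gamma>\<^sup>2 * (p v)\<^sup>2" for v using form_le[of v] by (simp add: power_mult_distrib)
  have "\<bar>B (s t x) y\<bar> \<le> M" if t: "\<bar>t\<bar> \<le> 1" for t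
  proof -
    have px: "(p (s t x))\<^sup>2 \<le> (p x)\<^sup>2"
      using t mult_right_mono[of "\<bar>t\<bar>" 1 "p x"] by (intro power_mono) auto
    have "\<phi> (s t x) \<le> \<gamma>\<^sup>2 * (p x)\<^sup>2"
      using le[of "s t x"] mult_left_mono[OF px, of "\<gamma>\<^sup>2"] by simp
    moreover have "\<phi> (s t x + y) \<le> b"
      unfolding b_def
    proof -
      have "(p (s t x + y))\<^sup>2 \<le> 2 * K\<^sup>2 * ((p (s t x))\<^sup>2 + (p y)\<^sup>2)" by (rule q_add_sq)
      also have "\<dots> \<le> 2 * K\<^sup>2 * ((p x)\<^sup>2 + (p y)\<^sup>2)" using px by (intro mult_left_mono add_right_mono) auto
      finally have "\<gamma>\<^sup>2 * (p (s t x + y))\<^sup>2 \<le> \<gamma>\<^sup>2 * (2 * K\<^sup>2 * ((p x)\<^sup>2 + (p y)\<^sup>2))"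
        by (rule mult_left_mono) simp
      then show "\<phi> (s t x + y) \<le> \<gamma>\<^sup>2 * (2 * K\<^sup>2 * ((p x)\<^sup>2 + (p y)\<^sup>2))"
        by (rule order_trans[OF le])
    qed
    moreover note le[of y] form_nonneg[of "s t x"] form_nonneg[of "s t x + y"] form_nonneg[of y]
    ultimately have bounds: "\<phi> (s t x) \<le> a1" "\<phi> (s t x + y) \<le> b" "\<phi> y \<le> a2"
        "0 \<le> \<phi> (s t x)" "0 \<le> \<phi> (s t x + y)" "0 \<le> \<phi> y"
      by (simp_all add: a1_def a2_def)
    then have "\<bar>\<phi> (s t x + y) - \<phi> (s t x) - \<phi> y\<bar> \<le> 2 * M"
      unfolding M_def distrib_left by (intro abs_leI) linarith+
    then show ?thesis by (simp add: B_def)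
  qed
  then have "B (s t x) y = t * B (s 1 x) y"
    using additive_bounded_linear[of "\<lambda>t. B (s t x) y" M t]
    by (simp only: scale_left_distrib B_add_left)
  then show ?thesis by simp
qed

lemma B_self: "B x x = \<phi> x"
proof -
  have "\<phi> (x + x) = 4 * \<phi> x" using parallelogram[of x x] by simp
  then show ?thesis by (simp add: B_def)
qed

lemma form_scale [simp]: "\<phi> (s t x) = t\<^sup>2 * \<phi> x"
  unfolding B_self[of "s t x", symmetric] B_scale_left B_commute[of x "s t x"] B_scale_left
  by (simp add: B_self power2_eq_square)

lemma B_0_left [simp]: "B 0 y = 0"
  using B_scale_left[of 0 0 y] by simp

lemma B_0_right [simp]: "B y 0 = 0"
  using B_0_left by (simp add: B_commute)

lemma B_minus_left: "B (- x) y = - B x y"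
  using B_scale_left[of "-1" x y] by simp

lemma B_diff_left: "B (x - y) z = B x z - B y z"
  using B_add_left[of x "- y" z] by (simp add: B_minus_left)

lemma B_sum_left: "B (\<Sum>i\<in>A. f i) y = (\<Sum>i\<in>A. B (f i) y)"
  by (induction A rule: infinite_finite_induct) (simp_all add: B_add_left)

lemma B_scale_right: "B x (s t y) = t * B x y"
  using B_scale_left by (simp add: B_commute[of x])

lemma B_sum_right: "B y (\<Sum>i\<in>A. f i) = (\<Sum>i\<in>A. B y (f i))"
  using B_sum_left by (simp add: B_commute[of y])

lemma form_diff: "\<phi> (x - y) = \<phi> x - 2 * B x y + \<phi> y"
  using form_add[of x "- y"] by (simp add: B_commute[of x] B_minus_left)

lemma Cauchy_Schwarz_form: "\<bar>B x y\<bar> \<le> sqrt (\<phi> x) * sqrt (\<phi> y)"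
proof -
  have q: "0 \<le> \<phi> x + 2 * t * B x y + t\<^sup>2 * \<phi> y" for t
    using form_nonneg[of "x + s t y"] by (simp add: form_add B_scale_right)
  have "(B x y)\<^sup>2 \<le> \<phi> x * \<phi> y"
  proof (cases "\<phi> y = 0")
    case True
    have "B x y = 0"
    proof (rule ccontr)
      assume "B x y \<noteq> 0"
      then show False using q[of "- (\<phi> x + 1) / (2 * B x y)"] True by (simp add: field_simps)
    qed
    then show ?thesis by simp
  next
    case False
    then have pos: "0 < \<phi> y" using form_nonneg[of y] by linarith
    have "0 \<le> \<phi> x - (B x y)\<^sup>2 / \<phi> y"
      using q[of "- B x y / \<phi> y"] pos by (simp add: power2_eq_square field_simps)
    then show ?thesis using pos by (simp add: field_simps)
  qed
  then have "sqrt ((B x y)\<^sup>2) \<le> sqrt (\<phi> x * \<phi> y)" by (rule real_sqrt_le_mono)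
  then show ?thesis by (simp add: real_sqrt_mult)
qed

lemma sqrt_form_add: "sqrt (\<phi> (x + y)) \<le> sqrt (\<phi> x) + sqrt (\<phi> y)"
proof (rule real_le_lsqrt)
  have "\<phi> (x + y) \<le> \<phi> x + 2 * (sqrt (\<phi> x) * sqrt (\<phi> y)) + \<phi> y"
    using Cauchy_Schwarz_form[of x y] by (simp add: form_add)
  then show "\<phi> (x + y) \<le> (sqrt (\<phi> x) + sqrt (\<phi> y))\<^sup>2" by (simp add: power2_sum)
qed simp

end

section \<open>The Banach envelope\<close>

context qnorm
begin

text \<open>The norm of the Banach envelope: the gauge of the convex hull of the unit ball.\<close>

definition envelope :: "'a \<Rightarrow> real" where
  "envelope x = Inf ((\<lambda>ys. \<Sum>y\<leftarrow>ys. q y) ` {ys. sum_list ys = x})"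

lemma envelope_le_sum: "envelope (sum_list ys) \<le> (\<Sum>y\<leftarrow>ys. q y)"
  unfolding envelope_def
  by (rule cINF_lower) (auto intro!: bdd_belowI[of _ 0] sum_list_nonneg)

lemma envelope_greatest:
  assumes "\<And>ys. sum_list ys = x \<Longrightarrow> b \<le> (\<Sum>y\<leftarrow>ys. q y)"
  shows "b \<le> envelope x"
proof -
  have "sum_list [x] = x" by simp
  then have "{ys. sum_list ys = x} \<noteq> {}" by blast
  then show ?thesis unfolding envelope_def by (rule cINF_greatest) (use assms in auto)
qed

lemma envelope_nonneg [simp]: "0 \<le> envelope x"
  by (rule envelope_greatest) (auto intro!: sum_list_nonneg)

lemma envelope_le: "envelope x \<le> q x"
  using envelope_le_sum[of "[x]"] by simp

lemma envelope_0 [simp]: "envelope 0 = 0"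
  using envelope_le[of 0] envelope_nonneg[of 0] by simp

lemma envelope_add: "envelope (x + y) \<le> envelope x + envelope y"
proof -
  have "envelope (x + y) - envelope x \<le> envelope y"
  proof (rule envelope_greatest)
    fix ys assume ys: "sum_list ys = y"
    have "envelope (x + y) - (\<Sum>y\<leftarrow>ys. q y) \<le> envelope x"
    proof (rule envelope_greatest)
      fix xs assume "sum_list xs = x"
      then show "envelope (x + y) - (\<Sum>y\<leftarrow>ys. q y) \<le> (\<Sum>y\<leftarrow>xs. q y)"
        using envelope_le_sum[of "xs @ ys"] ys by simp
    qed
    then show "envelope (x + y) - envelope x \<le> (\<Sum>y\<leftarrow>ys. q y)" by simp
  qed
  then show ?thesis by simp
qed

lemma envelope_scale_le: "envelope (s c x) \<le> \<bar>c\<bar> * envelope x"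
proof (cases "c = 0")
  case False
  have "envelope (s c x) / \<bar>c\<bar> \<le> envelope x"
  proof (rule envelope_greatest)
    fix ys assume ys: "sum_list ys = x"
    have "sum_list (map (s c) ys) = s c (sum_list ys)" for ys
      by (induction ys) (simp_all add: scale_right_distrib)
    moreover have "(\<Sum>y\<leftarrow>map (s c) ys. q y) = \<bar>c\<bar> * (\<Sum>y\<leftarrow>ys. q y)" for ys
      by (induction ys) (simp_all add: distrib_left)
    ultimately have "envelope (s c x) \<le> \<bar>c\<bar> * (\<Sum>y\<leftarrow>ys. q y)"
      using envelope_le_sum[of "map (s c) ys"] ys by metis
    then show "envelope (s c x) / \<bar>c\<bar> \<le> (\<Sum>y\<leftarrow>ys. q y)" using False by (simp add: field_simps)
  qed
  then show ?thesis using False by (simp add: field_simps)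
qed simp

lemma envelope_sum: "envelope (\<Sum>i\<in>A. f i) \<le> (\<Sum>i\<in>A. envelope (f i))"
proof (induction A rule: infinite_finite_induct)
  case (insert a A)
  then show ?case using envelope_add[of "f a" "\<Sum>i\<in>A. f i"] by simp
qed simp_all

end

context quadratic_form
begin

text \<open>The square root of a quadratic form satisfies the triangle inequality, so a bound by the
  quasi-norm passes to convex combinations without loss.\<close>

lemma form_le_envelope: "\<phi> x \<le> (\<gamma> * envelope x)\<^sup>2"
proof -
  have *: "sqrt (\<phi> (sum_list ys)) \<le> \<gamma> * (\<Sum>y\<leftarrow>ys. p y)" for ys
  proof (induction ys)
    case (Cons y ys)
    have "sqrt (\<phi> y) \<le> \<gamma> * p y"
      using real_sqrt_le_mono[OF form_le[of y]] \<gamma>_nonneg by (simp add: real_sqrt_abs abs_mult)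
    then show ?case using Cons sqrt_form_add[of y "sum_list ys"] by (simp add: distrib_left)
  qed simp
  have "sqrt (\<phi> x) \<le> \<gamma> * envelope x"
  proof (cases "\<gamma> = 0")
    case True
    then show ?thesis using *[of "[x]"] by simp
  next
    case False
    then have "sqrt (\<phi> x) / \<gamma> \<le> envelope x"
      using \<gamma>_nonneg by (intro envelope_greatest) (use * in \<open>auto simp: field_simps\<close>)
    then show ?thesis using False \<gamma>_nonneg by (simp add: field_simps)
  qed
  then have "(sqrt (\<phi> x))\<^sup>2 \<le> (\<gamma> * envelope x)\<^sup>2" by (intro power_mono) auto
  then show ?thesis by simp
qed

text \<open>Maurey's empirical method, made deterministic: among the points of which \<open>a\<close> is a convex
  combination there is always one whose addition raises \<open>\<phi>\<close> of the accumulated error by no more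
  than its average, because the cross terms cancel.\<close>

lemma empirical_step:
  assumes I: "finite I" and c: "\<And>i. i \<in> I \<Longrightarrow> 0 \<le> c i" "(\<Sum>i\<in>I. c i) = 1"
    and z: "\<And>i. i \<in> I \<Longrightarrow> p (z i) \<le> 1" and a: "a = (\<Sum>i\<in>I. s (c i) (z i))"
  shows "\<exists>i\<in>I. \<phi> (w + (z i - a)) \<le> \<phi> w + \<gamma>\<^sup>2"
proof (rule ccontr)
  assume "\<not> ?thesis"
  then have gt: "\<phi> w + \<gamma>\<^sup>2 < \<phi> (w + (z i - a))" if "i \<in> I" for i using that by auto
  have B_a: "(\<Sum>i\<in>I. c i * B (z i) y) = B a y" for y
    by (simp add: a B_sum_left B_scale_left)
  have "(\<Sum>i\<in>I. c i * \<phi> (w + (z i - a))) =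
      (\<Sum>i\<in>I. c i * (\<phi> w + \<phi> a - 2 * B a w) + 2 * (c i * B (z i) w) + c i * \<phi> (z i) - 2 * (c i * B (z i) a))"
  proof (rule sum.cong[OF refl])
    fix i
    have e: "\<phi> (w + (z i - a)) = \<phi> w + 2 * (B (z i) w - B a w) + (\<phi> (z i) - 2 * B (z i) a + \<phi> a)"
      by (simp only: form_add form_diff B_commute[of w "z i - a"] B_diff_left)
    show "c i * \<phi> (w + (z i - a)) =
      c i * (\<phi> w + \<phi> a - 2 * B a w) + 2 * (c i * B (z i) w) + c i * \<phi> (z i) - 2 * (c i * B (z i) a)"
      unfolding e by (simp only: algebra_simps)
  qed
  also have "\<dots> = (\<phi> w + \<phi> a - 2 * B a w) + 2 * B a w + (\<Sum>i\<in>I. c i * \<phi> (z i)) - 2 * B a a"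
    by (simp only: sum.distrib sum_subtractf sum_distrib_left[symmetric] sum_distrib_right[symmetric] B_a c(2) mult_1)
  also have "\<dots> \<le> \<phi> w + \<gamma>\<^sup>2"
  proof -
    have "(\<Sum>i\<in>I. c i * \<phi> (z i)) \<le> (\<Sum>i\<in>I. c i * \<gamma>\<^sup>2)"
    proof (intro sum_mono mult_left_mono c)
      fix i assume i: "i \<in> I"
      have "(\<gamma> * p (z i))\<^sup>2 \<le> (\<gamma> * 1)\<^sup>2" using z[OF i] \<gamma>_nonneg by (intro power_mono mult_left_mono) auto
      then show "\<phi> (z i) \<le> \<gamma>\<^sup>2" using form_le[of "z i"] by simp
    qed
    also have "\<dots> = \<gamma>\<^sup>2" by (simp add: sum_distrib_right[symmetric] c(2))
    finally have "(\<Sum>i\<in>I. c i * \<phi> (z i)) \<le> \<gamma>\<^sup>2" .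
    moreover have "B a a = \<phi> a" "0 \<le> \<phi> a" by (simp_all add: B_self)
    ultimately show ?thesis by linarith
  qed
  finally have "(\<Sum>i\<in>I. c i * (\<phi> (w + (z i - a)) - (\<phi> w + \<gamma>\<^sup>2))) \<le> 0"
    by (simp add: right_diff_distrib sum_subtractf sum_distrib_right[symmetric] c(2))
  moreover have nn: "0 \<le> c i * (\<phi> (w + (z i - a)) - (\<phi> w + \<gamma>\<^sup>2))" if "i \<in> I" for i
    using c(1)[OF that] gt[OF that] by simp
  ultimately have "(\<Sum>i\<in>I. c i * (\<phi> (w + (z i - a)) - (\<phi> w + \<gamma>\<^sup>2))) = 0"
    by (intro antisym sum_nonneg) auto
  then have "c i * (\<phi> (w + (z i - a)) - (\<phi> w + \<gamma>\<^sup>2)) = 0" if "i \<in> I" for i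
    using sum_nonneg_0[OF I, of "\<lambda>i. c i * (\<phi> (w + (z i - a)) - (\<phi> w + \<gamma>\<^sup>2))" i] nn that by blast
  then have "c i = 0" if "i \<in> I" for i using gt[OF that] that by fastforce
  then have "(\<Sum>i\<in>I. c i) = 0" by simp
  then show False using c(2) by simp
qed

lemma empirical_approximation:
  assumes I: "finite I" and c: "\<And>i. i \<in> I \<Longrightarrow> 0 \<le> c i" "(\<Sum>i\<in>I. c i) = 1"
    and z: "\<And>i. i \<in> I \<Longrightarrow> p (z i) \<le> 1" and a: "a = (\<Sum>i\<in>I. s (c i) (z i))"
  shows "\<exists>v. p v \<le> (2 * K) ^ m \<and> \<phi> (v - s (real m) a) \<le> real m * \<gamma>\<^sup>2"
proof (induction m)
  case 0
  show ?case by (intro exI[of _ 0]) simp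
next
  case (Suc m)
  then obtain v where v: "p v \<le> (2 * K) ^ m" "\<phi> (v - s (real m) a) \<le> real m * \<gamma>\<^sup>2" by blast
  obtain i where i: "i \<in> I" "\<phi> ((v - s (real m) a) + (z i - a)) \<le> \<phi> (v - s (real m) a) + \<gamma>\<^sup>2"
    using empirical_step[OF I c z a, of "v - s (real m) a"] by blast
  have one: "1 \<le> (2 * K) ^ m" using K_ge_1 by (intro one_le_power) simp
  have "p (v + z i) \<le> K * (p v + p (z i))" by (rule q_add)
  also have "\<dots> \<le> K * ((2 * K) ^ m + (2 * K) ^ m)"
    using v(1) z[OF i(1)] one K_ge_1 by (intro mult_left_mono add_mono) auto
  finally have "p (v + z i) \<le> (2 * K) ^ Suc m" by (simp add: mult_ac)
  moreover have "\<phi> ((v + z i) - s (real (Suc m)) a) \<le> real (Suc m) * \<gamma>\<^sup>2"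
  proof -
    have "(v + z i) - s (real (Suc m)) a = (v - s (real m) a) + (z i - a)"
      by (simp add: scale_left_distrib algebra_simps)
    then show ?thesis using i(2) v(2) by (simp add: algebra_simps)
  qed
  ultimately show ?case by blast
qed

end

locale hilbertian_operator = real_operator sx p Kx sy q Ky u + quadratic_form sx p Kx \<phi> \<gamma>
  for sx :: "real \<Rightarrow> 'a::ab_group_add \<Rightarrow> 'a" and p Kx
    and sy :: "real \<Rightarrow> 'b::ab_group_add \<Rightarrow> 'b" and q Ky and u \<phi> \<gamma> +
  fixes U :: real
  assumes u_form: "(q (u x))\<^sup>2 \<le> \<phi> x"
    and u_bounded: "q (u x) \<le> U * p x"
    and U_nonneg: "0 \<le> U"
begin

lemma u_le_sqrt_form: "q (u x) \<le> sqrt (\<phi> x)"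
  using real_sqrt_le_mono[OF u_form[of x]] by simp

text \<open>A convex combination \<open>a\<close> of vectors of the unit ball is \<open>v / m\<close> plus an error, where \<open>v\<close> is a
  sum of \<open>m\<close> of these vectors. The quasi-norm of \<open>v\<close> is at most \<open>(2K)\<^sup>m\<close>, however long the
  combination was, and the square root of \<open>\<phi>\<close> of the error is at most \<open>\<gamma> / \<surd>m\<close>. Thus the
  large constant multiplies the norm \<open>U\<close>, and \<open>\<gamma>\<close> gets a factor as small as desired.\<close>

lemma bounded_on_envelope:
  assumes m: "0 < m"
  shows "q (u x) \<le> Ky * ((2 * Kx) ^ m * U + \<gamma> / sqrt (real m)) * X.envelope x"
proof -
  define M where "M = Ky * ((2 * Kx) ^ m * U + \<gamma> / sqrt (real m))"
  have M0: "0 \<le> M"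
    unfolding M_def using X.K_ge_1 Y.K_ge_1 U_nonneg \<gamma>_nonneg by (intro mult_nonneg_nonneg add_nonneg_nonneg) auto
  have *: "q (u x) \<le> M * (\<Sum>y\<leftarrow>ys. p y)" if ys: "sum_list ys = x" for ys
  proof -
    define S where "S = (\<Sum>y\<leftarrow>ys. p y)"
    define I where "I = {..<length ys}"
    have S_eq: "S = (\<Sum>i\<in>I. p (ys ! i))" by (simp add: S_def I_def sum_list_sum_nth atLeast0LessThan)
    have x_eq: "x = (\<Sum>i\<in>I. ys ! i)" using ys by (simp add: I_def sum_list_sum_nth atLeast0LessThan)
    have "0 \<le> S" unfolding S_eq by (simp add: sum_nonneg)
    show ?thesis
    proof (cases "S = 0")
      case True
      then have "p (ys ! i) = 0" if "i \<in> I" for i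
        using that unfolding S_eq by (subst (asm) sum_nonneg_eq_0_iff) (auto simp: I_def)
      then have "x = 0" unfolding x_eq by simp
      then show ?thesis using M0 by (auto intro!: mult_nonneg_nonneg sum_list_nonneg)
    next
      case False
      then have S: "0 < S" using \<open>0 \<le> S\<close> by simp
      define c where "c i = p (ys ! i) / S" for i
      define z where "z i = sx (1 / p (ys ! i)) (ys ! i)" for i
      define a where "a = (\<Sum>i\<in>I. sx (c i) (z i))"
      have cz: "sx (c i) (z i) = sx (1 / S) (ys ! i)" for i
        by (cases "ys ! i = 0") (simp_all add: c_def z_def)
      have a_eq: "a = sx (1 / S) x"
        unfolding a_def cz x_eq by (simp add: X.scale_sum_right)
      have "\<exists>v. p v \<le> (2 * Kx) ^ m \<and> \<phi> (v - sx (real m) a) \<le> real m * \<gamma>\<^sup>2"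
      proof (rule empirical_approximation)
        show "finite I" by (simp add: I_def)
        show "0 \<le> c i" for i using S by (simp add: c_def)
        show "(\<Sum>i\<in>I. c i) = 1" using S by (simp add: c_def sum_divide_distrib[symmetric] S_eq[symmetric])
        show "p (z i) \<le> 1" for i by (simp add: z_def)
        show "a = (\<Sum>i\<in>I. sx (c i) (z i))" by (rule a_def)
      qed
      then obtain v where v: "p v \<le> (2 * Kx) ^ m" "\<phi> (v - sx (real m) a) \<le> real m * \<gamma>\<^sup>2" by blast
      have "q (u (sx (1 / real m) v)) \<le> (2 * Kx) ^ m * U"
      proof -
        have "q (u (sx (1 / real m) v)) \<le> U * p (sx (1 / real m) v)" by (rule u_bounded)
        also have "\<dots> \<le> U * p v"
          using m mult_right_mono[of "1 / real m" 1 "p v"] U_nonneg by (intro mult_left_mono) simp_all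
        also have "\<dots> \<le> U * (2 * Kx) ^ m" using v(1) U_nonneg by (rule mult_left_mono)
        finally show ?thesis by (simp only: mult.commute)
      qed
      moreover have "q (u (a - sx (1 / real m) v)) \<le> \<gamma> / sqrt (real m)"
      proof -
        have "a - sx (1 / real m) v = sx (- 1 / real m) (v - sx (real m) a)"
          using m by (simp add: X.scale_right_diff_distrib)
        then have "\<phi> (a - sx (1 / real m) v) = \<phi> (v - sx (real m) a) / (real m)\<^sup>2"
          by (simp add: power_divide)
        also have "\<dots> \<le> real m * \<gamma>\<^sup>2 / (real m)\<^sup>2" using v(2) by (intro divide_right_mono) auto
        also have "\<dots> = \<gamma>\<^sup>2 / real m" using m by (simp add: power2_eq_square)
        finally have "sqrt (\<phi> (a - sx (1 / real m) v)) \<le> sqrt (\<gamma>\<^sup>2 / real m)" by (rule real_sqrt_le_mono)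
        also have "\<dots> = \<gamma> / sqrt (real m)" using \<gamma>_nonneg by (simp add: real_sqrt_divide)
        finally show ?thesis using u_le_sqrt_form[of "a - sx (1 / real m) v"] by linarith
      qed
      ultimately have "Ky * (q (u (sx (1 / real m) v)) + q (u (a - sx (1 / real m) v))) \<le> M"
        unfolding M_def using Y.K_ge_1 by (intro mult_left_mono add_mono) auto
      moreover have "u a = u (sx (1 / real m) v) + u (a - sx (1 / real m) v)"
        by (simp add: u_add[symmetric])
      ultimately have "q (u a) \<le> M"
        using Y.q_add[of "u (sx (1 / real m) v)" "u (a - sx (1 / real m) v)"] by simp
      then have "q (u x) / S \<le> M" using S by (simp add: a_eq u_scale)
      then show ?thesis using S by (simp add: S_def[symmetric] field_simps)
    qed
  qed
  have "q (u x) \<le> M * X.envelope x"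
  proof (cases "M = 0")
    case True
    then show ?thesis using *[of "[x]"] by simp
  next
    case False
    then have "q (u x) / M \<le> X.envelope x"
      using M0 by (intro X.envelope_greatest) (use * in \<open>auto simp: field_simps\<close>)
    then show ?thesis using False M0 by (simp add: field_simps)
  qed
  then show ?thesis by (simp add: M_def)
qed

end

section \<open>Walsh functions and Riesz products\<close>

definition walsh :: "nat set \<Rightarrow> (nat \<Rightarrow> real) \<Rightarrow> real" where
  "walsh A \<epsilon> = (\<Prod>i\<in>A. \<epsilon> i)"

lemma sign_vectors_cases: "\<epsilon> \<in> sign_vectors N \<Longrightarrow> i < N \<Longrightarrow> \<epsilon> i = 1 \<or> \<epsilon> i = -1"
  by (auto simp: sign_vectors_def PiE_def Pi_def)

lemma sum_sign_vectors_prod: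
  "(\<Sum>\<epsilon>\<in>sign_vectors N. \<Prod>i<N. h i (\<epsilon> i)) = (\<Prod>i<N. h i 1 + h i (-1 :: real))"
  for h :: "nat \<Rightarrow> real \<Rightarrow> real"
proof -
  have "(\<Prod>i<N. \<Sum>y\<in>{-1, 1}. h i y) = (\<Sum>\<epsilon>\<in>sign_vectors N. \<Prod>i<N. h i (\<epsilon> i))"
    unfolding sign_vectors_def by (rule prod_sum_PiE) auto
  then show ?thesis by (simp add: add.commute)
qed

lemma walsh_orthogonal:
  assumes A: "A \<subseteq> {..<N}" and B: "B \<subseteq> {..<N}"
  shows "(\<Sum>\<epsilon>\<in>sign_vectors N. walsh A \<epsilon> * walsh B \<epsilon>) = (if A = B then 2 ^ N else 0)"
proof -
  have ext: "walsh C \<epsilon> = (\<Prod>i<N. if i \<in> C then \<epsilon> i else 1)" if "C \<subseteq> {..<N}" for C \<epsilon>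
    using that by (simp add: walsh_def prod.If_cases Int_absorb1)
  have "(\<Sum>\<epsilon>\<in>sign_vectors N. walsh A \<epsilon> * walsh B \<epsilon>) =
      (\<Sum>\<epsilon>\<in>sign_vectors N. \<Prod>i<N. (if i \<in> A then \<epsilon> i else 1) * (if i \<in> B then \<epsilon> i else 1))"
    by (simp add: ext[OF A] ext[OF B] prod.distrib)
  also have "\<dots> = (\<Prod>i<N. 1 + (if i \<in> A then -1 else 1) * (if i \<in> B then -1 else 1))"
    by (subst sum_sign_vectors_prod[where h = "\<lambda>i y. (if i \<in> A then y else 1) * (if i \<in> B then y else 1)"])
      (intro prod.cong; simp)
  also have "\<dots> = (if A = B then 2 ^ N else 0)"
  proof (cases "A = B")
    case True
    then have "(\<Prod>i<N. 1 + (if i \<in> A then -1 else 1) * (if i \<in> B then -1 else 1)) = (\<Prod>i<N. 2 :: real)"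
      by (intro prod.cong) auto
    then show ?thesis using True by simp
  next
    case False
    then obtain i where "i \<in> A \<longleftrightarrow> i \<notin> B" by blast
    then have "i < N" "1 + (if i \<in> A then -1 else 1) * (if i \<in> B then -1 else 1) = (0 :: real)"
      using A B by (auto split: if_splits)
    then have "\<exists>i\<in>{..<N}. 1 + (if i \<in> A then -1 else 1) * (if i \<in> B then -1 else 1) = (0 :: real)" by blast
    then show ?thesis using False by (subst prod_zero) auto
  qed
  finally show ?thesis .
qed

lemma walsh_singleton [simp]: "walsh {i} \<epsilon> = \<epsilon> i"
  by (simp add: walsh_def)

definition riesz_product :: "nat \<Rightarrow> real \<Rightarrow> (nat \<Rightarrow> real) \<Rightarrow> (nat \<Rightarrow> real) \<Rightarrow> real" where
  "riesz_product N \<delta> \<epsilon> \<eta> = (\<Prod>i<N. 1 + \<delta> * \<epsilon> i * \<eta> i)"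

lemma riesz_product_commute: "riesz_product N \<delta> \<epsilon> \<eta> = riesz_product N \<delta> \<eta> \<epsilon>"
  by (simp add: riesz_product_def mult.assoc mult.commute[of "\<epsilon> _"])

lemma riesz_product_nonneg:
  assumes "\<bar>\<delta>\<bar> \<le> 1" "\<epsilon> \<in> sign_vectors N" "\<eta> \<in> sign_vectors N"
  shows "0 \<le> riesz_product N \<delta> \<epsilon> \<eta>"
  unfolding riesz_product_def
proof (rule prod_nonneg)
  fix i assume "i \<in> {..<N}"
  then show "0 \<le> 1 + \<delta> * \<epsilon> i * \<eta> i"
    using sign_vectors_cases[OF assms(2), of i] sign_vectors_cases[OF assms(3), of i] assms(1) by auto
qed

lemma sum_riesz_product: "(\<Sum>\<eta>\<in>sign_vectors N. riesz_product N \<delta> \<epsilon> \<eta>) = 2 ^ N"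
  unfolding riesz_product_def
  by (subst sum_sign_vectors_prod[where h = "\<lambda>i y. 1 + \<delta> * \<epsilon> i * y"]) simp

lemma riesz_product_eq:
  "riesz_product N \<delta> \<epsilon> \<eta> = (\<Sum>A\<in>Pow {..<N}. \<delta> ^ card A * walsh A \<epsilon> * walsh A \<eta>)"
proof -
  have "riesz_product N \<delta> \<epsilon> \<eta> = (\<Prod>i<N. \<delta> * \<epsilon> i * \<eta> i + 1)"
    by (simp add: riesz_product_def add.commute)
  also have "\<dots> = (\<Sum>A\<in>Pow {..<N}. (\<Prod>i\<in>A. \<delta> * \<epsilon> i * \<eta> i) * (\<Prod>i\<in>{..<N} - A. 1))"
    by (rule prod_add) simp
  also have "\<dots> = (\<Sum>A\<in>Pow {..<N}. \<delta> ^ card A * walsh A \<epsilon> * walsh A \<eta>)"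
    by (simp add: prod.distrib walsh_def)
  finally show ?thesis .
qed

context real_vector_space
begin

definition walsh_coeff :: "nat \<Rightarrow> ((nat \<Rightarrow> real) \<Rightarrow> 'a) \<Rightarrow> nat set \<Rightarrow> 'a" where
  "walsh_coeff N f A = s (1 / 2 ^ N) (\<Sum>\<epsilon>\<in>sign_vectors N. s (walsh A \<epsilon>) (f \<epsilon>))"

lemma walsh_coeff_add: "walsh_coeff N (\<lambda>\<epsilon>. f \<epsilon> + g \<epsilon>) A = walsh_coeff N f A + walsh_coeff N g A"
  by (simp add: walsh_coeff_def scale_right_distrib sum.distrib)

lemma walsh_coeff_scale: "walsh_coeff N (\<lambda>\<epsilon>. s c (f \<epsilon>)) A = s c (walsh_coeff N f A)"
  by (simp add: walsh_coeff_def scale_sum_right mult_ac)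

lemma walsh_coeff_rademacher_sum:
  assumes "i < N"
  shows "walsh_coeff N (\<lambda>\<epsilon>. \<Sum>j<N. s (\<epsilon> j) (x j)) {i} = x i"
proof -
  have "(\<Sum>\<epsilon>\<in>sign_vectors N. s (walsh {i} \<epsilon>) (\<Sum>j<N. s (\<epsilon> j) (x j))) =
      (\<Sum>j<N. \<Sum>\<epsilon>\<in>sign_vectors N. s (walsh {i} \<epsilon> * walsh {j} \<epsilon>) (x j))"
    by (subst sum.swap) (simp add: scale_sum_right)
  also have "\<dots> = (\<Sum>j<N. s (\<Sum>\<epsilon>\<in>sign_vectors N. walsh {i} \<epsilon> * walsh {j} \<epsilon>) (x j))"
    by (simp only: scale_sum_left)
  also have "\<dots> = (\<Sum>j<N. if j = i then s (2 ^ N) (x j) else 0)"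
    using assms by (intro sum.cong refl, subst walsh_orthogonal) auto
  also have "\<dots> = s (2 ^ N) (x i)" using assms by (simp add: sum.delta)
  finally show ?thesis by (simp add: walsh_coeff_def)
qed

end

context quadratic_form
begin

lemma form_sum: "\<phi> (\<Sum>i\<in>I. s (d i) (y i)) = (\<Sum>i\<in>I. \<Sum>j\<in>I. d i * d j * B (y i) (y j))"
proof -
  let ?S = "\<Sum>i\<in>I. s (d i) (y i)"
  have "\<phi> ?S = (\<Sum>i\<in>I. B (s (d i) (y i)) ?S)"
    unfolding B_sum_left[symmetric] B_self ..
  moreover have "B (s (d i) (y i)) ?S = (\<Sum>j\<in>I. d i * d j * B (y i) (y j))" for i
    by (simp add: B_scale_left B_sum_right B_scale_right sum_distrib_left mult.assoc mult.left_commute)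
  ultimately show ?thesis by simp
qed

lemma parseval:
  "(\<Sum>\<epsilon>\<in>sign_vectors N. \<phi> (\<Sum>A\<in>Pow {..<N}. s (c A * walsh A \<epsilon>) (y A))) =
    2 ^ N * (\<Sum>A\<in>Pow {..<N}. (c A)\<^sup>2 * \<phi> (y A))"
proof -
  have "(\<Sum>\<epsilon>\<in>sign_vectors N. \<phi> (\<Sum>A\<in>Pow {..<N}. s (c A * walsh A \<epsilon>) (y A))) =
      (\<Sum>\<epsilon>\<in>sign_vectors N. \<Sum>A\<in>Pow {..<N}. \<Sum>A'\<in>Pow {..<N}.
        (c A * c A' * B (y A) (y A')) * (walsh A \<epsilon> * walsh A' \<epsilon>))"
    unfolding form_sum by (intro sum.cong refl) (simp only: mult_ac)
  also have "\<dots> = (\<Sum>A\<in>Pow {..<N}. \<Sum>A'\<in>Pow {..<N}. \<Sum>\<epsilon>\<in>sign_vectors N.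
        (c A * c A' * B (y A) (y A')) * (walsh A \<epsilon> * walsh A' \<epsilon>))"
    by (subst sum.swap, intro sum.cong refl, rule sum.swap)
  also have "\<dots> = (\<Sum>A\<in>Pow {..<N}. \<Sum>A'\<in>Pow {..<N}.
        (c A * c A' * B (y A) (y A')) * (if A = A' then 2 ^ N else 0))"
    by (simp only: sum_distrib_left[symmetric]) (intro sum.cong refl, subst walsh_orthogonal, auto)
  also have "\<dots> = (\<Sum>A\<in>Pow {..<N}. (c A)\<^sup>2 * \<phi> (y A) * 2 ^ N)"
  proof (rule sum.cong[OF refl])
    fix A assume A: "A \<in> Pow {..<N}"
    have "(\<Sum>A'\<in>Pow {..<N}. (c A * c A' * B (y A) (y A')) * (if A = A' then 2 ^ N else 0)) =
        (\<Sum>A'\<in>Pow {..<N}. if A = A' then (c A * c A' * B (y A) (y A')) * 2 ^ N else 0)"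
      by (intro sum.cong) auto
    also have "\<dots> = (c A * c A * B (y A) (y A)) * 2 ^ N"
      using A by (subst sum.delta') auto
    finally show "(\<Sum>A'\<in>Pow {..<N}. (c A * c A' * B (y A) (y A')) * (if A = A' then 2 ^ N else 0)) =
        (c A)\<^sup>2 * \<phi> (y A) * 2 ^ N"
      by (simp add: B_self power2_eq_square)
  qed
  finally show ?thesis by (simp add: sum_distrib_left mult_ac)
qed

lemma bessel: "2 ^ N * (\<Sum>A\<in>Pow {..<N}. \<phi> (walsh_coeff N f A)) \<le> (\<Sum>\<epsilon>\<in>sign_vectors N. \<phi> (f \<epsilon>))"
proof -
  define P where "P \<epsilon> = (\<Sum>A\<in>Pow {..<N}. s (walsh A \<epsilon>) (walsh_coeff N f A))" for \<epsilon>
  define S where "S = 2 ^ N * (\<Sum>A\<in>Pow {..<N}. \<phi> (walsh_coeff N f A))"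
  have PP: "(\<Sum>\<epsilon>\<in>sign_vectors N. \<phi> (P \<epsilon>)) = S"
    using parseval[of "\<lambda>_. 1" "walsh_coeff N f" N] by (simp add: P_def S_def)
  have "(\<Sum>\<epsilon>\<in>sign_vectors N. B (f \<epsilon>) (P \<epsilon>)) =
      (\<Sum>A\<in>Pow {..<N}. \<Sum>\<epsilon>\<in>sign_vectors N. B (s (walsh A \<epsilon>) (f \<epsilon>)) (walsh_coeff N f A))"
    by (subst sum.swap) (simp add: P_def B_sum_right B_scale_left B_scale_right)
  also have "\<dots> = (\<Sum>A\<in>Pow {..<N}. B (s (2 ^ N) (walsh_coeff N f A)) (walsh_coeff N f A))"
    by (simp add: B_sum_left[symmetric]) (simp add: walsh_coeff_def)
  also have "\<dots> = S" by (simp add: S_def B_scale_left B_self sum_distrib_left)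
  finally have fP: "(\<Sum>\<epsilon>\<in>sign_vectors N. B (f \<epsilon>) (P \<epsilon>)) = S" .
  have "0 \<le> (\<Sum>\<epsilon>\<in>sign_vectors N. \<phi> (f \<epsilon> - P \<epsilon>))" by (simp add: sum_nonneg)
  also have "\<dots> = (\<Sum>\<epsilon>\<in>sign_vectors N. \<phi> (f \<epsilon>)) - 2 * (\<Sum>\<epsilon>\<in>sign_vectors N. B (f \<epsilon>) (P \<epsilon>)) +
      (\<Sum>\<epsilon>\<in>sign_vectors N. \<phi> (P \<epsilon>))"
    by (simp add: form_diff sum.distrib sum_subtractf sum_distrib_left)
  finally show ?thesis by (simp add: PP fP S_def[symmetric])
qed

end

text \<open>Smoothing with the odd part of a Riesz product multiplies the Walsh coefficient of order
  \<open>k\<close> by \<open>\<delta>\<^sup>k\<close> for odd \<open>k\<close> and by \<open>0\<close> for even \<open>k\<close>. The Riesz products of parameters \<open>\<delta>\<close> and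
  \<open>- \<delta>\<close> are probability kernels, and half their difference is dominated by half their sum, so the
  operation contracts the envelope norm. Once the linear part has been taken out, only
  coefficients of order three and higher remain.\<close>

context qnorm
begin

definition odd_smoothing :: "nat \<Rightarrow> real \<Rightarrow> ((nat \<Rightarrow> real) \<Rightarrow> 'a) \<Rightarrow> (nat \<Rightarrow> real) \<Rightarrow> 'a" where
  "odd_smoothing N \<delta> f \<epsilon> = s (1 / 2 ^ N) (\<Sum>\<eta>\<in>sign_vectors N.
     s ((riesz_product N \<delta> \<epsilon> \<eta> - riesz_product N (- \<delta>) \<epsilon> \<eta>) / 2) (f \<eta>))"

lemma odd_smoothing_eq:
  "odd_smoothing N \<delta> f \<epsilon> = (\<Sum>A\<in>Pow {..<N}. s ((\<delta> ^ card A - (- \<delta>) ^ card A) / 2 * walsh A \<epsilon>) (walsh_coeff N f A))"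
proof -
  have "(riesz_product N \<delta> \<epsilon> \<eta> - riesz_product N (- \<delta>) \<epsilon> \<eta>) / 2 =
      (\<Sum>A\<in>Pow {..<N}. (\<delta> ^ card A - (- \<delta>) ^ card A) / 2 * walsh A \<epsilon> * walsh A \<eta>)" for \<eta>
    unfolding riesz_product_eq sum_subtractf[symmetric] sum_divide_distrib
    by (intro sum.cong refl) (simp add: field_simps)
  then have "odd_smoothing N \<delta> f \<epsilon> = s (1 / 2 ^ N) (\<Sum>\<eta>\<in>sign_vectors N. \<Sum>A\<in>Pow {..<N}.
      s ((\<delta> ^ card A - (- \<delta>) ^ card A) / 2 * walsh A \<epsilon> * walsh A \<eta>) (f \<eta>))"
    by (simp only: odd_smoothing_def scale_sum_left)
  also have "\<dots> = (\<Sum>A\<in>Pow {..<N}. \<Sum>\<eta>\<in>sign_vectors N.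
      s (1 / 2 ^ N * ((\<delta> ^ card A - (- \<delta>) ^ card A) / 2 * walsh A \<epsilon> * walsh A \<eta>)) (f \<eta>))"
    by (subst sum.swap) (simp only: scale_sum_right scale_scale)
  also have "\<dots> = (\<Sum>A\<in>Pow {..<N}. s ((\<delta> ^ card A - (- \<delta>) ^ card A) / 2 * walsh A \<epsilon>) (walsh_coeff N f A))"
    by (simp add: walsh_coeff_def scale_sum_right mult_ac)
  finally show ?thesis .
qed

lemma odd_smoothing_contraction:
  assumes \<delta>: "\<bar>\<delta>\<bar> \<le> 1"
  shows "(\<Sum>\<epsilon>\<in>sign_vectors N. (envelope (odd_smoothing N \<delta> f \<epsilon>))\<^sup>2) \<le> (\<Sum>\<epsilon>\<in>sign_vectors N. (envelope (f \<epsilon>))\<^sup>2)"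
proof -
  let ?S = "sign_vectors N"
  define k where "k \<epsilon> \<eta> = (riesz_product N \<delta> \<epsilon> \<eta> + riesz_product N (- \<delta>) \<epsilon> \<eta>) / 2 / 2 ^ N" for \<epsilon> \<eta>
  have k_nonneg: "0 \<le> k \<epsilon> \<eta>" if "\<epsilon> \<in> ?S" "\<eta> \<in> ?S" for \<epsilon> \<eta>
    using riesz_product_nonneg[OF _ that, of \<delta>] riesz_product_nonneg[OF _ that, of "- \<delta>"] \<delta> by (simp add: k_def)
  have k_sum: "(\<Sum>\<eta>\<in>?S. k \<epsilon> \<eta>) = 1" for \<epsilon>
    by (simp add: k_def sum_divide_distrib[symmetric] sum.distrib sum_riesz_product)
  have k_comm: "k \<epsilon> \<eta> = k \<eta> \<epsilon>" for \<epsilon> \<eta>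
    by (simp add: k_def riesz_product_commute[of N _ \<epsilon>])
  have le: "(envelope (odd_smoothing N \<delta> f \<epsilon>))\<^sup>2 \<le> (\<Sum>\<eta>\<in>?S. k \<epsilon> \<eta> * (envelope (f \<eta>))\<^sup>2)" if \<epsilon>: "\<epsilon> \<in> ?S" for \<epsilon>
  proof -
    have "envelope (odd_smoothing N \<delta> f \<epsilon>) \<le> (\<Sum>\<eta>\<in>?S. k \<epsilon> \<eta> * envelope (f \<eta>))"
    proof -
      have sm: "odd_smoothing N \<delta> f \<epsilon> = (\<Sum>\<eta>\<in>?S. s ((riesz_product N \<delta> \<epsilon> \<eta> - riesz_product N (- \<delta>) \<epsilon> \<eta>) / 2 / 2 ^ N) (f \<eta>))"
        by (simp add: odd_smoothing_def scale_sum_right mult.commute)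
      have "envelope (odd_smoothing N \<delta> f \<epsilon>) \<le> (\<Sum>\<eta>\<in>?S. envelope (s ((riesz_product N \<delta> \<epsilon> \<eta> - riesz_product N (- \<delta>) \<epsilon> \<eta>) / 2 / 2 ^ N) (f \<eta>)))"
        unfolding sm by (rule envelope_sum)
      also have "\<dots> \<le> (\<Sum>\<eta>\<in>?S. k \<epsilon> \<eta> * envelope (f \<eta>))"
      proof (rule sum_mono)
        fix \<eta> assume \<eta>: "\<eta> \<in> ?S"
        have "\<bar>(riesz_product N \<delta> \<epsilon> \<eta> - riesz_product N (- \<delta>) \<epsilon> \<eta>) / 2 / 2 ^ N\<bar> \<le> k \<epsilon> \<eta>"
        proof -
          have "0 \<le> riesz_product N \<delta> \<epsilon> \<eta>" "0 \<le> riesz_product N (- \<delta>) \<epsilon> \<eta>"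
            using riesz_product_nonneg[OF \<delta> \<epsilon> \<eta>] riesz_product_nonneg[OF _ \<epsilon> \<eta>, of "- \<delta>"] \<delta> by simp_all
          then have "\<bar>riesz_product N \<delta> \<epsilon> \<eta> - riesz_product N (- \<delta>) \<epsilon> \<eta>\<bar> \<le>
              riesz_product N \<delta> \<epsilon> \<eta> + riesz_product N (- \<delta>) \<epsilon> \<eta>"
            by linarith
          then show ?thesis by (simp add: k_def divide_right_mono)
        qed
        then show "envelope (s ((riesz_product N \<delta> \<epsilon> \<eta> - riesz_product N (- \<delta>) \<epsilon> \<eta>) / 2 / 2 ^ N) (f \<eta>)) \<le> k \<epsilon> \<eta> * envelope (f \<eta>)"
          by (intro order_trans[OF envelope_scale_le] mult_right_mono) auto
      qed
      finally show ?thesis .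
    qed
    then have "(envelope (odd_smoothing N \<delta> f \<epsilon>))\<^sup>2 \<le> (\<Sum>\<eta>\<in>?S. k \<epsilon> \<eta> * envelope (f \<eta>))\<^sup>2"
      by (intro power_mono) auto
    also have "\<dots> \<le> (\<Sum>\<eta>\<in>?S. k \<epsilon> \<eta> * (envelope (f \<eta>))\<^sup>2)"
    proof -
      define b where "b = (\<Sum>\<eta>\<in>?S. k \<epsilon> \<eta> * envelope (f \<eta>))"
      have "0 \<le> (\<Sum>\<eta>\<in>?S. k \<epsilon> \<eta> * (envelope (f \<eta>) - b)\<^sup>2)"
        using k_nonneg[OF \<epsilon>] by (intro sum_nonneg) auto
      also have "\<dots> = (\<Sum>\<eta>\<in>?S. k \<epsilon> \<eta> * (envelope (f \<eta>))\<^sup>2 - 2 * b * (k \<epsilon> \<eta> * envelope (f \<eta>)) + b\<^sup>2 * k \<epsilon> \<eta>)"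
        by (intro sum.cong refl) (simp add: power2_diff algebra_simps)
      also have "\<dots> = (\<Sum>\<eta>\<in>?S. k \<epsilon> \<eta> * (envelope (f \<eta>))\<^sup>2) - 2 * b * b + b\<^sup>2"
        by (simp only: sum.distrib sum_subtractf sum_distrib_left[symmetric] k_sum b_def[symmetric] mult_1_right)
      finally show ?thesis by (simp add: b_def[symmetric] power2_eq_square)
    qed
    finally show ?thesis .
  qed
  have "(\<Sum>\<epsilon>\<in>?S. (envelope (odd_smoothing N \<delta> f \<epsilon>))\<^sup>2) \<le> (\<Sum>\<epsilon>\<in>?S. \<Sum>\<eta>\<in>?S. k \<epsilon> \<eta> * (envelope (f \<eta>))\<^sup>2)"
    by (rule sum_mono) (rule le)
  also have "\<dots> = (\<Sum>\<eta>\<in>?S. (\<Sum>\<epsilon>\<in>?S. k \<eta> \<epsilon>) * (envelope (f \<eta>))\<^sup>2)"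
    by (subst sum.swap) (simp add: sum_distrib_right k_comm)
  also have "\<dots> = (\<Sum>\<eta>\<in>?S. (envelope (f \<eta>))\<^sup>2)" by (simp add: k_sum)
  finally show ?thesis .
qed

end

context quadratic_form
begin

lemma odd_smoothing_remainder:
  assumes \<delta>: "0 \<le> \<delta>" "\<delta> \<le> 1"
  shows "(\<Sum>\<epsilon>\<in>sign_vectors N. \<phi> (odd_smoothing N \<delta> f \<epsilon> - s \<delta> (\<Sum>i<N. s (\<epsilon> i) (walsh_coeff N f {i})))) \<le>
    \<delta> ^ 6 * (\<Sum>\<epsilon>\<in>sign_vectors N. \<phi> (f \<epsilon>))"
proof -
  define c where "c A = (if card A = 1 then 0 else (\<delta> ^ card A - (- \<delta>) ^ card A) / 2)" for A :: "nat set"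
  have c_le: "(c A)\<^sup>2 \<le> \<delta> ^ 6" for A
  proof (cases "even (card A) \<or> card A = 1")
    case True
    then show ?thesis using \<delta> by (auto simp: c_def)
  next
    case False
    then have "3 \<le> card A" by presburger
    then have "\<delta> ^ card A \<le> \<delta> ^ 3" using \<delta> by (intro power_decreasing) auto
    then have "(\<delta> ^ card A)\<^sup>2 \<le> (\<delta> ^ 3)\<^sup>2" using \<delta> by (intro power_mono) auto
    then show ?thesis using False by (simp add: c_def flip: power_mult)
  qed
  have "odd_smoothing N \<delta> f \<epsilon> - s \<delta> (\<Sum>i<N. s (\<epsilon> i) (walsh_coeff N f {i})) =
      (\<Sum>A\<in>Pow {..<N}. s (c A * walsh A \<epsilon>) (walsh_coeff N f A))" for \<epsilon>
  proof -
    define h where "h A = (if card A = 1 then s (\<delta> * walsh A \<epsilon>) (walsh_coeff N f A) else 0)" for A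
    have "odd_smoothing N \<delta> f \<epsilon> = (\<Sum>A\<in>Pow {..<N}. s (c A * walsh A \<epsilon>) (walsh_coeff N f A) + h A)"
      unfolding odd_smoothing_eq by (intro sum.cong refl) (auto simp: c_def h_def)
    also have "\<dots> = (\<Sum>A\<in>Pow {..<N}. s (c A * walsh A \<epsilon>) (walsh_coeff N f A)) + (\<Sum>A\<in>Pow {..<N}. h A)"
      by (rule sum.distrib)
    also have "(\<Sum>A\<in>Pow {..<N}. h A) = (\<Sum>A\<in>(\<lambda>i. {i}) ` {..<N}. h A)"
    proof (rule sum.mono_neutral_right)
      show "\<forall>A\<in>Pow {..<N} - (\<lambda>i. {i}) ` {..<N}. h A = 0"
        by (auto simp: h_def card_1_singleton_iff)
    qed auto
    also have "\<dots> = (\<Sum>i<N. h {i})" by (subst sum.reindex) (auto simp: inj_on_def)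
    also have "\<dots> = s \<delta> (\<Sum>i<N. s (\<epsilon> i) (walsh_coeff N f {i}))"
      by (simp add: h_def scale_sum_right)
    finally show ?thesis by simp
  qed
  then have "(\<Sum>\<epsilon>\<in>sign_vectors N. \<phi> (odd_smoothing N \<delta> f \<epsilon> - s \<delta> (\<Sum>i<N. s (\<epsilon> i) (walsh_coeff N f {i})))) =
      2 ^ N * (\<Sum>A\<in>Pow {..<N}. (c A)\<^sup>2 * \<phi> (walsh_coeff N f A))"
    by (simp only: parseval)
  also have "\<dots> \<le> 2 ^ N * (\<Sum>A\<in>Pow {..<N}. \<delta> ^ 6 * \<phi> (walsh_coeff N f A))"
    by (intro mult_left_mono sum_mono mult_right_mono c_le) auto
  also have "\<dots> = \<delta> ^ 6 * (2 ^ N * (\<Sum>A\<in>Pow {..<N}. \<phi> (walsh_coeff N f A)))"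
    by (simp add: sum_distrib_left mult_ac)
  also have "\<dots> \<le> \<delta> ^ 6 * (\<Sum>\<epsilon>\<in>sign_vectors N. \<phi> (f \<epsilon>))"
    using \<delta> by (intro mult_left_mono bessel) auto
  finally show ?thesis .
qed

end

section \<open>Lifting vectors to functions on the sign group\<close>

context qnorm
begin

text \<open>A linear function is odd and the unit ball is symmetric, so one-sided bounds and suprema
  without absolute value describe boundedness and the norm.\<close>

definition real_functional :: "('a \<Rightarrow> real) \<Rightarrow> bool" where
  "real_functional \<psi> \<longleftrightarrow> (\<forall>x y. \<psi> (x + y) = \<psi> x + \<psi> y) \<and> (\<forall>c x. \<psi> (s c x) = c * \<psi> x) \<and>
     (\<exists>M. \<forall>x. \<psi> x \<le> M * q x)"

definition functional_norm :: "('a \<Rightarrow> real) \<Rightarrow> real" where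
  "functional_norm \<psi> = (SUP x\<in>{x. q x \<le> 1}. \<psi> x)"

definition has_dual_cotype2 :: "real \<Rightarrow> bool" where
  "has_dual_cotype2 C \<longleftrightarrow> (\<forall>N \<psi>. (\<forall>i<N. real_functional (\<psi> i)) \<longrightarrow>
     (\<Sum>i<N. (functional_norm (\<psi> i))\<^sup>2) \<le>
     C\<^sup>2 * ((\<Sum>\<epsilon>\<in>sign_vectors N. (functional_norm (\<lambda>x. \<Sum>i<N. \<epsilon> i * \<psi> i x))\<^sup>2) / 2 ^ N))"

lemma functional_norm_bdd:
  assumes "real_functional \<psi>"
  shows "bdd_above (\<psi> ` {x. q x \<le> 1})"
proof -
  obtain M where M: "\<And>x. \<psi> x \<le> M * q x" using assms by (auto simp: real_functional_def)
  have "\<psi> x \<le> \<bar>M\<bar>" if "q x \<le> 1" for x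
  proof -
    have "M * q x \<le> \<bar>M\<bar> * q x" by (intro mult_right_mono) auto
    also have "\<dots> \<le> \<bar>M\<bar> * 1" using that by (intro mult_left_mono) auto
    finally show ?thesis using M[of x] by simp
  qed
  then show ?thesis by (intro bdd_aboveI) auto
qed

lemma real_functional_0: "real_functional \<psi> \<Longrightarrow> \<psi> 0 = 0"
  unfolding real_functional_def by (metis add_cancel_right_left)

lemma functional_norm_nonneg: "real_functional \<psi> \<Longrightarrow> 0 \<le> functional_norm \<psi>"
  unfolding functional_norm_def
  using cSUP_upper[OF _ functional_norm_bdd, of 0 \<psi>] real_functional_0[of \<psi>] by simp

lemma functional_norm_le:
  assumes \<psi>: "real_functional \<psi>"
  shows "\<psi> x \<le> functional_norm \<psi> * q x"
proof (cases "x = 0")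
  case False
  then have q: "0 < q x" using q_nonneg[of x] q_eq_0[of x] by linarith
  have "\<psi> (s (1 / q x) x) \<le> functional_norm \<psi>"
    unfolding functional_norm_def using q by (intro cSUP_upper functional_norm_bdd \<psi>) simp
  then have "1 / q x * \<psi> x \<le> functional_norm \<psi>" using \<psi> by (simp add: real_functional_def)
  then show ?thesis using q by (simp add: field_simps)
qed (simp add: real_functional_0[OF \<psi>])

lemma real_functional_sum:
  assumes "\<And>i. i < N \<Longrightarrow> real_functional (\<psi> i)"
  shows "real_functional (\<lambda>x. \<Sum>i<(N::nat). a i * \<psi> i x)"
proof -
  have "\<exists>M. \<forall>x. (\<Sum>i<N. a i * \<psi> i x) \<le> M * q x"
  proof (intro exI allI)
    fix x
    have "(\<Sum>i<N. a i * \<psi> i x) \<le> (\<Sum>i<N. \<bar>a i\<bar> * functional_norm (\<psi> i) * q x)"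
    proof (rule sum_mono)
      fix i assume "i \<in> {..<N}"
      then have \<psi>: "real_functional (\<psi> i)" using assms by simp
      have "\<psi> i (- x) = - \<psi> i x" using \<psi> by (metis real_functional_def mult_minus1 scale_minus_left scale_one)
      then have "\<bar>\<psi> i x\<bar> \<le> functional_norm (\<psi> i) * q x"
        using functional_norm_le[OF \<psi>, of x] functional_norm_le[OF \<psi>, of "- x"] by auto
      then have "\<bar>a i\<bar> * \<bar>\<psi> i x\<bar> \<le> \<bar>a i\<bar> * (functional_norm (\<psi> i) * q x)" by (intro mult_left_mono) auto
      moreover have "a i * \<psi> i x \<le> \<bar>a i\<bar> * \<bar>\<psi> i x\<bar>" by (metis abs_ge_self abs_mult)
      ultimately show "a i * \<psi> i x \<le> \<bar>a i\<bar> * functional_norm (\<psi> i) * q x" by (simp only: mult.assoc) 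
    qed
    then show "(\<Sum>i<N. a i * \<psi> i x) \<le> (\<Sum>i<N. \<bar>a i\<bar> * functional_norm (\<psi> i)) * q x"
      by (simp add: sum_distrib_right)
  qed
  then show ?thesis
    using assms unfolding real_functional_def
    by (auto simp: sum_distrib_left sum.distrib[symmetric] algebra_simps intro!: sum.cong)
qed

definition mean_norm :: "nat \<Rightarrow> ((nat \<Rightarrow> real) \<Rightarrow> 'a) \<Rightarrow> real" where
  "mean_norm N f = sqrt ((\<Sum>\<epsilon>\<in>sign_vectors N. (envelope (f \<epsilon>))\<^sup>2) / 2 ^ N)"

lemma mean_norm_nonneg [simp]: "0 \<le> mean_norm N f"
  by (simp add: mean_norm_def sum_nonneg)

lemma mean_norm_L2: "mean_norm N f = L2_set (\<lambda>\<epsilon>. envelope (f \<epsilon>)) (sign_vectors N) / sqrt (2 ^ N)"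
  by (simp add: mean_norm_def L2_set_def real_sqrt_divide)

lemma mean_norm_add: "mean_norm N (\<lambda>\<epsilon>. f \<epsilon> + g \<epsilon>) \<le> mean_norm N f + mean_norm N g"
proof -
  have "L2_set (\<lambda>\<epsilon>. envelope (f \<epsilon> + g \<epsilon>)) (sign_vectors N) \<le>
      L2_set (\<lambda>\<epsilon>. envelope (f \<epsilon>) + envelope (g \<epsilon>)) (sign_vectors N)"
    by (intro L2_set_mono envelope_add) auto
  also have "\<dots> \<le> L2_set (\<lambda>\<epsilon>. envelope (f \<epsilon>)) (sign_vectors N) + L2_set (\<lambda>\<epsilon>. envelope (g \<epsilon>)) (sign_vectors N)"
    by (rule L2_set_triangle_ineq)
  finally show ?thesis
    unfolding mean_norm_L2 add_divide_distrib[symmetric] by (rule divide_right_mono) simp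
qed

lemma mean_norm_scale: "mean_norm N (\<lambda>\<epsilon>. s c (f \<epsilon>)) \<le> \<bar>c\<bar> * mean_norm N f"
proof -
  have "L2_set (\<lambda>\<epsilon>. envelope (s c (f \<epsilon>))) (sign_vectors N) \<le> L2_set (\<lambda>\<epsilon>. \<bar>c\<bar> * envelope (f \<epsilon>)) (sign_vectors N)"
    by (intro L2_set_mono envelope_scale_le) auto
  also have "\<dots> = \<bar>c\<bar> * L2_set (\<lambda>\<epsilon>. envelope (f \<epsilon>)) (sign_vectors N)"
    by (simp add: L2_set_right_distrib)
  finally have "L2_set (\<lambda>\<epsilon>. envelope (s c (f \<epsilon>))) (sign_vectors N) / sqrt (2 ^ N) \<le>
      \<bar>c\<bar> * L2_set (\<lambda>\<epsilon>. envelope (f \<epsilon>)) (sign_vectors N) / sqrt (2 ^ N)"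
    by (rule divide_right_mono) simp
  then show ?thesis by (simp add: mean_norm_L2)
qed

lemma mean_norm_le:
  assumes "\<And>\<epsilon>. \<epsilon> \<in> sign_vectors N \<Longrightarrow> q (f \<epsilon>) \<le> b \<epsilon>"
  shows "mean_norm N f \<le> sqrt ((\<Sum>\<epsilon>\<in>sign_vectors N. (b \<epsilon>)\<^sup>2) / 2 ^ N)"
  unfolding mean_norm_def
  by (intro real_sqrt_le_mono divide_right_mono sum_mono power_mono order_trans[OF envelope_le assms]) auto

text \<open>The dual form of cotype 2 of the dual. The set of coefficient vectors of functions in the
  unit ball is convex because the envelope norm is, so a functional that is norming for the given
  \<open>x\<close> exists; it is a family \<open>\<psi>\<close> of functionals, and testing it against functions \<open>f\<close> that almost
  norm the sums \<open>\<Sum>\<epsilon>\<^sub>i \<psi>\<^sub>i\<close> bounds its Rademacher average.\<close>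

theorem lift_to_signs:
  assumes C: "has_dual_cotype2 C" and C_pos: "0 < C"
  shows "\<exists>f. (\<forall>i<N. walsh_coeff N f {i} = x i) \<and> mean_norm N f \<le> 3 * C * sqrt (\<Sum>i<N. (q (x i))\<^sup>2)"
proof -
  define F where "F y = {f. \<forall>i<N. walsh_coeff N f {i} = y i}" for y :: "nat \<Rightarrow> 'a"
  define P where "P y = Inf (mean_norm N ` F y)" for y
  have bdd: "bdd_below (mean_norm N ` A)" for A by (intro bdd_belowI[of _ 0]) auto
  have P_le: "P y \<le> mean_norm N f" if "f \<in> F y" for f y
    unfolding P_def by (rule cINF_lower[OF bdd that])
  have ne: "F y \<noteq> {}" for y
    using walsh_coeff_rademacher_sum[of _ N y] by (auto simp: F_def)
  have P_ge: "b \<le> P y" if "\<And>f. f \<in> F y \<Longrightarrow> b \<le> mean_norm N f" for b y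
    unfolding P_def by (rule cINF_greatest[OF ne that])
  have P_nonneg: "0 \<le> P y" for y by (rule P_ge) simp
  have P_add: "P (y + z) \<le> P y + P z" for y z
  proof -
    have *: "P (y + z) \<le> mean_norm N f + mean_norm N g" if "f \<in> F y" "g \<in> F z" for f g
    proof -
      have "(\<lambda>\<epsilon>. f \<epsilon> + g \<epsilon>) \<in> F (y + z)" using that by (simp add: F_def walsh_coeff_add)
      from P_le[OF this] show ?thesis using mean_norm_add[of N f g] by linarith
    qed
    have "P (y + z) - P y \<le> P z"
    proof (rule P_ge)
      fix g assume g: "g \<in> F z"
      have "P (y + z) - mean_norm N g \<le> P y" by (rule P_ge) (use *[OF _ g] in fastforce)
      then show "P (y + z) - P y \<le> mean_norm N g" by simp
    qed
    then show ?thesis by simp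
  qed
  have P_scale: "P (\<lambda>i. s c (y i)) \<le> \<bar>c\<bar> * P y" if c: "c \<noteq> 0" for c y
  proof -
    have "P (\<lambda>i. s c (y i)) / \<bar>c\<bar> \<le> P y"
    proof (rule P_ge)
      fix f assume "f \<in> F y"
      then have "(\<lambda>\<epsilon>. s c (f \<epsilon>)) \<in> F (\<lambda>i. s c (y i))" by (simp add: F_def walsh_coeff_scale)
      from order_trans[OF P_le[OF this] mean_norm_scale]
      show "P (\<lambda>i. s c (y i)) / \<bar>c\<bar> \<le> mean_norm N f" using c by (simp add: field_simps)
    qed
    then show ?thesis using c by (simp add: field_simps)
  qed
  have P_zero: "P y = 0" if "\<And>i. i < N \<Longrightarrow> y i = 0" for y
  proof -
    have "(\<lambda>_. 0) \<in> F y" using that by (simp add: F_def walsh_coeff_def)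
    from P_le[OF this] show ?thesis using P_nonneg[of y] by (simp add: mean_norm_def)
  qed
  have nmult_eq: "nmult n x = (\<lambda>i. s (real n) (x i))" for n
    by (induction n) (auto simp: scale_left_distrib fun_eq_iff)
  have P_nmult: "P (nmult n x) = real n * P x" for n
  proof (cases "n = 0")
    case False
    have "P (\<lambda>i. s (1 / real n) (nmult n x i)) \<le> \<bar>1 / real n\<bar> * P (nmult n x)"
      using False by (intro P_scale) simp
    then have "P x \<le> P (nmult n x) / real n" using False by (simp add: nmult_eq)
    moreover have "P (nmult n x) \<le> real n * P x" using P_scale[of "real n" x] False by (simp add: nmult_eq)
    ultimately show ?thesis using False by (simp add: field_simps)
  qed (use P_zero in simp)
  have "subadditive_fun P" using P_add by (simp add: subadditive_fun_def)
  from additive_minorant_touching[where p = P and z = x, OF this P_nmult]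
  obtain a where a_add: "\<And>y z. a (y + z) = a y + a z" and a_le: "\<And>y. a y \<le> P y" and a_x: "a x = P x"
    by blast
  have a_0: "a 0 = 0" using a_add[of 0 0] by simp
  have a_minus: "a (- y) = - a y" for y using a_add[of y "- y"] a_0 by simp
  have a_zero: "a y = 0" if "\<And>i. i < N \<Longrightarrow> y i = 0" for y
    using a_le[of y] a_le[of "- y"] P_zero[of y] P_zero[of "- y"] a_minus[of y] that by simp
  define E where "E i v = (\<lambda>j. if j = i then v else 0)" for i :: nat and v :: 'a
  define \<psi> where "\<psi> i v = a (E i v)" for i v
  have E_add: "E i (v + w) = E i v + E i w" for i v w by (auto simp: E_def fun_eq_iff)
  have \<psi>_add: "\<psi> i (v + w) = \<psi> i v + \<psi> i w" for i v w by (simp add: \<psi>_def E_add a_add)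
  have \<psi>_le: "\<psi> i v \<le> q v" if i: "i < N" for i v
  proof -
    have "(\<lambda>\<epsilon>. \<Sum>j<N. s (\<epsilon> j) (E i v j)) \<in> F (E i v)"
      using walsh_coeff_rademacher_sum[of _ N "E i v"] by (simp add: F_def)
    moreover have "(\<Sum>j<N. s (\<epsilon> j) (E i v j)) = s (\<epsilon> i) v" for \<epsilon>
    proof -
      have "(\<Sum>j<N. s (\<epsilon> j) (E i v j)) = (\<Sum>j<N. if j = i then s (\<epsilon> j) v else 0)"
        by (intro sum.cong) (auto simp: E_def)
      then show ?thesis using i by simp
    qed
    ultimately have "P (E i v) \<le> mean_norm N (\<lambda>\<epsilon>. s (\<epsilon> i) v)" using P_le by simp
    also have "\<dots> \<le> sqrt ((\<Sum>\<epsilon>\<in>sign_vectors N. (q v)\<^sup>2) / 2 ^ N)"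
      by (rule mean_norm_le) (use sign_vectors_cases[OF _ i] in fastforce)
    also have "\<dots> = q v" by simp
    finally show ?thesis using a_le[of "E i v"] by (simp add: \<psi>_def)
  qed
  have \<psi>_minus: "\<psi> i (- v) = - \<psi> i v" for i v
    using \<psi>_add[of i v "- v"] \<psi>_add[of i 0 0] by simp
  have \<psi>_scale: "\<psi> i (s t v) = t * \<psi> i v" if i: "i < N" for i t v
  proof -
    have "\<bar>\<psi> i (s t v)\<bar> \<le> q v" if t: "\<bar>t\<bar> \<le> 1" for t
    proof -
      have "\<bar>\<psi> i (s t v)\<bar> \<le> q (s t v)"
        using \<psi>_le[OF i, of "s t v"] \<psi>_le[OF i, of "- s t v"] by (simp only: \<psi>_minus q_minus)
      also have "\<dots> \<le> 1 * q v" unfolding q_scale using t by (rule mult_right_mono) simp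
      finally show ?thesis by simp
    qed
    then show ?thesis
      using additive_bounded_linear[of "\<lambda>t. \<psi> i (s t v)" "q v" t] by (simp add: scale_left_distrib \<psi>_add)
  qed
  have \<psi>: "real_functional (\<psi> i)" if "i < N" for i
    unfolding real_functional_def using \<psi>_add \<psi>_scale[OF that] \<psi>_le[OF that]
    by (auto intro!: exI[of _ 1])
  have a_eq: "a y = (\<Sum>i<N. \<psi> i (y i))" for y
  proof -
    have a_sum: "a (\<Sum>i\<in>I. g i) = (\<Sum>i\<in>I. a (g i))" for I and g :: "nat \<Rightarrow> nat \<Rightarrow> 'a"
      by (induction I rule: infinite_finite_induct)
        (simp_all only: sum.infinite sum.empty sum.insert a_add a_0 not_False_eq_True)
    have sum_app: "(\<Sum>i\<in>I. g i) j = (\<Sum>i\<in>I. g i j)" for I j and g :: "nat \<Rightarrow> nat \<Rightarrow> 'a"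
      by (induction I rule: infinite_finite_induct) simp_all
    have "a (y - (\<Sum>i<N. E i (y i))) = 0"
      by (rule a_zero) (simp add: sum_app E_def)
    then have "a y = a (\<Sum>i<N. E i (y i))"
      using a_add[of "y - (\<Sum>i<N. E i (y i))" "\<Sum>i<N. E i (y i)"] by simp
    then show ?thesis by (simp add: a_sum \<psi>_def)
  qed
  define \<Psi> where "\<Psi> \<epsilon> = (\<lambda>v. \<Sum>i<N. \<epsilon> i * \<psi> i v)" for \<epsilon>
  define d where "d \<epsilon> = functional_norm (\<Psi> \<epsilon>)" for \<epsilon>
  define A where "A = (\<Sum>\<epsilon>\<in>sign_vectors N. (d \<epsilon>)\<^sup>2) / 2 ^ N"
  have \<Psi>: "real_functional (\<Psi> \<epsilon>)" for \<epsilon> unfolding \<Psi>_def by (rule real_functional_sum[OF \<psi>])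
  have d_nonneg: "0 \<le> d \<epsilon>" for \<epsilon> unfolding d_def by (rule functional_norm_nonneg[OF \<Psi>])
  have A_nonneg: "0 \<le> A" by (simp add: A_def sum_nonneg)
  have "\<exists>v. q v \<le> 1 \<and> d \<epsilon> / 2 \<le> \<Psi> \<epsilon> v" for \<epsilon>
  proof (cases "d \<epsilon> = 0")
    case True
    then show ?thesis using real_functional_0[OF \<Psi>, of \<epsilon>] by (intro exI[of _ 0]) simp
  next
    case False
    then have lt: "d \<epsilon> / 2 < (SUP x\<in>{x. q x \<le> 1}. \<Psi> \<epsilon> x)"
      using d_nonneg[of \<epsilon>] unfolding d_def functional_norm_def by linarith
    have ball: "{x. q x \<le> 1} \<noteq> {}" by (auto intro!: exI[of _ 0])
    obtain v where "q v \<le> 1" "d \<epsilon> / 2 < \<Psi> \<epsilon> v"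
      using lt unfolding less_cSUP_iff[OF ball functional_norm_bdd[OF \<Psi>[of \<epsilon>]]] by blast
    then show ?thesis by (auto intro: less_imp_le)
  qed
  \<comment> \<open>weighting the vector \<open>v \<epsilon>\<close> with \<open>d \<epsilon>\<close> makes the pairing with \<open>f\<close> comparable to the mean of
    \<open>d\<^sup>2\<close>, while the norm of \<open>f\<close> is at most the square root of that mean\<close>
  then obtain v where v: "\<And>\<epsilon>. q (v \<epsilon>) \<le> 1" "\<And>\<epsilon>. d \<epsilon> / 2 \<le> \<Psi> \<epsilon> (v \<epsilon>)" by metis
  define f where "f \<epsilon> = s (d \<epsilon>) (v \<epsilon>)" for \<epsilon>
  have "A / 2 \<le> a (\<lambda>i. walsh_coeff N f {i})"
  proof -
    have \<psi>_sum: "\<psi> i (\<Sum>\<epsilon>\<in>S. g \<epsilon>) = (\<Sum>\<epsilon>\<in>S. \<psi> i (g \<epsilon>))" for i S and g :: "(nat \<Rightarrow> real) \<Rightarrow> 'a"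
      by (induction S rule: infinite_finite_induct) (use \<psi>_add[of i 0 0] in \<open>simp_all add: \<psi>_add\<close>)
    have "a (\<lambda>i. walsh_coeff N f {i}) = (\<Sum>i<N. (\<Sum>\<epsilon>\<in>sign_vectors N. \<epsilon> i * \<psi> i (f \<epsilon>)) / 2 ^ N)"
      by (simp add: a_eq walsh_coeff_def \<psi>_scale \<psi>_sum)
    also have "\<dots> = (\<Sum>\<epsilon>\<in>sign_vectors N. \<Psi> \<epsilon> (f \<epsilon>)) / 2 ^ N"
      unfolding sum_divide_distrib[symmetric] \<Psi>_def by (subst sum.swap) simp
    finally have eq: "a (\<lambda>i. walsh_coeff N f {i}) = (\<Sum>\<epsilon>\<in>sign_vectors N. \<Psi> \<epsilon> (f \<epsilon>)) / 2 ^ N" .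
    have "(\<Sum>\<epsilon>\<in>sign_vectors N. \<Psi> \<epsilon> (f \<epsilon>)) \<ge> (\<Sum>\<epsilon>\<in>sign_vectors N. (d \<epsilon>)\<^sup>2 / 2)"
    proof (rule sum_mono)
      fix \<epsilon>
      have "\<Psi> \<epsilon> (f \<epsilon>) = d \<epsilon> * \<Psi> \<epsilon> (v \<epsilon>)" using \<Psi>[of \<epsilon>] by (simp add: real_functional_def f_def)
      also have "\<dots> \<ge> d \<epsilon> * (d \<epsilon> / 2)" using v(2) d_nonneg by (rule mult_left_mono)
      finally show "(d \<epsilon>)\<^sup>2 / 2 \<le> \<Psi> \<epsilon> (f \<epsilon>)" by (simp add: power2_eq_square)
    qed
    then have "(\<Sum>\<epsilon>\<in>sign_vectors N. (d \<epsilon>)\<^sup>2) / 2 / 2 ^ N \<le> (\<Sum>\<epsilon>\<in>sign_vectors N. \<Psi> \<epsilon> (f \<epsilon>)) / 2 ^ N"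
      unfolding sum_divide_distrib[symmetric] by (rule divide_right_mono) simp
    then show ?thesis unfolding eq by (simp add: A_def mult.commute)
  qed
  also have "\<dots> \<le> P (\<lambda>i. walsh_coeff N f {i})" by (rule a_le)
  also have "\<dots> \<le> mean_norm N f" by (rule P_le) (simp add: F_def)
  also have "\<dots> \<le> sqrt A"
    unfolding A_def
  proof (rule mean_norm_le)
    fix \<epsilon>
    show "q (f \<epsilon>) \<le> d \<epsilon>" using mult_left_mono[OF v(1), of "d \<epsilon>" \<epsilon>] d_nonneg[of \<epsilon>] by (simp add: f_def)
  qed
  finally have "A / 2 \<le> sqrt A" .
  then have "(A / 2)\<^sup>2 \<le> (sqrt A)\<^sup>2" using A_nonneg by (intro power_mono) auto
  then have "A * A \<le> 4 * A" using A_nonneg by (simp add: power2_eq_square)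
  then have A_le: "A \<le> 4" using A_nonneg by (cases "A = 0") (auto simp: mult_le_cancel_right)
  have "(\<Sum>i<N. (functional_norm (\<psi> i))\<^sup>2) \<le> C\<^sup>2 * A"
    using C \<psi> unfolding has_dual_cotype2_def A_def d_def \<Psi>_def by blast
  also have "\<dots> \<le> C\<^sup>2 * 4" using A_le by (intro mult_left_mono) auto
  finally have \<psi>_bound: "sqrt (\<Sum>i<N. (functional_norm (\<psi> i))\<^sup>2) \<le> sqrt (C\<^sup>2 * 4)" by (rule real_sqrt_le_mono)
  define R where "R = sqrt (\<Sum>i<N. (q (x i))\<^sup>2)"
  have R_nonneg: "0 \<le> R" by (simp add: R_def sum_nonneg)
  have "P x = (\<Sum>i<N. \<psi> i (x i))" using a_x a_eq[of x] by simp
  also have "\<dots> \<le> (\<Sum>i<N. \<bar>functional_norm (\<psi> i)\<bar> * \<bar>q (x i)\<bar>)"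
  proof (rule sum_mono)
    fix i assume "i \<in> {..<N}"
    then have "real_functional (\<psi> i)" using \<psi> by simp
    then show "\<psi> i (x i) \<le> \<bar>functional_norm (\<psi> i)\<bar> * \<bar>q (x i)\<bar>"
      using functional_norm_le[of "\<psi> i" "x i"] functional_norm_nonneg[of "\<psi> i"] by simp
  qed
  also have "\<dots> \<le> L2_set (\<lambda>i. functional_norm (\<psi> i)) {..<N} * L2_set (\<lambda>i. q (x i)) {..<N}"
    by (rule L2_set_mult_ineq)
  also have "\<dots> \<le> (2 * C) * R"
    using \<psi>_bound C_pos R_nonneg unfolding L2_set_def R_def[symmetric]
    by (intro mult_right_mono) (auto simp: real_sqrt_mult)
  finally have P_x: "P x \<le> 2 * C * R" .
  show ?thesis
  proof (cases "R = 0")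
    case True
    then have "(\<Sum>i<N. (q (x i))\<^sup>2) = 0" by (simp add: R_def)
    then have x0: "x i = 0" if "i < N" for i
      using that by (subst (asm) sum_nonneg_eq_0_iff) auto
    have "walsh_coeff N (\<lambda>_. 0) {i} = x i" if "i < N" for i using x0[OF that] by (simp add: walsh_coeff_def)
    moreover have "mean_norm N (\<lambda>_. 0) \<le> 3 * C * R" using C_pos R_nonneg by (simp add: mean_norm_def)
    ultimately show ?thesis unfolding R_def by blast
  next
    case False
    \<comment> \<open>the infimum \<open>P x\<close> need not be attained, which costs the step from 2 to 3\<close>
    then have "2 * C * R < 3 * C * R" using C_pos R_nonneg by simp
    then have "Inf (mean_norm N ` F x) < 3 * C * R" using P_x by (simp add: P_def)
    then obtain f where "f \<in> F x" "mean_norm N f < 3 * C * R"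
      using cInf_lessD[of "mean_norm N ` F x" "3 * C * R"] ne[of x] by auto
    then show ?thesis unfolding R_def F_def by (auto intro: less_imp_le)
  qed
qed

end

context hilbertian_operator
begin

text \<open>Pisier's splitting: the Rademacher sum is \<open>1/\<delta>\<close> times the smoothed lift minus \<open>1/\<delta>\<close> times
  the remainder. The first part is controlled by the norm of \<open>u\<close> on the envelope, the second
  by the Hilbertian form, with the small factor \<open>\<delta>\<^sup>3\<close>.\<close>

theorem type2_improvement:
  assumes C: "X.has_dual_cotype2 C" "0 < C" and \<delta>: "0 < \<delta>" "\<delta> \<le> 1"
    and \<beta>: "\<And>x. q (u x) \<le> \<beta> * X.envelope x" "0 \<le> \<beta>"
  shows "Y.rad_sq N (\<lambda>i. u (x i)) \<le>
    18 * Ky\<^sup>2 * C\<^sup>2 * (\<beta>\<^sup>2 / \<delta>\<^sup>2 + \<delta> ^ 4 * \<gamma>\<^sup>2) * (\<Sum>i<N. (p (x i))\<^sup>2)"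
proof -
  let ?S = "sign_vectors N"
  obtain f where f: "\<And>i. i < N \<Longrightarrow> X.walsh_coeff N f {i} = x i"
    and f_norm: "X.mean_norm N f \<le> 3 * C * sqrt (\<Sum>i<N. (p (x i))\<^sup>2)"
    using X.lift_to_signs[OF C] by blast
  define M where "M = (\<Sum>\<epsilon>\<in>?S. (X.envelope (f \<epsilon>))\<^sup>2)"
  have "(X.mean_norm N f)\<^sup>2 \<le> (3 * C * sqrt (\<Sum>i<N. (p (x i))\<^sup>2))\<^sup>2" by (intro power_mono f_norm) simp
  then have M_le: "M / 2 ^ N \<le> 9 * C\<^sup>2 * (\<Sum>i<N. (p (x i))\<^sup>2)"
    by (simp add: X.mean_norm_def M_def power_mult_distrib sum_nonneg)
  define g where "g = X.odd_smoothing N \<delta> f"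
  define e where "e \<epsilon> = g \<epsilon> - sx \<delta> (\<Sum>i<N. sx (\<epsilon> i) (x i))" for \<epsilon>
  have g_le: "(\<Sum>\<epsilon>\<in>?S. (X.envelope (g \<epsilon>))\<^sup>2) \<le> M"
    unfolding g_def M_def using \<delta> by (intro X.odd_smoothing_contraction) auto
  have "(\<Sum>\<epsilon>\<in>?S. \<phi> (e \<epsilon>)) \<le> \<delta> ^ 6 * (\<Sum>\<epsilon>\<in>?S. \<phi> (f \<epsilon>))"
    using odd_smoothing_remainder[of \<delta> N f] \<delta> f by (simp add: e_def g_def)
  also have "\<dots> \<le> \<delta> ^ 6 * (\<Sum>\<epsilon>\<in>?S. (\<gamma> * X.envelope (f \<epsilon>))\<^sup>2)"
    using \<delta> by (intro mult_left_mono sum_mono form_le_envelope) auto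
  also have "\<dots> = \<delta> ^ 6 * \<gamma>\<^sup>2 * M" by (simp add: M_def power_mult_distrib sum_distrib_left mult_ac)
  finally have e_le: "(\<Sum>\<epsilon>\<in>?S. \<phi> (e \<epsilon>)) \<le> \<delta> ^ 6 * \<gamma>\<^sup>2 * M" .
  have le: "(q (\<Sum>i<N. sy (\<epsilon> i) (u (x i))))\<^sup>2 \<le>
      2 * Ky\<^sup>2 / \<delta>\<^sup>2 * (\<beta>\<^sup>2 * (X.envelope (g \<epsilon>))\<^sup>2 + \<phi> (e \<epsilon>))" for \<epsilon>
  proof -
    have "(\<Sum>i<N. sx (\<epsilon> i) (x i)) = sx (1 / \<delta>) (g \<epsilon> - e \<epsilon>)"
      using \<delta> by (simp add: e_def)
    moreover have "(\<Sum>i<N. sy (\<epsilon> i) (u (x i))) = u (\<Sum>i<N. sx (\<epsilon> i) (x i))"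
      by (simp add: u_sum u_scale)
    ultimately have "(\<Sum>i<N. sy (\<epsilon> i) (u (x i))) = sy (1 / \<delta>) (u (g \<epsilon>) + u (- e \<epsilon>))"
      by (simp only: u_scale u_diff u_minus add_uminus_conv_diff)
    then have "(q (\<Sum>i<N. sy (\<epsilon> i) (u (x i))))\<^sup>2 = (q (u (g \<epsilon>) + u (- e \<epsilon>)))\<^sup>2 / \<delta>\<^sup>2"
      using \<delta> by (simp add: power_divide)
    also have "\<dots> \<le> (2 * Ky\<^sup>2 * ((q (u (g \<epsilon>)))\<^sup>2 + (q (u (- e \<epsilon>)))\<^sup>2)) / \<delta>\<^sup>2"
      by (intro divide_right_mono Y.q_add_sq) simp
    also have "\<dots> \<le> (2 * Ky\<^sup>2 * (\<beta>\<^sup>2 * (X.envelope (g \<epsilon>))\<^sup>2 + \<phi> (e \<epsilon>))) / \<delta>\<^sup>2"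
    proof -
      have "(q (u (g \<epsilon>)))\<^sup>2 \<le> (\<beta> * X.envelope (g \<epsilon>))\<^sup>2" by (intro power_mono \<beta>) simp
      moreover have "(q (u (- e \<epsilon>)))\<^sup>2 \<le> \<phi> (e \<epsilon>)" using u_form[of "- e \<epsilon>"] by simp
      ultimately show ?thesis
        by (intro divide_right_mono mult_left_mono add_mono) (auto simp: power_mult_distrib)
    qed
    finally show ?thesis by simp
  qed
  have "Y.rad_sq N (\<lambda>i. u (x i)) \<le>
      (\<Sum>\<epsilon>\<in>?S. 2 * Ky\<^sup>2 / \<delta>\<^sup>2 * (\<beta>\<^sup>2 * (X.envelope (g \<epsilon>))\<^sup>2 + \<phi> (e \<epsilon>))) / 2 ^ N"
    unfolding Y.rad_sq_def by (intro divide_right_mono sum_mono le) simp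
  also have "\<dots> = 2 * Ky\<^sup>2 / \<delta>\<^sup>2 * (\<beta>\<^sup>2 * (\<Sum>\<epsilon>\<in>?S. (X.envelope (g \<epsilon>))\<^sup>2) + (\<Sum>\<epsilon>\<in>?S. \<phi> (e \<epsilon>))) / 2 ^ N"
    by (simp only: sum_distrib_left[symmetric] sum.distrib)
  also have "\<dots> \<le> 2 * Ky\<^sup>2 / \<delta>\<^sup>2 * (\<beta>\<^sup>2 * M + \<delta> ^ 6 * \<gamma>\<^sup>2 * M) / 2 ^ N"
    by (intro divide_right_mono mult_left_mono add_mono g_le e_le) auto
  also have "\<dots> = 2 * Ky\<^sup>2 * (\<beta>\<^sup>2 / \<delta>\<^sup>2 + \<delta> ^ 4 * \<gamma>\<^sup>2) * (M / 2 ^ N)"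
  proof -
    have "\<delta> ^ 6 / \<delta>\<^sup>2 = \<delta> ^ 4" using \<delta> by (simp add: power_diff[symmetric])
    then show ?thesis using \<delta> by (simp add: field_simps)
  qed
  also have "\<dots> \<le> 2 * Ky\<^sup>2 * (\<beta>\<^sup>2 / \<delta>\<^sup>2 + \<delta> ^ 4 * \<gamma>\<^sup>2) * (9 * C\<^sup>2 * (\<Sum>i<N. (p (x i))\<^sup>2))"
    using \<delta> by (intro mult_left_mono M_le mult_nonneg_nonneg add_nonneg_nonneg) auto
  also have "\<dots> = 18 * Ky\<^sup>2 * C\<^sup>2 * (\<beta>\<^sup>2 / \<delta>\<^sup>2 + \<delta> ^ 4 * \<gamma>\<^sup>2) * (\<Sum>i<N. (p (x i))\<^sup>2)"
    by (simp add: algebra_simps)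
  finally show ?thesis .
qed

end

section \<open>The scalar field\<close>

lemma sconj_of_real [simp]: "sconj (of_real r :: 'k::rc_field) = of_real r"
proof (cases "r = 0")
  case True
  then show ?thesis using sconj_add[of "0 :: 'k" 0] by simp
next
  case False
  have "of_real r * sconj (of_real r :: 'k) = of_real r * of_real r"
    using mult_sconj[of "of_real r :: 'k"] by (simp add: power2_eq_square scaleR_conv_of_real)
  then show ?thesis using False by simp
qed

lemma sconj_0 [simp]: "sconj (0 :: 'k::rc_field) = 0"
  using sconj_of_real[of 0, where 'k = 'k] by simp

lemma sconj_1 [simp]: "sconj (1 :: 'k::rc_field) = 1"
  using sconj_of_real[of 1, where 'k = 'k] by simp

lemma sconj_minus: "sconj (- x :: 'k::rc_field) = - sconj x"
  using sconj_add[of x "- x"] by (simp add: eq_neg_iff_add_eq_0 add.commute)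

lemma sconj_diff: "sconj (x - y :: 'k::rc_field) = sconj x - sconj y"
  using sconj_add[of x "- y"] by (simp add: sconj_minus)

lemma mult_sconj': "x * sconj x = of_real ((norm (x :: 'k::rc_field))\<^sup>2)"
  by (simp add: mult_sconj scaleR_conv_of_real)

lemma norm_sconj [simp]: "norm (sconj x) = norm (x :: 'k::rc_field)"
proof (cases "x = 0")
  case False
  have "norm (x * sconj x) = (norm x)\<^sup>2" by (simp add: mult_sconj' norm_power)
  then show ?thesis using False by (simp add: norm_mult power2_eq_square)
qed simp

lemma sconj_mult: "sconj (x * y) = sconj x * sconj (y :: 'k::rc_field)"
proof (cases "x * y = 0")
  case False
  have "(x * y) * sconj (x * y) = (x * sconj x) * (y * sconj y)"
    unfolding mult_sconj' by (simp add: norm_mult power_mult_distrib)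
  also have "\<dots> = (x * y) * (sconj x * sconj y)" by (simp add: mult_ac)
  finally show ?thesis using False by (metis mult_left_cancel)
qed auto

lemma sconj_sconj [simp]: "sconj (sconj x) = (x :: 'k::rc_field)"
proof (cases "x = 0")
  case False
  then have "sconj x \<noteq> 0" by (metis norm_eq_zero norm_sconj)
  moreover have "sconj x * sconj (sconj x) = sconj x * x"
    using mult_sconj'[of "sconj x"] mult_sconj'[of x] by (simp add: mult.commute)
  ultimately show ?thesis by (metis mult_left_cancel)
qed simp

text \<open>Polarization at 1: the square of the modulus of \<open>x + 1\<close> exceeds that of \<open>x\<close> by twice the real
  part plus 1.\<close>

definition real_part :: "'k::rc_field \<Rightarrow> real" where
  "real_part x = ((norm (x + 1))\<^sup>2 - (norm x)\<^sup>2 - 1) / 2"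

lemma add_sconj: "x + sconj x = of_real (2 * real_part (x :: 'k::rc_field))"
proof -
  have "of_real ((norm (x + 1))\<^sup>2) = (x + 1) * (sconj x + 1)"
    using mult_sconj'[of "x + 1"] by (simp add: sconj_add)
  also have "\<dots> = of_real ((norm x)\<^sup>2) + (x + sconj x) + 1"
    unfolding mult_sconj'[symmetric] by (simp add: algebra_simps)
  finally have "x + sconj x = of_real ((norm (x + 1))\<^sup>2) - of_real ((norm x)\<^sup>2) - 1" by (simp add: algebra_simps)
  also have "\<dots> = of_real ((norm (x + 1))\<^sup>2 - (norm x)\<^sup>2 - 1)" by (simp only: of_real_diff of_real_1)
  finally show ?thesis by (simp add: real_part_def)
qed

lemma real_part_eqI: "x + sconj x = of_real (2 * r) \<Longrightarrow> real_part (x :: 'k::rc_field) = r"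
  unfolding add_sconj by (simp only: of_real_eq_iff)

lemma real_part_add: "real_part (x + y) = real_part x + real_part (y :: 'k::rc_field)"
proof (rule real_part_eqI)
  have "x + y + sconj (x + y) = (x + sconj x) + (y + sconj y)" by (simp add: sconj_add)
  then show "x + y + sconj (x + y) = of_real (2 * (real_part x + real_part y))"
    by (simp add: add_sconj distrib_left)
qed

lemma real_part_of_real [simp]: "real_part (of_real r :: 'k::rc_field) = r"
  by (rule real_part_eqI) simp

lemma real_part_mult_of_real: "real_part (of_real r * x) = r * real_part (x :: 'k::rc_field)"
proof (rule real_part_eqI)
  have "of_real r * x + sconj (of_real r * x) = of_real r * (x + sconj x)"
    by (simp add: sconj_mult distrib_left)
  then show "of_real r * x + sconj (of_real r * x) = of_real (2 * (r * real_part x))"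
    by (simp add: add_sconj)
qed

lemma abs_real_part_le: "\<bar>real_part x\<bar> \<le> norm (x :: 'k::rc_field)"
proof -
  have "norm (x + sconj x) \<le> 2 * norm x" using norm_triangle_ineq[of x "sconj x"] by simp
  then show ?thesis by (simp add: add_sconj abs_mult)
qed

lemma real_part_diff: "real_part (x - y) = real_part x - real_part (y :: 'k::rc_field)"
  using real_part_add[of "x - y" y] by simp

text \<open>If some \<open>x\<close> differs from its conjugate, the normalized difference \<open>j\<close> is skew with square
  \<open>-1\<close>. Multiplication by \<open>j\<close> turns the skew part of any element into a self-conjugate one, and
  those are real.\<close>

lemma rc_field_cases:
  obtains (real) "\<And>x :: 'k::rc_field. x = of_real (real_part x)"
  | (complex) j :: "'k::rc_field" where "j * j = -1" "sconj j = - j"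
      "\<And>x :: 'k. x = of_real (real_part x) + of_real (real_part (- (j * x))) * j"
proof (cases "\<forall>x :: 'k. sconj x = x")
  case True
  have "x = of_real (real_part x)" for x :: 'k
    using add_sconj[of x] True by (simp add: mult_2[symmetric])
  then show ?thesis by (rule real)
next
  case False
  then obtain x :: 'k where x: "sconj x \<noteq> x" by blast
  define d where "d = x - sconj x"
  define j where "j = d * of_real (1 / norm d)"
  have d: "d \<noteq> 0" "sconj d = - d" using x by (auto simp: d_def sconj_diff)
  have j_conj: "sconj j = - j" unfolding j_def sconj_mult sconj_of_real d(2) by simp
  have "j * sconj j = 1"
    unfolding mult_sconj' using d(1) by (simp add: j_def norm_mult norm_divide)
  moreover have "j * j = - (j * sconj j)" by (simp add: j_conj)
  ultimately have j2: "j * j = -1" by simp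
  have fixed: "w = of_real (real_part w)" if "sconj w = w" for w :: 'k
    using add_sconj[of w] that by (simp add: mult_2[symmetric])
  have "y = of_real (real_part y) + of_real (real_part (- (j * y))) * j" for y :: 'k
  proof -
    define z where "z = y - of_real (real_part y)"
    have "sconj y = of_real (2 * real_part y) - y" using add_sconj[of y] by (simp add: algebra_simps)
    then have z: "sconj z = - z" by (simp add: z_def sconj_diff algebra_simps)
    have "sconj (- (j * z)) = - (j * z)" by (simp add: sconj_mult sconj_minus z j_conj)
    then have "- (j * z) = of_real (real_part (- (j * z)))" by (rule fixed)
    then have "z = of_real (real_part (- (j * z))) * j"
    proof -
      have "- (j * z) * j = - (j * j) * z" by (simp add: mult_ac)
      then have "- (j * z) * j = z" by (simp add: j2)
      then show ?thesis using \<open>- (j * z) = of_real (real_part (- (j * z)))\<close> by metis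
    qed
    moreover have "real_part (- (j * z)) = real_part (- (j * y))"
    proof -
      have "real_part j = 0" by (rule real_part_eqI) (simp add: j_conj)
      have "- (j * y) = - (j * z) + of_real (- real_part y) * j"
        by (simp add: z_def algebra_simps)
      then show ?thesis using \<open>real_part j = 0\<close> by (simp only: real_part_add real_part_mult_of_real mult_zero_right add_0_right)
    qed
    ultimately show ?thesis by (simp add: z_def algebra_simps)
  qed
  from complex[OF j2 j_conj this] show ?thesis .
qed

lemma Cauchy_real_part:
  assumes "Cauchy (f :: nat \<Rightarrow> 'k::rc_field)"
  shows "convergent (\<lambda>n. of_real (real_part (f n)) :: 'k)"
proof -
  have "Cauchy (\<lambda>n. real_part (f n))"
    unfolding Cauchy_iff
  proof (intro allI impI)
    fix e :: real assume "0 < e"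
    then obtain M where "\<And>m n. M \<le> m \<Longrightarrow> M \<le> n \<Longrightarrow> norm (f m - f n) < e"
      using assms unfolding Cauchy_iff by meson
    then show "\<exists>M. \<forall>m\<ge>M. \<forall>n\<ge>M. norm (real_part (f m) - real_part (f n)) < e"
      using abs_real_part_le by (metis real_part_diff real_norm_def order.strict_trans1)
  qed
  then have "convergent (\<lambda>n. real_part (f n))" by (rule Cauchy_convergent)
  then show ?thesis unfolding convergent_def using tendsto_of_real by blast
qed

lemma rc_field_complete:
  assumes f: "Cauchy (f :: nat \<Rightarrow> 'k::rc_field)"
  shows "convergent f"
proof (rule rc_field_cases[where 'k = 'k])
  assume r: "\<And>x :: 'k. x = of_real (real_part x)"
  have "(\<lambda>n. of_real (real_part (f n))) = f" using r by auto
  then show ?thesis using Cauchy_real_part[OF f] by simp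
next
  fix j :: 'k
  assume r: "\<And>x :: 'k. x = of_real (real_part x) + of_real (real_part (- (j * x))) * j"
  have "Cauchy (\<lambda>n. - (j * f n))"
    using bounded_linear.Cauchy[OF bounded_linear_mult_right f, of "- j"] by simp
  from Cauchy_real_part[OF this]
  have "convergent (\<lambda>n. of_real (real_part (f n)) + of_real (real_part (- (j * f n))) * j)"
    by (intro convergent_add convergent_mult convergent_const Cauchy_real_part[OF f])
  moreover have "(\<lambda>n. of_real (real_part (f n)) + of_real (real_part (- (j * f n))) * j) = f" using r by auto
  ultimately show ?thesis by simp
qed

section \<open>The Hilbert space of a Hermitian form\<close>

locale semi_inner_product = vector_space s for s :: "'k::rc_field \<Rightarrow> 'a::ab_group_add \<Rightarrow> 'a" +
  fixes h :: "'a \<Rightarrow> 'a \<Rightarrow> 'k" and \<psi> :: "'a \<Rightarrow> real"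
  assumes h_add: "h (x + y) z = h x z + h y z"
    and h_scale: "h (s c x) y = c * h x y"
    and h_conj: "h y x = sconj (h x y)"
    and h_self: "h x x = of_real (\<psi> x)"
    and \<psi>_nonneg: "0 \<le> \<psi> x"
begin

definition seminorm :: "'a \<Rightarrow> real" where "seminorm x = sqrt (\<psi> x)"

lemma seminorm_nonneg [simp]: "0 \<le> seminorm x" by (simp add: seminorm_def \<psi>_nonneg)

lemma seminorm_sq: "(seminorm x)\<^sup>2 = \<psi> x" by (simp add: seminorm_def \<psi>_nonneg)

lemma h_add_right: "h x (y + z) = h x y + h x z"
  unfolding h_conj[of x] h_add sconj_add ..

lemma h_scale_right: "h x (s c y) = sconj c * h x y"
  unfolding h_conj[of x] h_scale sconj_mult ..

lemma h_diff: "h (x - y) z = h x z - h y z"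
  using h_add[of "x - y" y z] by simp

lemma h_diff_right: "h x (y - z) = h x y - h x z"
  using h_add_right[of x "y - z" z] by simp

lemma \<psi>_add: "\<psi> (x + y) = \<psi> x + 2 * real_part (h x y) + \<psi> y"
proof -
  have "(of_real (\<psi> (x + y)) :: 'k) = of_real (\<psi> x) + (h x y + sconj (h x y)) + of_real (\<psi> y)"
    unfolding h_self[symmetric] h_conj[of y x, symmetric] by (simp add: h_add h_add_right)
  also have "\<dots> = of_real (\<psi> x + 2 * real_part (h x y) + \<psi> y)" by (simp add: add_sconj)
  finally show ?thesis by (simp only: of_real_eq_iff)
qed

lemma \<psi>_scale: "\<psi> (s c x) = (norm c)\<^sup>2 * \<psi> x"
proof -
  have "(of_real (\<psi> (s c x)) :: 'k) = (c * sconj c) * of_real (\<psi> x)"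
    unfolding h_self[symmetric] by (simp add: h_scale h_scale_right mult_ac)
  also have "\<dots> = of_real ((norm c)\<^sup>2 * \<psi> x)" by (simp only: mult_sconj' of_real_mult)
  finally show ?thesis by (simp only: of_real_eq_iff)
qed

lemma seminorm_scale: "seminorm (s c x) = norm c * seminorm x"
  by (simp add: seminorm_def \<psi>_scale real_sqrt_mult)

lemma seminorm_0 [simp]: "seminorm 0 = 0"
  using seminorm_scale[of 0 0] by simp

lemma seminorm_minus: "seminorm (- x) = seminorm x"
  using seminorm_scale[of "-1" x] by simp

lemma Cauchy_Schwarz: "norm (h x y) \<le> seminorm x * seminorm y"
proof -
  have q: "0 \<le> \<psi> x - 2 * r * (norm (h x y))\<^sup>2 + r\<^sup>2 * (norm (h x y))\<^sup>2 * \<psi> y" for r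
  proof -
    have "h x (s (of_real (- r) * h x y) y) = sconj (of_real (- r) * h x y) * h x y"
      by (rule h_scale_right)
    also have "\<dots> = of_real (- r) * (h x y * sconj (h x y))"
      by (simp only: sconj_mult sconj_of_real mult_ac)
    also have "\<dots> = of_real (- r * (norm (h x y))\<^sup>2)"
      by (simp only: mult_sconj' of_real_mult)
    finally have "\<psi> (x + s (of_real (- r) * h x y) y) =
        \<psi> x + 2 * (- r * (norm (h x y))\<^sup>2) + (norm (of_real (- r) * h x y))\<^sup>2 * \<psi> y"
      by (simp only: \<psi>_add \<psi>_scale real_part_of_real)
    then show ?thesis using \<psi>_nonneg[of "x + s (of_real (- r) * h x y) y"]
      by (simp add: norm_mult power_mult_distrib)
  qed
  have "(norm (h x y))\<^sup>2 \<le> \<psi> x * \<psi> y"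
  proof (cases "\<psi> y = 0")
    case True
    have "norm (h x y) = 0"
    proof (rule ccontr)
      assume "norm (h x y) \<noteq> 0"
      then show False using q[of "(\<psi> x + 1) / (2 * (norm (h x y))\<^sup>2)"] True by (simp add: field_simps)
    qed
    then show ?thesis using True by simp
  next
    case False
    then have pos: "0 < \<psi> y" using \<psi>_nonneg[of y] by linarith
    have "0 \<le> \<psi> x - (norm (h x y))\<^sup>2 / \<psi> y"
      using q[of "1 / \<psi> y"] pos by (simp add: power2_eq_square field_simps)
    then show ?thesis using pos by (simp add: field_simps)
  qed
  then have "sqrt ((norm (h x y))\<^sup>2) \<le> sqrt (\<psi> x * \<psi> y)" by (rule real_sqrt_le_mono)
  then show ?thesis by (simp add: real_sqrt_mult seminorm_def)
qed

lemma seminorm_add: "seminorm (x + y) \<le> seminorm x + seminorm y"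
proof -
  have "\<psi> (x + y) \<le> (seminorm x + seminorm y)\<^sup>2"
    using Cauchy_Schwarz[of x y] abs_real_part_le[of "h x y"]
    by (simp add: \<psi>_add power2_sum seminorm_sq)
  then have "sqrt (\<psi> (x + y)) \<le> sqrt ((seminorm x + seminorm y)\<^sup>2)" by (rule real_sqrt_le_mono)
  then show ?thesis by (simp add: seminorm_def[of "x + y"])
qed

lemma seminorm_diff_commute: "seminorm (x - y) = seminorm (y - x)"
  using seminorm_minus[of "x - y"] by simp

lemma seminorm_diff_ge: "\<bar>seminorm x - seminorm y\<bar> \<le> seminorm (x - y)"
  using seminorm_add[of "x - y" y] seminorm_add[of "y - x" x] seminorm_diff_commute[of x y] by simp

text \<open>The completion is built from functions on the space itself: the class of a Cauchy sequence
  \<open>x\<close> is stored as the limit of the functions \<open>h (x n)\<close>, and the map \<open>h\<close> embeds the space.\<close>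

definition cauchy :: "(nat \<Rightarrow> 'a) \<Rightarrow> bool" where
  "cauchy x \<longleftrightarrow> (\<forall>e>0. \<exists>N. \<forall>m\<ge>N. \<forall>n\<ge>N. seminorm (x m - x n) < e)"

definition represents :: "(nat \<Rightarrow> 'a) \<Rightarrow> ('a \<Rightarrow> 'k) \<Rightarrow> bool" where
  "represents x g \<longleftrightarrow> cauchy x \<and> (\<forall>y. (\<lambda>n. h (x n) y) \<longlonglongrightarrow> g y)"

lemma cauchyD: "cauchy x \<Longrightarrow> 0 < e \<Longrightarrow> \<exists>N. \<forall>m\<ge>N. \<forall>n\<ge>N. seminorm (x m - x n) < e"
  by (simp add: cauchy_def)

lemma cauchy_const: "cauchy (\<lambda>_. x)"
  by (simp add: cauchy_def)

lemma cauchy_add: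
  assumes "cauchy x" "cauchy y" shows "cauchy (\<lambda>n. x n + y n)"
  unfolding cauchy_def
proof (intro allI impI)
  fix e :: real assume "0 < e"
  then obtain N M where N: "\<And>m n. N \<le> m \<Longrightarrow> N \<le> n \<Longrightarrow> seminorm (x m - x n) < e / 2"
      and M: "\<And>m n. M \<le> m \<Longrightarrow> M \<le> n \<Longrightarrow> seminorm (y m - y n) < e / 2"
    using cauchyD[OF assms(1), of "e / 2"] cauchyD[OF assms(2), of "e / 2"] by (metis half_gt_zero)
  have "seminorm ((x m + y m) - (x n + y n)) < e" if "max N M \<le> m" "max N M \<le> n" for m n
  proof -
    have "seminorm ((x m - x n) + (y m - y n)) \<le> seminorm (x m - x n) + seminorm (y m - y n)" by (rule seminorm_add)
    also have "\<dots> < e / 2 + e / 2" using that by (intro add_strict_mono N M) auto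
    finally show ?thesis by (simp add: add_diff_add)
  qed
  then show "\<exists>N. \<forall>m\<ge>N. \<forall>n\<ge>N. seminorm ((x m + y m) - (x n + y n)) < e" by blast
qed

lemma cauchy_scale:
  assumes "cauchy x" shows "cauchy (\<lambda>n. s c (x n))"
  unfolding cauchy_def
proof (intro allI impI)
  fix e :: real assume e: "0 < e"
  then have "0 < e / (norm c + 1)" by (simp add: add_nonneg_pos)
  then obtain N where N: "\<And>m n. N \<le> m \<Longrightarrow> N \<le> n \<Longrightarrow> seminorm (x m - x n) < e / (norm c + 1)"
    using cauchyD[OF assms] by blast
  have "seminorm (s c (x m) - s c (x n)) < e" if "N \<le> m" "N \<le> n" for m n
  proof -
    have "seminorm (s c (x m) - s c (x n)) = norm c * seminorm (x m - x n)"
      by (simp add: scale_right_diff_distrib[symmetric] seminorm_scale)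
    also have "\<dots> \<le> (norm c + 1) * seminorm (x m - x n)" by (intro mult_right_mono) auto
    also have "\<dots> < (norm c + 1) * (e / (norm c + 1))"
      using N[OF that] by (intro mult_strict_left_mono) (auto simp: add_nonneg_pos)
    also have "\<dots> = e" by (simp add: add_nonneg_eq_0_iff)
    finally show ?thesis .
  qed
  then show "\<exists>N. \<forall>m\<ge>N. \<forall>n\<ge>N. seminorm (s c (x m) - s c (x n)) < e" by blast
qed

lemma cauchy_bounded:
  assumes "cauchy x" obtains M where "0 < M" "\<And>n. seminorm (x n) \<le> M"
proof -
  have "Cauchy (\<lambda>n. seminorm (x n))"
    unfolding Cauchy_iff real_norm_def
    using cauchyD[OF assms] seminorm_diff_ge by (meson order.strict_trans1)
  then have "Bseq (\<lambda>n. seminorm (x n))" by (rule Cauchy_Bseq)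
  then show ?thesis using that by (auto simp: Bseq_def)
qed

lemma cauchy_pairing:
  assumes x: "cauchy x" and y: "cauchy y"
  shows "convergent (\<lambda>n. h (x n) (y n))"
proof (rule rc_field_complete)
  obtain A where A: "0 < A" "\<And>n. seminorm (x n) \<le> A" using cauchy_bounded[OF x] by blast
  obtain B where B: "0 < B" "\<And>n. seminorm (y n) \<le> B" using cauchy_bounded[OF y] by blast
  show "Cauchy (\<lambda>n. h (x n) (y n))"
    unfolding Cauchy_iff
  proof (intro allI impI)
    fix e :: real assume e: "0 < e"
    then have "0 < e / (2 * B)" "0 < e / (2 * A)" using A B by auto
    then obtain N M where N: "\<And>m n. N \<le> m \<Longrightarrow> N \<le> n \<Longrightarrow> seminorm (x m - x n) < e / (2 * B)"
      and M: "\<And>m n. M \<le> m \<Longrightarrow> M \<le> n \<Longrightarrow> seminorm (y m - y n) < e / (2 * A)"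
      using cauchyD[OF x, of "e / (2 * B)"] cauchyD[OF y, of "e / (2 * A)"] by metis
    have "norm (h (x m) (y m) - h (x n) (y n)) < e" if mn: "max N M \<le> m" "max N M \<le> n" for m n
    proof -
      have "h (x m) (y m) - h (x n) (y n) = h (x m - x n) (y m) + h (x n) (y m - y n)"
        by (simp add: h_diff h_diff_right)
      also have "norm \<dots> \<le> seminorm (x m - x n) * seminorm (y m) + seminorm (x n) * seminorm (y m - y n)"
        by (intro order_trans[OF norm_triangle_ineq] add_mono Cauchy_Schwarz)
      also have "\<dots> \<le> seminorm (x m - x n) * B + A * seminorm (y m - y n)"
        using A B by (intro add_mono mult_left_mono mult_right_mono) auto
      also have "\<dots> < e / (2 * B) * B + A * (e / (2 * A))"
        using A B mn N M by (intro add_strict_mono mult_strict_left_mono mult_strict_right_mono) auto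
      also have "\<dots> = e" using A B by simp
      finally show ?thesis .
    qed
    then show "\<exists>M. \<forall>m\<ge>M. \<forall>n\<ge>M. norm (h (x m) (y m) - h (x n) (y n)) < e" by blast
  qed
qed

lemma represents_exists: "cauchy x \<Longrightarrow> \<exists>g. represents x g"
  using cauchy_pairing[OF _ cauchy_const] unfolding represents_def convergent_def by metis

lemma represents_add: "represents x g \<Longrightarrow> represents y g' \<Longrightarrow> represents (\<lambda>n. x n + y n) (g + g')"
  by (auto simp: represents_def h_add intro!: cauchy_add tendsto_add)

lemma represents_scale: "represents x g \<Longrightarrow> represents (\<lambda>n. s c (x n)) (fscale (*) c g)"
  by (auto simp: represents_def h_scale fscale_def intro!: cauchy_scale tendsto_mult_left)

lemma represents_diff:
  assumes x: "represents x g" and y: "represents y g'"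
  shows "represents (\<lambda>n. x n - y n) (g - g')"
proof -
  have e: "g - g' = g + fscale (*) (-1) g'" by (rule ext) (simp add: fscale_def)
  have "represents (\<lambda>n. x n + s (-1) (y n)) (g + fscale (*) (-1) g')"
    by (rule represents_add[OF x represents_scale[OF y]])
  then show ?thesis unfolding e by simp
qed

lemma represents_const: "represents (\<lambda>_. x) (h x)"
  by (simp add: represents_def cauchy_const)

lemma represents_0: "represents (\<lambda>_. 0) 0"
proof -
  have "h 0 y = 0" for y using h_scale[of 0 0 y] by simp
  then have "h 0 = 0" by (simp add: fun_eq_iff)
  then show ?thesis using represents_const[of 0] by simp
qed

text \<open>A Cauchy sequence that tends weakly to zero tends to zero in the seminorm; hence the limit
  function determines the class of the sequence.\<close>

lemma represents_zero_tendsto: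
  assumes "represents x 0"
  shows "(\<lambda>n. seminorm (x n)) \<longlonglongrightarrow> 0"
proof (rule LIMSEQ_I)
  fix e :: real assume e: "0 < e"
  have x: "cauchy x" and lim: "\<And>y. (\<lambda>n. h (x n) y) \<longlonglongrightarrow> 0" using assms by (auto simp: represents_def)
  obtain A where A: "0 < A" "\<And>n. seminorm (x n) \<le> A" using cauchy_bounded[OF x] by blast
  have e': "0 < e\<^sup>2 / (2 * A)" "0 < e\<^sup>2 / 2" using e A by simp_all
  obtain N where N: "\<And>m n. N \<le> m \<Longrightarrow> N \<le> n \<Longrightarrow> seminorm (x m - x n) < e\<^sup>2 / (2 * A)"
    using cauchyD[OF x e'(1)] by blast
  obtain M where M: "\<And>n. M \<le> n \<Longrightarrow> norm (h (x n) (x N)) < e\<^sup>2 / 2"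
    using LIMSEQ_D[OF lim[of "x N"] e'(2)] by auto
  have "norm (seminorm (x n) - 0) < e" if n: "max N M \<le> n" for n
  proof -
    have "\<psi> (x n) = norm (h (x n) (x n))" by (simp add: h_self \<psi>_nonneg)
    also have "h (x n) (x n) = h (x n) (x N) + h (x n) (x n - x N)" by (simp add: h_diff_right)
    also have "norm \<dots> \<le> norm (h (x n) (x N)) + seminorm (x n) * seminorm (x n - x N)"
      by (intro order_trans[OF norm_triangle_ineq] add_mono Cauchy_Schwarz) simp
    also have "\<dots> \<le> norm (h (x n) (x N)) + A * seminorm (x n - x N)"
      using A by (intro add_mono mult_right_mono) auto
    also have "\<dots> < e\<^sup>2 / 2 + A * (e\<^sup>2 / (2 * A))"
      using n A N M by (intro add_strict_mono mult_strict_left_mono) auto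
    also have "\<dots> = e\<^sup>2" using A by simp
    finally have "(seminorm (x n))\<^sup>2 < e\<^sup>2" by (simp add: seminorm_sq)
    then show ?thesis using e by (simp add: power2_less_imp_less)
  qed
  then show "\<exists>no. \<forall>n\<ge>no. norm (seminorm (x n) - 0) < e" by blast
qed

text \<open>The inner product is computed from arbitrarily chosen representing sequences; any other
  choice leads to the same limit, by the lemma \<open>ip_tendsto\<close> below.\<close>

definition H :: "('a \<Rightarrow> 'k) set" where "H = {g. \<exists>x. represents x g}"

definition rep :: "('a \<Rightarrow> 'k) \<Rightarrow> nat \<Rightarrow> 'a" where "rep g = (SOME x. represents x g)"

definition ip :: "('a \<Rightarrow> 'k) \<Rightarrow> ('a \<Rightarrow> 'k) \<Rightarrow> 'k" where
  "ip g g' = lim (\<lambda>n. h (rep g n) (rep g' n))"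

lemma represents_rep: "represents x g \<Longrightarrow> represents (rep g) g"
  unfolding rep_def by (rule someI[of "\<lambda>x. represents x g"])

lemma ip_tendsto:
  assumes x: "represents x g" and y: "represents y g'"
  shows "(\<lambda>n. h (x n) (y n)) \<longlonglongrightarrow> ip g g'"
proof -
  let ?x = "rep g" and ?y = "rep g'"
  note x' = represents_rep[OF x] and y' = represents_rep[OF y]
  have cx: "cauchy x" "cauchy ?y" "cauchy ?x" using x x' y' by (auto simp: represents_def)
  obtain A where A: "0 < A" "\<And>n. seminorm (x n) \<le> A" using cauchy_bounded[OF cx(1)] by blast
  obtain B where B: "0 < B" "\<And>n. seminorm (?y n) \<le> B" using cauchy_bounded[OF cx(2)] by blast
  have lim: "(\<lambda>n. h (?x n) (?y n)) \<longlonglongrightarrow> ip g g'"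
    unfolding ip_def using cauchy_pairing[OF cx(3) cx(2)] by (simp add: convergent_LIMSEQ_iff)
  have zx: "(\<lambda>n. seminorm (x n - ?x n)) \<longlonglongrightarrow> 0"
    using represents_zero_tendsto[of "\<lambda>n. x n - ?x n"] represents_diff[OF x x'] by simp
  have zy: "(\<lambda>n. seminorm (y n - ?y n)) \<longlonglongrightarrow> 0"
    using represents_zero_tendsto[of "\<lambda>n. y n - ?y n"] represents_diff[OF y y'] by simp
  have "(\<lambda>n. h (x n) (y n) - h (?x n) (?y n)) \<longlonglongrightarrow> 0"
  proof (rule Lim_null_comparison)
    show "\<forall>\<^sub>F n in sequentially. norm (h (x n) (y n) - h (?x n) (?y n)) \<le> A * seminorm (y n - ?y n) + seminorm (x n - ?x n) * B"
    proof (rule always_eventually, rule allI)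
      fix n
      have "h (x n) (y n) - h (?x n) (?y n) = h (x n) (y n - ?y n) + h (x n - ?x n) (?y n)"
        by (simp add: h_diff h_diff_right)
      then have "norm (h (x n) (y n) - h (?x n) (?y n)) \<le> seminorm (x n) * seminorm (y n - ?y n) + seminorm (x n - ?x n) * seminorm (?y n)"
        using order_trans[OF norm_triangle_ineq add_mono[OF Cauchy_Schwarz Cauchy_Schwarz]] by simp
      also have "\<dots> \<le> A * seminorm (y n - ?y n) + seminorm (x n - ?x n) * B"
        using A B by (intro add_mono mult_left_mono mult_right_mono) auto
      finally show "norm (h (x n) (y n) - h (?x n) (?y n)) \<le> A * seminorm (y n - ?y n) + seminorm (x n - ?x n) * B" .
    qed
    show "(\<lambda>n. A * seminorm (y n - ?y n) + seminorm (x n - ?x n) * B) \<longlonglongrightarrow> 0"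
      using tendsto_add[OF tendsto_mult_left[OF zy, of A] tendsto_mult_right[OF zx, of B]] by simp
  qed
  from tendsto_add[OF this lim] show ?thesis by simp
qed

lemma ip_add:
  assumes x: "represents x f" and y: "represents y g" and z: "represents z k"
  shows "ip (f + g) k = ip f k + ip g k"
proof (rule LIMSEQ_unique)
  show "(\<lambda>n. h (x n + y n) (z n)) \<longlonglongrightarrow> ip (f + g) k" by (rule ip_tendsto[OF represents_add[OF x y] z])
  show "(\<lambda>n. h (x n + y n) (z n)) \<longlonglongrightarrow> ip f k + ip g k"
    unfolding h_add by (intro tendsto_add ip_tendsto x y z)
qed

lemma ip_scale:
  assumes x: "represents x f" and y: "represents y g"
  shows "ip (fscale (*) c f) g = c * ip f g"
proof (rule LIMSEQ_unique)
  show "(\<lambda>n. h (s c (x n)) (y n)) \<longlonglongrightarrow> ip (fscale (*) c f) g" by (rule ip_tendsto[OF represents_scale[OF x] y])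
  show "(\<lambda>n. h (s c (x n)) (y n)) \<longlonglongrightarrow> c * ip f g"
    unfolding h_scale by (intro tendsto_mult_left ip_tendsto x y)
qed

lemma ip_conj:
  assumes x: "represents x f" and y: "represents y g"
  shows "ip g f = sconj (ip f g)"
proof (rule LIMSEQ_unique)
  show "(\<lambda>n. h (y n) (x n)) \<longlonglongrightarrow> ip g f" by (rule ip_tendsto[OF y x])
  have "(\<lambda>n. sconj (h (x n) (y n))) \<longlonglongrightarrow> sconj (ip f g)"
    using ip_tendsto[OF x y] unfolding tendsto_iff dist_norm sconj_diff[symmetric] norm_sconj .
  then show "(\<lambda>n. h (y n) (x n)) \<longlonglongrightarrow> sconj (ip f g)" by (simp only: h_conj[of "y n" "x n" for n])
qed

lemma ip_norm_tendsto:
  assumes "represents x g"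
  shows "(\<lambda>n. seminorm (x n)) \<longlonglongrightarrow> ip_norm ip g"
proof -
  have "(\<lambda>n. sqrt (norm (h (x n) (x n)))) \<longlonglongrightarrow> ip_norm ip g"
    unfolding ip_norm_def by (intro tendsto_real_sqrt tendsto_norm ip_tendsto assms)
  then show ?thesis by (simp add: h_self \<psi>_nonneg seminorm_def)
qed

lemma ip_self:
  assumes "represents x g" shows "ip g g = of_real ((ip_norm ip g)\<^sup>2)"
proof -
  have "(\<lambda>n. of_real ((seminorm (x n))\<^sup>2) :: 'k) \<longlonglongrightarrow> of_real ((ip_norm ip g)\<^sup>2)"
    by (intro tendsto_of_real tendsto_power ip_norm_tendsto assms)
  moreover have "(\<lambda>n. of_real ((seminorm (x n))\<^sup>2) :: 'k) \<longlonglongrightarrow> ip g g"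
    using ip_tendsto[OF assms assms] by (simp add: h_self seminorm_sq)
  ultimately show ?thesis by (rule LIMSEQ_unique[symmetric])
qed

lemma ip_norm_nonneg: "0 \<le> ip_norm ip g" by (simp add: ip_norm_def)

lemma ip_norm_zero:
  assumes x: "represents x g" and z: "ip_norm ip g = 0" shows "g = 0"
proof
  fix y
  have zero: "(\<lambda>n. h (x n) y) \<longlonglongrightarrow> 0"
  proof (rule Lim_null_comparison)
    show "\<forall>\<^sub>F n in sequentially. norm (h (x n) y) \<le> seminorm (x n) * seminorm y"
      by (intro always_eventually allI Cauchy_Schwarz)
    show "(\<lambda>n. seminorm (x n) * seminorm y) \<longlonglongrightarrow> 0"
      using tendsto_mult_right[OF ip_norm_tendsto[OF x], of "seminorm y"] z by simp
  qed
  have "(\<lambda>n. h (x n) y) \<longlonglongrightarrow> g y" using x by (simp add: represents_def)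
  from LIMSEQ_unique[OF this zero] show "g y = 0 y" by simp
qed

lemma ip_norm_add:
  assumes x: "represents x f" and y: "represents y g"
  shows "ip_norm ip (f + g) \<le> ip_norm ip f + ip_norm ip g"
  by (rule LIMSEQ_le[OF ip_norm_tendsto[OF represents_add[OF x y]]
        tendsto_add[OF ip_norm_tendsto[OF x] ip_norm_tendsto[OF y]]]) (use seminorm_add in blast)

lemma ip_norm_embedding: "ip_norm ip (h x) = seminorm x"
  using LIMSEQ_unique[OF ip_norm_tendsto[OF represents_const] tendsto_const[of "seminorm x"]] by simp

lemma embedding_diff: "h x - h y = h (x - y)"
  by (rule ext) (simp add: h_diff)

lemma ip_norm_diff_commute:
  assumes "represents x f" "represents y g" shows "ip_norm ip (f - g) = ip_norm ip (g - f)"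
  using LIMSEQ_unique[OF ip_norm_tendsto[OF represents_diff[OF assms]]
      ip_norm_tendsto[OF represents_diff[OF assms(2,1)], unfolded seminorm_diff_commute[of "y _"]]] .

lemma embedding_dense:
  assumes x: "represents x g" and e: "0 < e"
  shows "\<exists>N. \<forall>m\<ge>N. ip_norm ip (g - h (x m)) \<le> e"
proof -
  have "cauchy x" using x by (simp add: represents_def)
  then obtain N where N: "\<And>m n. N \<le> m \<Longrightarrow> N \<le> n \<Longrightarrow> seminorm (x m - x n) < e" using cauchyD[OF _ e] by blast
  have "ip_norm ip (g - h (x m)) \<le> e" if "N \<le> m" for m
    by (rule LIMSEQ_le_const2[OF ip_norm_tendsto[OF represents_diff[OF x represents_const]]])
      (use N[OF _ that] in \<open>auto intro!: exI[of _ N] less_imp_le\<close>)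
  then show ?thesis by blast
qed

lemma H_complete: "complete_for H (ip_norm ip)"
  unfolding complete_for_def
proof (intro allI impI, elim conjE)
  fix f :: "nat \<Rightarrow> 'a \<Rightarrow> 'k"
  assume f_H: "\<forall>n. f n \<in> H" and f_C: "\<forall>e>0. \<exists>N. \<forall>m\<ge>N. \<forall>n\<ge>N. ip_norm ip (f m - f n) < e"
  obtain X where X: "\<And>n. represents (X n) (f n)" using f_H unfolding H_def by (auto dest!: choice)
  have "\<exists>z. ip_norm ip (f n - h z) \<le> 1 / real (Suc n)" for n
    using embedding_dense[OF X, of "1 / real (Suc n)" n] by auto
  then obtain z where z: "\<And>n. ip_norm ip (f n - h (z n)) \<le> 1 / real (Suc n)" by metis
  have zero: "(\<lambda>n. 1 / real (Suc n)) \<longlonglongrightarrow> 0" by (rule LIMSEQ_Suc[OF lim_1_over_n])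
  have fz: "represents (\<lambda>k. X n k - z n) (f n - h (z n))" for n by (rule represents_diff[OF X represents_const])
  have "cauchy z"
    unfolding cauchy_def
  proof (intro allI impI)
    fix e :: real assume e: "0 < e"
    then obtain N where N: "\<And>m n. N \<le> m \<Longrightarrow> N \<le> n \<Longrightarrow> ip_norm ip (f m - f n) < e / 3"
      using f_C by (meson divide_pos_pos zero_less_numeral)
    obtain M where M: "\<And>n. M \<le> n \<Longrightarrow> 1 / real (Suc n) < e / 3"
      using LIMSEQ_D[OF zero, of "e / 3"] e by auto
    have "seminorm (z m - z n) < e" if mn: "max N M \<le> m" "max N M \<le> n" for m n
    proof -
      have "seminorm (z m - z n) = ip_norm ip (h (z m) - h (z n))" by (simp add: embedding_diff ip_norm_embedding)
      also have "h (z m) - h (z n) = (h (z m) - f m) + ((f m - f n) + (f n - h (z n)))" by simp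
      also have "ip_norm ip \<dots> \<le> ip_norm ip (h (z m) - f m) + (ip_norm ip (f m - f n) + ip_norm ip (f n - h (z n)))"
        by (rule order_trans[OF ip_norm_add add_left_mono[OF ip_norm_add]])
          (rule represents_diff[OF represents_const X] represents_diff[OF X X] fz
            represents_add[OF represents_diff[OF X X] fz])+
      also have "\<dots> < e / 3 + (e / 3 + e / 3)"
        using mn N[of m n] order.strict_trans1[OF z M, of m] order.strict_trans1[OF z M, of n]
          ip_norm_diff_commute[OF X represents_const, of m "z m"]
        by (intro add_strict_mono) auto
      finally show ?thesis by simp
    qed
    then show "\<exists>N. \<forall>m\<ge>N. \<forall>n\<ge>N. seminorm (z m - z n) < e" by blast
  qed
  then obtain l where l: "represents z l" using represents_exists by blast
  have "(\<lambda>n. ip_norm ip (f n - l)) \<longlonglongrightarrow> 0"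
  proof (rule LIMSEQ_I)
    fix e :: real assume e: "0 < e"
    obtain M where M: "\<And>n. M \<le> n \<Longrightarrow> 1 / real (Suc n) < e / 2"
      using LIMSEQ_D[OF zero, of "e / 2"] e by auto
    obtain N where N: "\<And>n. N \<le> n \<Longrightarrow> ip_norm ip (l - h (z n)) \<le> e / 2"
      using embedding_dense[OF l, of "e / 2"] e by auto
    have "norm (ip_norm ip (f n - l) - 0) < e" if n: "max N M \<le> n" for n
    proof -
      have "f n - l = (f n - h (z n)) + (h (z n) - l)" by simp
      then have "ip_norm ip (f n - l) \<le> ip_norm ip (f n - h (z n)) + ip_norm ip (h (z n) - l)"
        using ip_norm_add[OF fz represents_diff[OF represents_const l], of n "z n"] by simp
      also have "\<dots> < e / 2 + e / 2"
        using n N[of n] order.strict_trans1[OF z M, of n] ip_norm_diff_commute[OF l represents_const, of "z n"]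
        by (intro add_less_le_mono) auto
      finally show ?thesis by (simp add: ip_norm_nonneg)
    qed
    then show "\<exists>no. \<forall>n\<ge>no. norm (ip_norm ip (f n - l) - 0) < e" by blast
  qed
  then show "\<exists>l\<in>H. (\<lambda>n. ip_norm ip (f n - l)) \<longlonglongrightarrow> 0" using l by (auto simp: H_def)
qed

theorem hilbert_space_H: "hilbert_space (fscale (*)) H ip"
proof -
  have v: "vector_space (fscale (*) :: 'k \<Rightarrow> ('a \<Rightarrow> 'k) \<Rightarrow> _)"
    by (rule vector_space_fscale) (unfold_locales, auto simp: algebra_simps)
  then interpret F: vector_space "fscale (*) :: 'k \<Rightarrow> ('a \<Rightarrow> 'k) \<Rightarrow> _" .
  have "F.subspace H"
    unfolding F.subspace_def H_def using represents_0 represents_add represents_scale by blast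
  note subspace = this
  have pos: "\<exists>r>0. ip g g = of_real r" if "represents x g" "g \<noteq> 0" for x g
    using ip_norm_zero[OF that(1)] that(2) ip_self[OF that(1)] ip_norm_nonneg[of g]
    by (intro exI[of _ "(ip_norm ip g)\<^sup>2"]) auto
  show ?thesis
    unfolding hilbert_space_def
  proof (intro conjI ballI allI impI)
    fix c f g k assume f: "f \<in> H" and g: "g \<in> H"
    then obtain x y where x: "represents x f" and y: "represents y g" unfolding H_def by blast
    show "ip (fscale (*) c f) g = c * ip f g" by (rule ip_scale[OF x y])
    show "ip g f = sconj (ip f g)" by (rule ip_conj[OF x y])
    show "\<exists>r>0. ip f f = of_real r" if "f \<noteq> 0" by (rule pos[OF x that])
    assume "k \<in> H"
    then obtain z where z: "represents z k" unfolding H_def by blast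
    show "ip (f + g) k = ip f k + ip g k" by (rule ip_add[OF x y z])
  qed (fact v subspace H_complete)+
qed

end

section \<open>From forms to factorizations\<close>

lemma opnorm_le:
  fixes B :: real
  assumes "0 \<in> S" "p 0 \<le> 1" "\<And>x. x \<in> S \<Longrightarrow> q (u x) \<le> B * p x" "0 \<le> B"
  shows "opnorm S p q u \<le> B"
  unfolding opnorm_def
proof (rule cSUP_least)
  show "{x \<in> S. p x \<le> 1} \<noteq> {}" using assms by auto
  fix x assume x: "x \<in> {x \<in> S. p x \<le> 1}"
  then have "B * p x \<le> B * 1" using assms(4) by (intro mult_left_mono) auto
  then show "q (u x) \<le> B" using assms(3)[of x] x by simp
qed

lemma opnorm_bdd_above:
  fixes B :: real
  assumes "\<And>x. x \<in> S \<Longrightarrow> q (u x) \<le> B * p x" "\<And>x. 0 \<le> p x"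
  shows "bdd_above ((\<lambda>x. q (u x)) ` {x \<in> S. p x \<le> 1})"
proof (rule bdd_aboveI2)
  fix x assume x: "x \<in> {x \<in> S. p x \<le> 1}"
  have "B * p x \<le> \<bar>B\<bar> * 1" using x assms(2)[of x] by (intro mult_mono) auto
  then show "q (u x) \<le> \<bar>B\<bar>" using assms(1)[of x] x by simp
qed

text \<open>Since \<open>u\<close> is bounded by the seminorm, it extends to limits of Cauchy sequences. The quasi-norm
  need not be continuous, and the passage to the limit costs the factor \<open>K\<close>.\<close>

lemma (in semi_inner_product) gamma2_le:
  fixes t :: "'k \<Rightarrow> 'b::ab_group_add \<Rightarrow> 'b"
  assumes Y: "quasi_banach t q" and K: "\<And>x y. q (x + y) \<le> K * (q x + q y)" "1 \<le> K"
    and u_add: "\<And>x y. u (x + y) = u x + u y" and u_scale: "\<And>c x. u (s c x) = t c (u x)"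
    and u_le: "\<And>x. q (u x) \<le> seminorm x" and seminorm_le: "\<And>x. seminorm x \<le> \<gamma> * p x"
    and p: "\<And>x. 0 \<le> p x" "p 0 = 0" and \<gamma>: "0 \<le> \<gamma>"
  shows "gamma2 s p t q u \<le> ennreal (K * \<gamma>)"
proof -
  interpret Y: vector_space t using Y by (simp add: quasi_banach_def)
  have q_nonneg: "0 \<le> q y" and q_zero: "q y = 0 \<longleftrightarrow> y = 0" and q_scale: "q (t c y) = norm c * q y" for c y
    using Y by (auto simp: quasi_banach_def quasi_norm_def)
  have q_comm: "q (x - y) = q (y - x)" for x y
    using q_scale[of "-1" "x - y"] by simp
  have q_tri: "q (x - z) \<le> K * (q (x - y) + q (y - z))" for x y z
    using K(1)[of "x - y" "y - z"] by simp
  have u_diff: "u (x - y) = u x - u y" for x y using u_add[of "x - y" y] by simp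
  have null: "f \<longlonglongrightarrow> 0" if "\<And>n. f n \<le> K * (a n + b n)" "\<And>n. 0 \<le> f n" "a \<longlonglongrightarrow> 0" "b \<longlonglongrightarrow> 0" for f a b :: "nat \<Rightarrow> real"
  proof (rule Lim_null_comparison)
    show "\<forall>\<^sub>F n in sequentially. norm (f n) \<le> K * (a n + b n)"
      using that(1,2) by (intro always_eventually) simp
    show "(\<lambda>n. K * (a n + b n)) \<longlonglongrightarrow> 0"
      using tendsto_mult_left[OF tendsto_add[OF that(3,4)], of K] by simp
  qed
  have unique: "l = l'" if "(\<lambda>n. q (a n - l)) \<longlonglongrightarrow> 0" "(\<lambda>n. q (a n - l')) \<longlonglongrightarrow> 0" for a l l'
  proof -
    have "(\<lambda>_::nat. q (l - l')) \<longlonglongrightarrow> 0"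
      by (rule null[OF _ q_nonneg that]) (use q_tri q_comm in metis)
    then have "q (l - l') = 0" by (simp add: LIMSEQ_const_iff)
    then show ?thesis by (simp add: q_zero)
  qed
  have exists: "\<exists>l. (\<lambda>n. q (u (x n) - l)) \<longlonglongrightarrow> 0" if x: "cauchy x" for x
  proof -
    have "\<forall>e>0. \<exists>N. \<forall>m\<ge>N. \<forall>n\<ge>N. q (u (x m) - u (x n)) < e"
      using x u_le unfolding cauchy_def u_diff[symmetric] by (meson order.strict_trans1)
    moreover have "complete_for UNIV q" using Y by (simp add: quasi_banach_def)
    ultimately show ?thesis unfolding complete_for_def by (auto dest!: spec[of _ "\<lambda>n. u (x n)"])
  qed
  define v where "v g = (SOME l. (\<lambda>n. q (u (rep g n) - l)) \<longlonglongrightarrow> 0)" for g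
  have v: "(\<lambda>n. q (u (x n) - v g)) \<longlonglongrightarrow> 0" if x: "represents x g" for x g
  proof -
    have r: "represents (rep g) g" by (rule represents_rep[OF x])
    then have "\<exists>l. (\<lambda>n. q (u (rep g n) - l)) \<longlonglongrightarrow> 0" by (intro exists) (simp add: represents_def)
    then have rep: "(\<lambda>n. q (u (rep g n) - v g)) \<longlonglongrightarrow> 0" unfolding v_def by (rule someI_ex)
    have diff: "(\<lambda>n. seminorm (x n - rep g n)) \<longlonglongrightarrow> 0"
      using represents_zero_tendsto[of "\<lambda>n. x n - rep g n"] represents_diff[OF x r] by simp
    show ?thesis
    proof (rule null[OF _ q_nonneg diff rep])
      fix n
      have "q (u (x n) - v g) \<le> K * (q (u (x n) - u (rep g n)) + q (u (rep g n) - v g))" by (rule q_tri)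
      also have "\<dots> \<le> K * (seminorm (x n - rep g n) + q (u (rep g n) - v g))"
        using u_le[of "x n - rep g n"] K(2) by (intro mult_left_mono add_right_mono) (auto simp: u_diff)
      finally show "q (u (x n) - v g) \<le> K * (seminorm (x n - rep g n) + q (u (rep g n) - v g))" .
    qed
  qed
  have v_h: "v (h x) = u x" for x
    using v[OF represents_const, of x] by (simp add: LIMSEQ_const_iff q_zero)
  have v_add: "v (f + g) = v f + v g" if x: "represents x f" and y: "represents y g" for x y f g
  proof (rule unique)
    show "(\<lambda>n. q (u (x n + y n) - v (f + g))) \<longlonglongrightarrow> 0" by (rule v[OF represents_add[OF x y]])
    show "(\<lambda>n. q (u (x n + y n) - (v f + v g))) \<longlonglongrightarrow> 0"
    proof (rule null[OF _ q_nonneg v[OF x] v[OF y]])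
      fix n
      have "u (x n + y n) - (v f + v g) = (u (x n) - v f) + (u (y n) - v g)" by (simp add: u_add)
      then show "q (u (x n + y n) - (v f + v g)) \<le> K * (q (u (x n) - v f) + q (u (y n) - v g))"
        using K(1) by metis
    qed
  qed
  have v_scale: "v (fscale (*) c f) = t c (v f)" if x: "represents x f" for x f c
  proof (rule unique)
    show "(\<lambda>n. q (u (s c (x n)) - v (fscale (*) c f))) \<longlonglongrightarrow> 0" by (rule v[OF represents_scale[OF x]])
    have "u (s c (x n)) - t c (v f) = t c (u (x n) - v f)" for n
      by (simp add: u_scale Y.scale_right_diff_distrib)
    then show "(\<lambda>n. q (u (s c (x n)) - t c (v f))) \<longlonglongrightarrow> 0"
      using tendsto_mult_left[OF v[OF x], of "norm c"] by (simp add: q_scale)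
  qed
  have v_le: "q (v g) \<le> K * ip_norm ip g" if x: "represents x g" for x g
  proof (rule LIMSEQ_le_const)
    show "(\<lambda>n. K * (q (u (x n) - v g) + seminorm (x n))) \<longlonglongrightarrow> K * ip_norm ip g"
      using tendsto_mult_left[OF tendsto_add[OF v[OF x] ip_norm_tendsto[OF x]], of K] by simp
    have "q (v g) \<le> K * (q (u (x n) - v g) + seminorm (x n))" for n
    proof -
      have "q (v g) \<le> K * (q (v g - u (x n)) + q (u (x n)))" using K(1)[of "v g - u (x n)" "u (x n)"] by simp
      also have "\<dots> \<le> K * (q (u (x n) - v g) + seminorm (x n))"
        using K(2) u_le by (intro mult_left_mono add_mono) (auto simp: q_comm[of "v g"])
      finally show ?thesis .
    qed
    then show "\<exists>N. \<forall>n\<ge>N. q (v g) \<le> K * (q (u (x n) - v g) + seminorm (x n))" by blast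
  qed
  have w: "bounded_op s UNIV p (fscale (*)) H (ip_norm ip) h"
    unfolding bounded_op_def
  proof (intro conjI ballI allI)
    show "h ` UNIV \<subseteq> H" using represents_const by (auto simp: H_def)
    show "h (x + y) = h x + h y" for x y by (rule ext) (simp add: h_add)
    show "h (s c x) = fscale (*) c (h x)" for c x by (rule ext) (simp add: h_scale fscale_def)
    show "\<exists>B. \<forall>x\<in>UNIV. ip_norm ip (h x) \<le> B * p x"
      using seminorm_le by (auto simp: ip_norm_embedding)
  qed
  have v_op: "bounded_op (fscale (*)) H (ip_norm ip) t UNIV q v"
    unfolding bounded_op_def using v_add v_scale v_le by (auto simp: H_def intro!: exI[of _ K])
  have "opnorm H (ip_norm ip) q v * opnorm UNIV p (ip_norm ip) h \<le> K * \<gamma>"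
  proof (rule mult_mono)
    have zero: "0 \<in> H" using represents_0 by (auto simp: H_def)
    show "opnorm H (ip_norm ip) q v \<le> K"
    proof (rule opnorm_le[OF zero])
      show "ip_norm ip 0 \<le> 1"
        using LIMSEQ_unique[OF ip_norm_tendsto[OF represents_0] tendsto_const[of "seminorm 0"]] by simp
    qed (use v_le K in \<open>auto simp: H_def\<close>)
    show "opnorm UNIV p (ip_norm ip) h \<le> \<gamma>"
      by (rule opnorm_le) (use p \<gamma> seminorm_le in \<open>auto simp: ip_norm_embedding\<close>)
    have "bdd_above ((\<lambda>x. ip_norm ip (h x)) ` {x \<in> UNIV. p x \<le> 1})"
      by (rule opnorm_bdd_above[of _ _ _ \<gamma>]) (use seminorm_le p in \<open>auto simp: ip_norm_embedding\<close>)
    from cSUP_upper[OF _ this, of 0] p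
    show "0 \<le> opnorm UNIV p (ip_norm ip) h" by (simp add: opnorm_def ip_norm_embedding)
  qed (use K in simp)
  moreover have "u = v \<circ> h" by (simp add: fun_eq_iff v_h)
  ultimately show ?thesis
    unfolding gamma2_def using hilbert_space_H w v_op
    by (intro Inf_lower2[of "ennreal (opnorm H (ip_norm ip) q v * opnorm UNIV p (ip_norm ip) h)"] ennreal_leI) blast+
qed

text \<open>A real quadratic form is averaged over the multiplication by the imaginary unit \<open>j\<close>; over
  the reals \<open>j = 1\<close> and nothing changes.\<close>

lemma hermitian_form:
  fixes s :: "'k::rc_field \<Rightarrow> 'a::ab_group_add \<Rightarrow> 'a"
  assumes s: "vector_space s" and \<phi>: "quadratic_form (\<lambda>r. s (of_real r)) p K \<phi> \<gamma>"
  obtains h \<psi> and j :: 'k where "semi_inner_product s h \<psi>" "norm j = 1" "\<And>x. \<psi> x = (\<phi> x + \<phi> (s j x)) / 2"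
proof -
  interpret vector_space s by (rule s)
  interpret Q: quadratic_form "\<lambda>r. s (of_real r)" p K \<phi> \<gamma> by (rule \<phi>)
  show thesis
  proof (rule rc_field_cases[where 'k = 'k])
    assume r: "\<And>x :: 'k. x = of_real (real_part x)"
    define h where "h x y = (of_real (Q.B x y) :: 'k)" for x y
    have "semi_inner_product s h \<phi>"
    proof
      show "h (x + y) z = h x z + h y z" for x y z by (simp add: h_def Q.B_add_left)
      show "h (s c x) y = c * h x y" for c x y
        using Q.B_scale_left[of "real_part c" x y] r[of c] by (metis h_def of_real_mult)
      show "h y x = sconj (h x y)" for x y by (simp add: h_def Q.B_commute)
      show "h x x = of_real (\<phi> x)" for x by (simp add: h_def Q.B_self)
      show "0 \<le> \<phi> x" for x by simp
    qed
    then show thesis by (rule that[of h \<phi> 1]) simp_all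
  next
    fix j :: 'k
    assume j: "j * j = -1" "sconj j = - j"
      and r: "\<And>x :: 'k. x = of_real (real_part x) + of_real (real_part (- (j * x))) * j"
    have "(norm j)\<^sup>2 = 1" by (metis j(1) norm_minus_cancel norm_mult norm_one power2_eq_square)
    then have norm_j: "norm j = 1" by (simp add: power2_eq_1_iff) (use norm_ge_zero[of j] in linarith)
    define b where "b x y = (Q.B x y + Q.B (s j x) (s j y)) / 2" for x y
    define h where "h x y = of_real (b x y) + j * of_real (b x (s j y))" for x y
    have jj: "s j (s j x) = - x" for x by (simp add: j(1))
    have b_add: "b (x + y) z = b x z + b y z" for x y z
      by (simp add: b_def Q.B_add_left scale_right_distrib add_divide_distrib)
    have b_scale: "b (s (of_real c) x) y = c * b x y" for c x y
    proof -
      have "s j (s (of_real c) x) = s (of_real c) (s j x)" by (simp add: mult.commute)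
      then show ?thesis using Q.B_scale_left by (simp add: b_def distrib_left del: scale_scale)
    qed
    have b_comm: "b x y = b y x" for x y by (simp add: b_def Q.B_commute)
    have B_minus_right: "Q.B x (- y) = - Q.B x y" for x y
      using Q.B_minus_left[of y x] by (simp add: Q.B_commute)
    have b_j: "b (s j x) (s j y) = b x y" for x y
      by (simp only: b_def jj Q.B_minus_left B_minus_right) (simp add: add.commute)
    have b_minus: "b (- x) y = - b x y" for x y using b_scale[of "-1" x y] by simp
    have b_skew: "b (s j x) y = - b x (s j y)" for x y
      using b_j[of "s j x" y] by (simp only: jj b_minus)
    have h_add: "h (x + y) z = h x z + h y z" for x y z by (simp add: h_def b_add algebra_simps)
    have h_real: "h (s (of_real c) x) y = of_real c * h x y" for c x y
      by (simp only: h_def b_scale of_real_mult distrib_left mult_ac)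
    have h_j: "h (s j x) y = j * h x y" for x y
    proof -
      have "h (s j x) y = j * of_real (b x y) - of_real (b x (s j y))"
        unfolding h_def b_j b_skew[of x y] by simp
      also have "\<dots> = j * of_real (b x y) + (j * j) * of_real (b x (s j y))" by (simp add: j(1))
      finally show ?thesis by (simp add: h_def distrib_left mult.assoc)
    qed
    have "semi_inner_product s h (\<lambda>x. (\<phi> x + \<phi> (s j x)) / 2)"
    proof
      show "h (x + y) z = h x z + h y z" for x y z by (rule h_add)
      show "h (s c x) y = c * h x y" for c x y
      proof -
        let ?a = "real_part c" and ?b = "real_part (- (j * c))"
        have "s c x = s (of_real ?a) x + s (of_real ?b) (s j x)"
          using r[of c] by (metis scale_left_distrib scale_scale)
        then have "h (s c x) y = of_real ?a * h x y + of_real ?b * (j * h x y)"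
          by (simp only: h_add h_real h_j)
        also have "\<dots> = (of_real ?a + of_real ?b * j) * h x y" by (simp add: distrib_right mult.assoc)
        finally show ?thesis using r[of c] by simp
      qed
      show "h y x = sconj (h x y)" for x y
        unfolding h_def sconj_add sconj_mult sconj_of_real j(2) b_comm[of y x]
        using b_skew[of x y] b_comm[of y "s j x"] by simp
      show "h x x = of_real ((\<phi> x + \<phi> (s j x)) / 2)" for x
      proof -
        have "b x (s j x) = 0" using b_skew[of x x] b_comm[of "s j x" x] by simp
        then show ?thesis by (simp add: h_def b_def Q.B_self)
      qed
      show "0 \<le> (\<phi> x + \<phi> (s j x)) / 2" for x by simp
    qed
    then show thesis by (rule that[OF _ norm_j]) simp
  qed
qed

section \<open>Real and complex functionals\<close>

text \<open>The functional with real part \<open>\<psi>\<close> is \<open>\<psi> x - j \<psi> (j x)\<close>.\<close>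

lemma real_part_functional:
  fixes s :: "'k::rc_field \<Rightarrow> 'a::ab_group_add \<Rightarrow> 'a"
  assumes s: "vector_space s"
    and \<psi>: "\<And>x y. \<psi> (x + y) = \<psi> x + \<psi> y" "\<And>c x. \<psi> (s (of_real c) x) = c * \<psi> x"
  obtains f :: "'a \<Rightarrow> 'k" where "\<And>x y. f (x + y) = f x + f y" "\<And>c x. f (s c x) = c * f x" "\<And>x. real_part (f x) = \<psi> x"
proof -
  interpret vector_space s by (rule s)
  show thesis
  proof (rule rc_field_cases[where 'k = 'k])
    assume r: "\<And>x :: 'k. x = of_real (real_part x)"
    show thesis
    proof (rule that)
      show "of_real (\<psi> (s c x)) = c * of_real (\<psi> x)" for c :: 'k and x
        using \<psi>(2)[of "real_part c" x] r[of c] by (metis of_real_mult)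
    qed (simp_all add: \<psi>)
  next
    fix j :: 'k
    assume j: "j * j = -1" "sconj j = - j"
      and r: "\<And>x :: 'k. x = of_real (real_part x) + of_real (real_part (- (j * x))) * j"
    define f where "f x = of_real (\<psi> x) - j * of_real (\<psi> (s j x))" for x
    have \<psi>_minus: "\<psi> (- x) = - \<psi> x" for x using \<psi>(2)[of "-1" x] by simp
    have f_add: "f (x + y) = f x + f y" for x y by (simp add: f_def \<psi>(1) scale_right_distrib algebra_simps)
    have f_real: "f (s (of_real c) x) = of_real c * f x" for c x
    proof -
      have "s j (s (of_real c) x) = s (of_real c) (s j x)" by (simp add: mult.commute)
      then show ?thesis by (simp only: f_def \<psi>(2) of_real_mult right_diff_distrib mult_ac)
    qed
    have f_j: "f (s j x) = j * f x" for x
    proof -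
      have "s j (s j x) = - x" by (simp add: j(1))
      then have "f (s j x) = of_real (\<psi> (s j x)) + j * of_real (\<psi> x)" by (simp only: f_def \<psi>_minus) simp
      also have "\<dots> = j * of_real (\<psi> x) - (j * j) * of_real (\<psi> (s j x))" by (simp add: j(1))
      finally show ?thesis by (simp add: f_def right_diff_distrib mult.assoc)
    qed
    show thesis
    proof (rule that[of f, OF f_add])
      show "f (s c x) = c * f x" for c x
      proof -
        let ?a = "real_part c" and ?b = "real_part (- (j * c))"
        have "s c x = s (of_real ?a) x + s (of_real ?b) (s j x)"
          using r[of c] by (metis scale_left_distrib scale_scale)
        then have "f (s c x) = of_real ?a * f x + of_real ?b * (j * f x)"
          by (simp only: f_add f_real f_j)
        also have "\<dots> = (of_real ?a + of_real ?b * j) * f x" by (simp add: distrib_right mult.assoc)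
        finally show ?thesis using r[of c] by simp
      qed
      show "real_part (f x) = \<psi> x" for x
        by (rule real_part_eqI) (simp add: f_def sconj_diff sconj_mult j(2))
    qed
  qed
qed

lemma quasi_norm_real:
  fixes s :: "'k::rc_field \<Rightarrow> 'a::ab_group_add \<Rightarrow> 'a"
  assumes s: "vector_space s" and q: "quasi_norm s q"
  obtains K where "qnorm (\<lambda>r. s (of_real r)) q K"
proof -
  interpret vector_space s by (rule s)
  obtain K where K: "\<And>x y. q (x + y) \<le> K * (q x + q y)" using q by (auto simp: quasi_norm_def)
  have nonneg: "0 \<le> q x" for x using q by (simp add: quasi_norm_def)
  have "q (x + y) \<le> max 1 K * (q x + q y)" for x y
  proof -
    have "K * (q x + q y) \<le> max 1 K * (q x + q y)" by (intro mult_right_mono) (auto simp: nonneg)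
    then show ?thesis using K[of x y] by linarith
  qed
  then have "qnorm (\<lambda>r. s (of_real r)) q (max 1 K)"
    using q by unfold_locales
      (auto simp: quasi_norm_def scale_right_distrib scale_left_distrib)
  then show thesis by (rule that)
qed

text \<open>Multiplying the argument by a scalar of modulus 1 makes the value of \<open>f\<close> real and
  nonnegative, and the unit ball is invariant under this: the real part alone has the norm of \<open>f\<close>.
  So the dual of \<open>X\<close> and the dual of the underlying real space have the same norms.\<close>

lemma dual_norm_eq:
  fixes s :: "'k::rc_field \<Rightarrow> 'a::ab_group_add \<Rightarrow> 'a"
  assumes s: "vector_space s" and p: "quasi_norm s p" and P: "qnorm (\<lambda>r. s (of_real r)) p K"
    and f: "f \<in> dual s p"
  shows "dual_norm p f = qnorm.functional_norm p (\<lambda>x. real_part (f x))"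
    and "qnorm.real_functional (\<lambda>r. s (of_real r)) p (\<lambda>x. real_part (f x))"
proof -
  interpret vector_space s by (rule s)
  interpret P: qnorm "\<lambda>r. s (of_real r)" p K by (rule P)
  have f_add: "f (x + y) = f x + f y" and f_scale: "f (s c x) = c * f x" for x y c
    using f by (auto simp: dual_def bounded_ops_def bounded_op_def)
  obtain M where M: "\<And>x. norm (f x) \<le> M * p x"
    using f by (auto simp: dual_def bounded_ops_def bounded_op_def)
  have re_le: "real_part (f x) \<le> M * p x" for x
    using abs_real_part_le[of "f x"] M[of x] by linarith
  show fn: "P.real_functional (\<lambda>x. real_part (f x))"
    unfolding P.real_functional_def f_add f_scale real_part_add real_part_mult_of_real
    using re_le by (auto intro!: exI[of _ M])
  have bdd: "bdd_above ((\<lambda>x. norm (f x)) ` {x \<in> UNIV. p x \<le> 1})"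
    by (rule opnorm_bdd_above[of _ norm f M]) (use M in auto)
  have ne: "{x. p x \<le> 1} \<noteq> {}" by (auto intro!: exI[of _ 0])
  show "dual_norm p f = P.functional_norm (\<lambda>x. real_part (f x))"
  proof (rule antisym)
    show "dual_norm p f \<le> P.functional_norm (\<lambda>x. real_part (f x))"
      unfolding dual_norm_def opnorm_def
    proof (rule cSUP_least)
      fix x assume x: "x \<in> {x \<in> UNIV. p x \<le> 1}"
      have "\<exists>c. norm c = 1 \<and> c * f x = of_real (norm (f x))"
      proof (cases "f x = 0")
        case False
        have "sconj (f x) * f x = of_real ((norm (f x))\<^sup>2)" using mult_sconj'[of "f x"] by (simp add: mult.commute)
        then show ?thesis using False
          by (intro exI[of _ "sconj (f x) / of_real (norm (f x))"]) (simp add: norm_divide power2_eq_square)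
      qed (auto intro!: exI[of _ 1])
      then obtain c where c: "norm c = 1" "c * f x = of_real (norm (f x))" by blast
      have "p (s c x) \<le> 1" using p x c(1) by (simp add: quasi_norm_def)
      then have "real_part (f (s c x)) \<le> P.functional_norm (\<lambda>x. real_part (f x))"
        unfolding P.functional_norm_def by (intro cSUP_upper P.functional_norm_bdd fn) simp
      then show "norm (f x) \<le> P.functional_norm (\<lambda>x. real_part (f x))" by (simp add: f_scale c(2))
    qed (use ne in simp)
    show "P.functional_norm (\<lambda>x. real_part (f x)) \<le> dual_norm p f"
      unfolding P.functional_norm_def
    proof (rule cSUP_least[OF ne])
      fix x assume x: "x \<in> {x. p x \<le> 1}"
      have "real_part (f x) \<le> norm (f x)" using abs_real_part_le[of "f x"] by linarith
      also have "\<dots> \<le> dual_norm p f"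
        unfolding dual_norm_def opnorm_def using x by (intro cSUP_upper bdd) simp
      finally show "real_part (f x) \<le> dual_norm p f" .
    qed
  qed
qed

lemma cotype2_constant:
  fixes s :: "'k::rc_field \<Rightarrow> 'a::ab_group_add \<Rightarrow> 'a"
  assumes "cotype2 s S q"
  obtains C where "0 < C" "\<And>N x. (\<And>i. i < N \<Longrightarrow> x i \<in> S) \<Longrightarrow> (\<Sum>i<N. (q (x i))\<^sup>2) \<le>
    C\<^sup>2 * ((\<Sum>\<epsilon>\<in>sign_vectors N. (q (\<Sum>i<N. s (of_real (\<epsilon> i)) (x i)))\<^sup>2) / 2 ^ N)"
proof -
  obtain C where C: "\<And>N x. (\<forall>i<N. x i \<in> S) \<Longrightarrow> sqrt (\<Sum>i<N. (q (x i))\<^sup>2) \<le>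
      C * sqrt (\<integral>\<epsilon>. (q (\<Sum>i<N. s (of_real (\<epsilon> i)) (x i)))\<^sup>2 \<partial>uniform_count_measure (sign_vectors N))"
    using assms unfolding cotype2_def by blast
  have "(\<Sum>i<N. (q (x i))\<^sup>2) \<le> (\<bar>C\<bar> + 1)\<^sup>2 * ((\<Sum>\<epsilon>\<in>sign_vectors N. (q (\<Sum>i<N. s (of_real (\<epsilon> i)) (x i)))\<^sup>2) / 2 ^ N)"
    (is "?L \<le> _ * ?R") if x: "\<And>i. i < N \<Longrightarrow> x i \<in> S" for N x
  proof -
    have R: "0 \<le> ?R" and L: "0 \<le> ?L" by (simp_all add: sum_nonneg)
    have "sqrt ?L \<le> C * sqrt ?R"
      using C[of N x] x by (simp add: integral_uniform_count_measure)
    also have "\<dots> \<le> (\<bar>C\<bar> + 1) * sqrt ?R" using R by (intro mult_right_mono) auto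
    finally have "(sqrt ?L)\<^sup>2 \<le> ((\<bar>C\<bar> + 1) * sqrt ?R)\<^sup>2" using L by (intro power_mono) auto
    then show ?thesis using R L by (simp add: power_mult_distrib)
  qed
  then show thesis by (intro that[of "\<bar>C\<bar> + 1"]) auto
qed

lemma dual_cotype2_real:
  fixes s :: "'k::rc_field \<Rightarrow> 'a::ab_group_add \<Rightarrow> 'a"
  assumes s: "vector_space s" and p: "quasi_norm s p" and P: "qnorm (\<lambda>r. s (of_real r)) p K"
    and C: "cotype2 (fscale (*)) (dual s p) (dual_norm p :: ('a \<Rightarrow> 'k) \<Rightarrow> real)"
  obtains C where "0 < C" "qnorm.has_dual_cotype2 (\<lambda>r. s (of_real r)) p C"
proof -
  interpret vector_space s by (rule s)
  interpret P: qnorm "\<lambda>r. s (of_real r)" p K by (rule P)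
  obtain C where C0: "0 < C" and C: "\<And>N (x :: nat \<Rightarrow> 'a \<Rightarrow> 'k). (\<And>i. i < N \<Longrightarrow> x i \<in> dual s p) \<Longrightarrow>
    (\<Sum>i<N. (dual_norm p (x i))\<^sup>2) \<le>
    C\<^sup>2 * ((\<Sum>\<epsilon>\<in>sign_vectors N. (dual_norm p (\<Sum>i<N. fscale (*) (of_real (\<epsilon> i)) (x i)))\<^sup>2) / 2 ^ N)"
    using cotype2_constant[OF C] by blast
  have "P.has_dual_cotype2 C"
    unfolding P.has_dual_cotype2_def
  proof (intro allI impI)
    fix N and \<psi> :: "nat \<Rightarrow> 'a \<Rightarrow> real"
    assume \<psi>: "\<forall>i<N. P.real_functional (\<psi> i)"
    have lift: "\<exists>f :: 'a \<Rightarrow> 'k. f \<in> dual s p \<and> (\<forall>x. real_part (f x) = \<phi> x)" if \<phi>: "P.real_functional \<phi>" for \<phi>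
    proof -
      obtain f :: "'a \<Rightarrow> 'k" where f: "\<And>x y. f (x + y) = f x + f y" "\<And>c x. f (s c x) = c * f x" "\<And>x. real_part (f x) = \<phi> x"
        using real_part_functional[OF s, of \<phi>] \<phi> unfolding P.real_functional_def by blast
      have "norm (f x) \<le> P.functional_norm \<phi> * p x" for x
      proof (cases "f x = 0")
        case True
        then show ?thesis using P.functional_norm_nonneg[OF \<phi>] by simp
      next
        case False
        define c where "c = sconj (f x) / of_real (norm (f x))"
        have "norm c = 1" using False by (simp add: c_def norm_divide)
        have "sconj (f x) * f x = of_real ((norm (f x))\<^sup>2)" using mult_sconj'[of "f x"] by (simp add: mult.commute)
        then have "c * f x = of_real (norm (f x))" using False by (simp add: c_def power2_eq_square)
        then have "norm (f x) = \<phi> (s c x)" using f(3)[of "s c x"] by (simp add: f(2))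
        also have "\<dots> \<le> P.functional_norm \<phi> * p (s c x)" by (rule P.functional_norm_le[OF \<phi>])
        also have "p (s c x) = p x" using p \<open>norm c = 1\<close> by (simp add: quasi_norm_def)
        finally show ?thesis .
      qed
      then have "f \<in> dual s p" using f(1,2) by (auto simp: dual_def bounded_ops_def bounded_op_def)
      then show ?thesis using f(3) by blast
    qed
    have "\<exists>f :: nat \<Rightarrow> 'a \<Rightarrow> 'k. \<forall>i<N. f i \<in> dual s p \<and> (\<forall>x. real_part (f i x) = \<psi> i x)"
      using lift \<psi> by (intro choice_iff'[THEN iffD1]) blast
    then obtain f :: "nat \<Rightarrow> 'a \<Rightarrow> 'k" where f: "\<And>i. i < N \<Longrightarrow> f i \<in> dual s p" "\<And>i x. i < N \<Longrightarrow> real_part (f i x) = \<psi> i x"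
      by blast
    have app: "(\<Sum>i\<in>I. fscale (*) (of_real (\<epsilon> i)) (f i)) x = (\<Sum>i\<in>I. of_real (\<epsilon> i) * f i x)" for I x and \<epsilon> :: "nat \<Rightarrow> real"
      by (induction I rule: infinite_finite_induct) (simp_all add: fscale_def)
    have real_sum: "real_part (\<Sum>i\<in>I. g i) = (\<Sum>i\<in>I. real_part (g i))" for I and g :: "nat \<Rightarrow> 'k"
      by (induction I rule: infinite_finite_induct) (simp_all add: real_part_add real_part_of_real[of 0, simplified])
    have f_dual: "(\<Sum>i<N. fscale (*) (of_real (\<epsilon> i)) (f i)) \<in> dual s p" for \<epsilon> :: "nat \<Rightarrow> real"
    proof -
      obtain M where M: "\<And>i x. i < N \<Longrightarrow> norm (f i x) \<le> M i * p x"
      proof -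
        have "\<exists>M. \<forall>i<N. \<forall>x. norm (f i x) \<le> M i * p x"
          using f(1) by (intro choice_iff'[THEN iffD1]) (auto simp: dual_def bounded_ops_def bounded_op_def)
        then show thesis using that by blast
      qed
      have "norm (\<Sum>i<N. of_real (\<epsilon> i) * f i x) \<le> (\<Sum>i<N. \<bar>\<epsilon> i\<bar> * M i) * p x" for x
      proof -
        have "norm (\<Sum>i<N. of_real (\<epsilon> i) * f i x) \<le> (\<Sum>i<N. \<bar>\<epsilon> i\<bar> * (M i * p x))"
          by (rule sum_norm_le) (auto simp: norm_mult intro!: mult_left_mono M)
        then show ?thesis by (simp add: sum_distrib_right mult.assoc)
      qed
      moreover have "f i (x + y) = f i x + f i y" "f i (s c x) = c * f i x" if "i < N" for i x y c
        using f(1)[OF that] by (auto simp: dual_def bounded_ops_def bounded_op_def)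
      ultimately show ?thesis
        unfolding dual_def bounded_ops_def bounded_op_def app mem_Collect_eq
        by (auto simp: sum.distrib[symmetric] sum_distrib_left distrib_left mult.left_commute intro!: sum.cong)
    qed
    have norm_sum: "dual_norm p (\<Sum>i<N. fscale (*) (of_real (\<epsilon> i)) (f i)) = P.functional_norm (\<lambda>x. \<Sum>i<N. \<epsilon> i * \<psi> i x)" for \<epsilon> :: "nat \<Rightarrow> real"
    proof -
      have "(\<lambda>x. real_part ((\<Sum>i<N. fscale (*) (of_real (\<epsilon> i)) (f i)) x)) = (\<lambda>x. \<Sum>i<N. \<epsilon> i * \<psi> i x)"
        by (rule ext) (simp add: app real_sum real_part_mult_of_real f(2))
      then show ?thesis using dual_norm_eq(1)[OF s p P f_dual[of \<epsilon>]] by simp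
    qed
    have norm_i: "dual_norm p (f i) = P.functional_norm (\<psi> i)" if "i < N" for i
    proof -
      have "(\<lambda>x. real_part (f i x)) = \<psi> i" by (rule ext) (rule f(2)[OF that])
      then show ?thesis using dual_norm_eq(1)[OF s p P f(1)[OF that]] by simp
    qed
    show "(\<Sum>i<N. (P.functional_norm (\<psi> i))\<^sup>2) \<le>
        C\<^sup>2 * ((\<Sum>\<epsilon>\<in>sign_vectors N. (P.functional_norm (\<lambda>x. \<Sum>i<N. \<epsilon> i * \<psi> i x))\<^sup>2) / 2 ^ N)"
      using C[of N f] f(1) by (simp add: norm_i norm_sum)
  qed
  then show thesis by (rule that[OF C0])
qed

section \<open>Type 2 operators\<close>

lemma (in quadratic_form) rademacher_parallelogram:
  "(\<Sum>\<epsilon>\<in>sign_vectors N. \<phi> (\<Sum>i<N. s (\<epsilon> i) (x i))) = 2 ^ N * (\<Sum>i<N. \<phi> (x i))"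
proof (induction N)
  case 0
  then show ?case by (simp add: sign_vectors_def)
next
  case (Suc N)
  have eq: "(\<Sum>i<N. s ((\<epsilon>(N := c)) i) (x i)) = (\<Sum>i<N. s (\<epsilon> i) (x i))" for \<epsilon> :: "nat \<Rightarrow> real" and c
    by (rule sum.cong) auto
  have "(\<Sum>\<epsilon>\<in>sign_vectors (Suc N). \<phi> (\<Sum>i<Suc N. s (\<epsilon> i) (x i))) =
      (\<Sum>\<epsilon>\<in>sign_vectors N. \<phi> ((\<Sum>i<N. s (\<epsilon> i) (x i)) + x N) + \<phi> ((\<Sum>i<N. s (\<epsilon> i) (x i)) - x N))"
    unfolding sum_sign_vectors_Suc sum.lessThan_Suc eq by simp
  also have "\<dots> = (\<Sum>\<epsilon>\<in>sign_vectors N. 2 * \<phi> (\<Sum>i<N. s (\<epsilon> i) (x i)) + 2 * \<phi> (x N))"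
    by (simp only: parallelogram)
  also have "\<dots> = 2 ^ Suc N * (\<Sum>i<Suc N. \<phi> (x i))"
    by (simp add: sum.distrib sum_distrib_left[symmetric] Suc algebra_simps)
  finally show ?case .
qed

context qnorm
begin

lemma q_sum_sq: "finite A \<Longrightarrow> (q (\<Sum>i\<in>A. f i))\<^sup>2 \<le> (2 * K\<^sup>2) ^ card A * (\<Sum>i\<in>A. (q (f i))\<^sup>2)"
proof (induction A rule: finite_induct)
  case (insert a A)
  have "1 \<le> K\<^sup>2" by (rule one_le_power[OF K_ge_1])
  then have one: "1 \<le> (2 * K\<^sup>2) ^ card A" by (intro one_le_power) simp
  have "(q (f a + (\<Sum>i\<in>A. f i)))\<^sup>2 \<le> 2 * K\<^sup>2 * ((q (f a))\<^sup>2 + (q (\<Sum>i\<in>A. f i))\<^sup>2)" by (rule q_add_sq)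
  also have "\<dots> \<le> 2 * K\<^sup>2 * ((2 * K\<^sup>2) ^ card A * (q (f a))\<^sup>2 + (2 * K\<^sup>2) ^ card A * (\<Sum>i\<in>A. (q (f i))\<^sup>2))"
    using insert.IH mult_right_mono[OF one, of "(q (f a))\<^sup>2"] by (intro mult_left_mono add_mono) auto
  also have "\<dots> = (2 * K\<^sup>2) ^ card (insert a A) * (\<Sum>i\<in>insert a A. (q (f i))\<^sup>2)"
    using insert.hyps by (simp add: algebra_simps)
  finally show ?case using insert.hyps by simp
qed simp

lemma rad_sq_add: "rad_sq N (\<lambda>i. x i + y i) \<le> 2 * K\<^sup>2 * (rad_sq N x + rad_sq N y)"
proof -
  have "(\<Sum>\<epsilon>\<in>sign_vectors N. (q (\<Sum>i<N. s (\<epsilon> i) (x i + y i)))\<^sup>2) \<le>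
      (\<Sum>\<epsilon>\<in>sign_vectors N. 2 * K\<^sup>2 * ((q (\<Sum>i<N. s (\<epsilon> i) (x i)))\<^sup>2 + (q (\<Sum>i<N. s (\<epsilon> i) (y i)))\<^sup>2))"
    by (rule sum_mono) (simp only: scale_right_distrib sum.distrib q_add_sq)
  then have "(\<Sum>\<epsilon>\<in>sign_vectors N. (q (\<Sum>i<N. s (\<epsilon> i) (x i + y i)))\<^sup>2) / 2 ^ N \<le>
      (\<Sum>\<epsilon>\<in>sign_vectors N. 2 * K\<^sup>2 * ((q (\<Sum>i<N. s (\<epsilon> i) (x i)))\<^sup>2 + (q (\<Sum>i<N. s (\<epsilon> i) (y i)))\<^sup>2)) / 2 ^ N"
    by (rule divide_right_mono) simp
  then show ?thesis
    unfolding rad_sq_def sum_distrib_left[symmetric] sum.distrib add_divide_distrib[symmetric] times_divide_eq_right .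
qed

lemma rad_sq_le_sum: "rad_sq N x \<le> (2 * K\<^sup>2) ^ N * (\<Sum>i<N. (q (x i))\<^sup>2)"
proof -
  have "(q (\<Sum>i<N. s (\<epsilon> i) (x i)))\<^sup>2 \<le> (2 * K\<^sup>2) ^ N * (\<Sum>i<N. (q (x i))\<^sup>2)" if "\<epsilon> \<in> sign_vectors N" for \<epsilon>
  proof -
    have "(q (\<Sum>i<N. s (\<epsilon> i) (x i)))\<^sup>2 \<le> (2 * K\<^sup>2) ^ N * (\<Sum>i<N. (q (s (\<epsilon> i) (x i)))\<^sup>2)"
      using q_sum_sq[of "{..<N}" "\<lambda>i. s (\<epsilon> i) (x i)"] by simp
    also have "(\<Sum>i<N. (q (s (\<epsilon> i) (x i)))\<^sup>2) = (\<Sum>i<N. (q (x i))\<^sup>2)"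
      using sign_vectors_cases[OF that] by (intro sum.cong) fastforce+
    finally show ?thesis .
  qed
  then have "(\<Sum>\<epsilon>\<in>sign_vectors N. (q (\<Sum>i<N. s (\<epsilon> i) (x i)))\<^sup>2) \<le>
      (\<Sum>\<epsilon>\<in>sign_vectors N. (2 * K\<^sup>2) ^ N * (\<Sum>i<N. (q (x i))\<^sup>2))"
    by (rule sum_mono)
  then show ?thesis by (simp add: rad_sq_def field_simps)
qed

end

locale cotype_pair = X: qnorm sx p Kx + Y: qnorm sy q Ky
  for sx :: "real \<Rightarrow> 'a::ab_group_add \<Rightarrow> 'a" and p Kx
    and sy :: "real \<Rightarrow> 'b::ab_group_add \<Rightarrow> 'b" and q Ky +
  fixes C C' :: real
  assumes dual_cotype: "X.has_dual_cotype2 C" "0 < C"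
    and cotype: "Y.has_cotype2 C'"
    and cont: "Y.continuous_combinations"
begin

definition type2_bound :: "('a \<Rightarrow> 'b) \<Rightarrow> real \<Rightarrow> bool" where
  "type2_bound u T \<longleftrightarrow> (\<forall>N x. Y.rad_sq N (\<lambda>i. u (x i)) \<le> T * (\<Sum>i<N. (p (x i))\<^sup>2))"

text \<open>For a quadratic form the average over signs equals \<open>\<Sum>\<phi> x\<^sub>i\<close>, so factoring through a Hilbert
  space gives type 2.\<close>

lemma form_type2_bound:
  assumes u: "real_operator sx p Kx sy q Ky u" and \<phi>: "quadratic_form sx p Kx \<phi> \<gamma>"
    and le: "\<And>x. (q (u x))\<^sup>2 \<le> \<phi> x"
  shows "type2_bound u (\<gamma>\<^sup>2)"
  unfolding type2_bound_def
proof (intro allI)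
  interpret u: real_operator sx p Kx sy q Ky u by (rule u)
  interpret Q: quadratic_form sx p Kx \<phi> \<gamma> by (rule \<phi>)
  fix N and x :: "nat \<Rightarrow> 'a"
  have "(\<Sum>\<epsilon>\<in>sign_vectors N. (q (\<Sum>i<N. sy (\<epsilon> i) (u (x i))))\<^sup>2) \<le> (\<Sum>\<epsilon>\<in>sign_vectors N. \<phi> (\<Sum>i<N. sx (\<epsilon> i) (x i)))"
  proof (rule sum_mono)
    fix \<epsilon>
    have "(\<Sum>i<N. sy (\<epsilon> i) (u (x i))) = u (\<Sum>i<N. sx (\<epsilon> i) (x i))" by (simp add: u.u_sum u.u_scale)
    then show "(q (\<Sum>i<N. sy (\<epsilon> i) (u (x i))))\<^sup>2 \<le> \<phi> (\<Sum>i<N. sx (\<epsilon> i) (x i))" using le by simp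
  qed
  then have "Y.rad_sq N (\<lambda>i. u (x i)) \<le> (\<Sum>i<N. \<phi> (x i))"
    unfolding Q.rademacher_parallelogram Y.rad_sq_def by (simp add: field_simps)
  also have "\<dots> \<le> (\<Sum>i<N. \<gamma>\<^sup>2 * (p (x i))\<^sup>2)"
    using Q.form_le by (intro sum_mono) (simp add: power_mult_distrib)
  finally show "Y.rad_sq N (\<lambda>i. u (x i)) \<le> \<gamma>\<^sup>2 * (\<Sum>i<N. (p (x i))\<^sup>2)" by (simp add: sum_distrib_left)
qed

lemma type2_bound_form:
  assumes u: "real_operator sx p Kx sy q Ky u" and T: "type2_bound u T" "0 \<le> T"
  obtains \<phi> where "quadratic_form sx p Kx \<phi> (\<bar>C'\<bar> * sqrt T)" "\<And>x. (q (u x))\<^sup>2 \<le> \<phi> x"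
proof -
  interpret u: real_operator sx p Kx sy q Ky u by (rule u)
  have "u.has_type2 (sqrt T)"
    using T by (simp add: u.has_type2_def type2_bound_def)
  then obtain \<phi> where par: "parallelogram_law \<phi>" and low: "\<And>x. (q (u x))\<^sup>2 \<le> \<phi> x"
      and up: "\<And>x. \<phi> x \<le> (C' * sqrt T * p x)\<^sup>2"
    using u.type2_cotype2_quadratic_form[OF cont cotype] by blast
  have "quadratic_form sx p Kx \<phi> (\<bar>C'\<bar> * sqrt T)"
  proof
    show "parallelogram_law \<phi>" by (rule par)
    show "0 \<le> \<phi> x" for x using low[of x] zero_le_power2[of "q (u x)"] by linarith
    show "\<phi> x \<le> (\<bar>C'\<bar> * sqrt T * p x)\<^sup>2" for x using up[of x] by (simp add: power_mult_distrib)
    show "0 \<le> \<bar>C'\<bar> * sqrt T" using T by simp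
  qed
  then show thesis using low by (rule that)
qed

text \<open>One round trip through the quadratic form. The number \<open>m\<close> of samples and the smoothing
  parameter \<open>\<delta>\<close> are chosen, in terms of the two spaces only, such that the old bound \<open>T\<close> enters
  with a factor \<open>1/4\<close>.\<close>

lemma type2_bound_improvement:
  obtains a where "0 \<le> a"
    "\<And>u U T. \<lbrakk>real_operator sx p Kx sy q Ky u; \<And>x. q (u x) \<le> U * p x; 0 \<le> U; 0 \<le> T; type2_bound u T\<rbrakk> \<Longrightarrow>
      type2_bound u (a * U\<^sup>2 + T / 4)"
proof -
  \<comment> \<open>\<open>\<delta>\<close> makes the remainder of the smoothing, and then \<open>m\<close> the sampling error, contribute at
    most \<open>T / 8\<close> each.\<close>
  define G where "G = 18 * Ky\<^sup>2 * C\<^sup>2 * C'\<^sup>2"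
  define \<delta> where "\<delta> = 1 / (1 + 8 * G)"
  have G: "0 \<le> G" by (simp add: G_def)
  then have \<delta>: "0 < \<delta>" "\<delta> \<le> 1" by (simp_all add: \<delta>_def)
  have "\<delta> ^ 4 \<le> \<delta> ^ 1" using \<delta> by (intro power_decreasing) auto
  then have "G * \<delta> ^ 4 \<le> G * \<delta>" using G by (intro mult_left_mono) auto
  also have "\<dots> \<le> 1 / 8" using G by (simp add: \<delta>_def field_simps)
  finally have G\<delta>: "G * \<delta> ^ 4 \<le> 1 / 8" .
  obtain m :: nat where m0: "16 * G * Ky\<^sup>2 / \<delta>\<^sup>2 + 1 \<le> real m" using real_arch_simple by blast
  have "0 \<le> 16 * G * Ky\<^sup>2 / \<delta>\<^sup>2" using G by simp
  then have m: "0 < m" "16 * G * Ky\<^sup>2 / \<delta>\<^sup>2 \<le> real m" using m0 by (auto intro: Nat.gr0I)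
  then have Gm: "2 * G * Ky\<^sup>2 / (\<delta>\<^sup>2 * real m) \<le> 1 / 8"
    using \<delta> by (simp add: field_simps)
  define a where "a = 18 * Ky\<^sup>2 * C\<^sup>2 * (2 * Ky\<^sup>2 * ((2 * Kx) ^ m)\<^sup>2) / \<delta>\<^sup>2"
  have "type2_bound u (a * U\<^sup>2 + T / 4)"
    if u: "real_operator sx p Kx sy q Ky u" and U: "\<And>x. q (u x) \<le> U * p x" "0 \<le> U" and T: "0 \<le> T" "type2_bound u T"
    for u U T
  proof -
    define \<gamma> where "\<gamma> = \<bar>C'\<bar> * sqrt T"
    obtain \<phi> where \<phi>: "quadratic_form sx p Kx \<phi> \<gamma>" "\<And>x. (q (u x))\<^sup>2 \<le> \<phi> x"
      unfolding \<gamma>_def using type2_bound_form[OF u T(2,1)] by blast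
    interpret u: hilbertian_operator sx p Kx sy q Ky u \<phi> \<gamma> U
      by (intro hilbertian_operator.intro hilbertian_operator_axioms.intro u \<phi> U)
    define \<beta> where "\<beta> = Ky * ((2 * Kx) ^ m * U + \<gamma> / sqrt (real m))"
    have \<gamma>2: "\<gamma>\<^sup>2 = C'\<^sup>2 * T" using T by (simp add: \<gamma>_def power_mult_distrib)
    have \<beta>0: "0 \<le> \<beta>"
      unfolding \<beta>_def using X.K_ge_1 Y.K_ge_1 U u.\<gamma>_nonneg by (intro mult_nonneg_nonneg add_nonneg_nonneg) auto
    have "\<beta>\<^sup>2 \<le> 2 * Ky\<^sup>2 * (((2 * Kx) ^ m)\<^sup>2 * U\<^sup>2 + \<gamma>\<^sup>2 / real m)"
    proof -
      have "((2 * Kx) ^ m * U + \<gamma> / sqrt (real m))\<^sup>2 \<le> 2 * (((2 * Kx) ^ m * U)\<^sup>2 + (\<gamma> / sqrt (real m))\<^sup>2)"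
        using sum_squares_bound[of "(2 * Kx) ^ m * U" "\<gamma> / sqrt (real m)"] by (simp add: power2_sum)
      then have "Ky\<^sup>2 * ((2 * Kx) ^ m * U + \<gamma> / sqrt (real m))\<^sup>2 \<le> Ky\<^sup>2 * (2 * (((2 * Kx) ^ m * U)\<^sup>2 + (\<gamma> / sqrt (real m))\<^sup>2))"
        by (rule mult_left_mono) simp
      moreover have "((2 * Kx) ^ m * U)\<^sup>2 = ((2 * Kx) ^ m)\<^sup>2 * U\<^sup>2" "(\<gamma> / sqrt (real m))\<^sup>2 = \<gamma>\<^sup>2 / real m"
        by (simp_all only: power_mult_distrib power_divide real_sqrt_pow2 of_nat_0_le_iff)
      ultimately show ?thesis unfolding \<beta>_def power_mult_distrib[of Ky] by (simp only: mult_ac)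
    qed
    then have "\<beta>\<^sup>2 / \<delta>\<^sup>2 \<le> 2 * Ky\<^sup>2 * (((2 * Kx) ^ m)\<^sup>2 * U\<^sup>2 + \<gamma>\<^sup>2 / real m) / \<delta>\<^sup>2"
      by (rule divide_right_mono) simp
    then have "18 * Ky\<^sup>2 * C\<^sup>2 * (\<beta>\<^sup>2 / \<delta>\<^sup>2 + \<delta> ^ 4 * \<gamma>\<^sup>2) \<le>
        18 * Ky\<^sup>2 * C\<^sup>2 * (2 * Ky\<^sup>2 * (((2 * Kx) ^ m)\<^sup>2 * U\<^sup>2 + \<gamma>\<^sup>2 / real m) / \<delta>\<^sup>2 + \<delta> ^ 4 * \<gamma>\<^sup>2)"
      by (intro mult_left_mono add_right_mono) auto
    also have "\<dots> = a * U\<^sup>2 + (2 * G * Ky\<^sup>2 / (\<delta>\<^sup>2 * real m)) * T + (G * \<delta> ^ 4) * T"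
      unfolding \<gamma>2 a_def G_def using \<delta> m by (simp add: field_simps)
    also have "\<dots> \<le> a * U\<^sup>2 + 1 / 8 * T + 1 / 8 * T"
      using T by (intro add_mono mult_right_mono Gm G\<delta>) auto
    finally have const: "18 * Ky\<^sup>2 * C\<^sup>2 * (\<beta>\<^sup>2 / \<delta>\<^sup>2 + \<delta> ^ 4 * \<gamma>\<^sup>2) \<le> a * U\<^sup>2 + T / 4" by simp
    show ?thesis
      unfolding type2_bound_def
    proof (intro allI)
      fix N and x :: "nat \<Rightarrow> 'a"
      have "Y.rad_sq N (\<lambda>i. u (x i)) \<le> 18 * Ky\<^sup>2 * C\<^sup>2 * (\<beta>\<^sup>2 / \<delta>\<^sup>2 + \<delta> ^ 4 * \<gamma>\<^sup>2) * (\<Sum>i<N. (p (x i))\<^sup>2)"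
        by (rule u.type2_improvement[OF dual_cotype \<delta> _ \<beta>0]) (unfold \<beta>_def, rule u.bounded_on_envelope[OF m(1)])
      also have "\<dots> \<le> (a * U\<^sup>2 + T / 4) * (\<Sum>i<N. (p (x i))\<^sup>2)"
        using const by (rule mult_right_mono) (simp add: sum_nonneg)
      finally show "Y.rad_sq N (\<lambda>i. u (x i)) \<le> (a * U\<^sup>2 + T / 4) * (\<Sum>i<N. (p (x i))\<^sup>2)" .
    qed
  qed
  moreover have "0 \<le> a" by (simp add: a_def)
  ultimately show thesis by (rule that[rotated])
qed

text \<open>The map taking \<open>T\<close> to \<open>a U\<^sup>2 + T / 4\<close> is a contraction whose fixed point is at most \<open>2 a U\<^sup>2\<close>,
  so its iterates lose all memory of the initial bound.\<close>

theorem type2_bound_automatic: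
  obtains a where "0 \<le> a"
    "\<And>u U T. \<lbrakk>real_operator sx p Kx sy q Ky u; \<And>x. q (u x) \<le> U * p x; 0 \<le> U; 0 \<le> T; type2_bound u T\<rbrakk> \<Longrightarrow>
      type2_bound u (a * U\<^sup>2)"
proof -
  obtain a where a: "0 \<le> a" and imp:
    "\<And>u U T. \<lbrakk>real_operator sx p Kx sy q Ky u; \<And>x. q (u x) \<le> U * p x; 0 \<le> U; 0 \<le> T; type2_bound u T\<rbrakk> \<Longrightarrow>
      type2_bound u (a * U\<^sup>2 + T / 4)"
    using type2_bound_improvement by blast
  have "type2_bound u (2 * a * U\<^sup>2)"
    if u: "real_operator sx p Kx sy q Ky u" and U: "\<And>x. q (u x) \<le> U * p x" "0 \<le> U" and T: "0 \<le> T" "type2_bound u T"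
    for u U T
  proof -
    have iter: "type2_bound u (2 * a * U\<^sup>2 + T / 4 ^ n)" for n
    proof (induction n)
      case 0
      have "T * (\<Sum>i<N. (p (x i))\<^sup>2) \<le> (2 * a * U\<^sup>2 + T) * (\<Sum>i<N. (p (x i))\<^sup>2)" for N and x :: "nat \<Rightarrow> 'a"
        using a by (intro mult_right_mono) (auto simp: sum_nonneg)
      then show ?case using T(2) unfolding type2_bound_def by simp (meson order_trans)
    next
      case (Suc n)
      have "0 \<le> 2 * a * U\<^sup>2 + T / 4 ^ n" using a T by simp
      from imp[OF u U this Suc] have *: "type2_bound u (a * U\<^sup>2 + (2 * a * U\<^sup>2 + T / 4 ^ n) / 4)" .
      have "a * U\<^sup>2 + (2 * a * U\<^sup>2 + T / 4 ^ n) / 4 \<le> 2 * a * U\<^sup>2 + T / 4 ^ Suc n"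
        using a by (simp add: field_simps)
      then have "(a * U\<^sup>2 + (2 * a * U\<^sup>2 + T / 4 ^ n) / 4) * (\<Sum>i<N. (p (x i))\<^sup>2) \<le>
          (2 * a * U\<^sup>2 + T / 4 ^ Suc n) * (\<Sum>i<N. (p (x i))\<^sup>2)" for N and x :: "nat \<Rightarrow> 'a"
        by (rule mult_right_mono) (simp add: sum_nonneg)
      then show ?case using * unfolding type2_bound_def by (meson order_trans)
    qed
    show ?thesis
      unfolding type2_bound_def
    proof (intro allI)
      fix N and x :: "nat \<Rightarrow> 'a"
      have "(\<lambda>n. T / 4 ^ n) \<longlonglongrightarrow> 0"
        using LIMSEQ_divide_realpow_zero[of 4 T] by simp
      then have "(\<lambda>n. (2 * a * U\<^sup>2 + T / 4 ^ n) * (\<Sum>i<N. (p (x i))\<^sup>2)) \<longlonglongrightarrow> (2 * a * U\<^sup>2 + 0) * (\<Sum>i<N. (p (x i))\<^sup>2)"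
        by (intro tendsto_intros)
      then show "Y.rad_sq N (\<lambda>i. u (x i)) \<le> 2 * a * U\<^sup>2 * (\<Sum>i<N. (p (x i))\<^sup>2)"
        using iter unfolding type2_bound_def by (intro LIMSEQ_le_const[of _ "2 * a * U\<^sup>2 * (\<Sum>i<N. (p (x i))\<^sup>2)"]) auto
    qed
  qed
  then show thesis using a by (intro that[of "2 * a"]) auto
qed

end

section \<open>Operators of finite rank\<close>

lemma rc_field_parallelogram:
  "(norm (x + y))\<^sup>2 + (norm (x - y))\<^sup>2 = 2 * (norm x)\<^sup>2 + 2 * (norm (y :: 'k::rc_field))\<^sup>2"
proof -
  have "(of_real ((norm (x + y))\<^sup>2 + (norm (x - y))\<^sup>2) :: 'k) = 2 * (x * sconj x) + 2 * (y * sconj y)"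
    unfolding of_real_add mult_sconj'[symmetric] by (simp add: sconj_add sconj_diff algebra_simps)
  also have "\<dots> = of_real (2 * (norm x)\<^sup>2 + 2 * (norm y)\<^sup>2)" by (simp add: mult_sconj')
  finally show ?thesis by (simp only: of_real_eq_iff)
qed

text \<open>Induction on the dimension. A new basis vector has positive distance from the span of the
  others: by induction the coordinates on that span are bounded functionals, and the scalars are
  complete, so the span is closed.\<close>

lemma coordinates_bounded:
  fixes t :: "'k::rc_field \<Rightarrow> 'b::ab_group_add \<Rightarrow> 'b"
  assumes t: "vector_space t" and q: "quasi_norm t q"
    and B: "finite B" "\<not> module.dependent t B"
  shows "\<exists>M\<ge>0. \<forall>c. \<forall>b\<in>B. norm (c b) \<le> M * q (\<Sum>b\<in>B. t (c b) b)"
proof -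
  interpret vector_space t by (rule t)
  obtain K where K: "qnorm (\<lambda>r. t (of_real r)) q K" using quasi_norm_real[OF t q] .
  interpret Q: qnorm "\<lambda>r. t (of_real r)" q K by (rule K)
  have q_scale: "q (t c x) = norm c * q x" for c x using q by (simp add: quasi_norm_def)
  show ?thesis
    using B
  proof (induction B rule: finite_induct)
    case empty
    then show ?case by auto
  next
    case (insert b\<^sub>0 B)
    have indep: "independent B" and b0: "b\<^sub>0 \<notin> span B"
      using insert.prems insert.hyps by (auto simp: independent_insert)
    obtain M where M: "0 \<le> M" "\<And>c b. b \<in> B \<Longrightarrow> norm (c b) \<le> M * q (\<Sum>b\<in>B. t (c b) b)"
      using insert.IH[OF indep] by blast
    have "\<exists>d>0. \<forall>c. d \<le> q (b\<^sub>0 - (\<Sum>b\<in>B. t (c b) b))"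
    proof (rule ccontr)
      assume "\<not> ?thesis"
      then have "\<exists>c. q (b\<^sub>0 - (\<Sum>b\<in>B. t (c b) b)) < 1 / real (Suc n)" for n
        by (metis not_le of_nat_0_less_iff zero_less_Suc zero_less_divide_1_iff)
      then obtain c where c: "\<And>n. q (b\<^sub>0 - (\<Sum>b\<in>B. t (c n b) b)) < 1 / real (Suc n)" by metis
      define y where "y n = (\<Sum>b\<in>B. t (c n b) b)" for n
      have zero: "(\<lambda>n. 1 / real (Suc n)) \<longlonglongrightarrow> 0" by (rule LIMSEQ_Suc[OF lim_1_over_n])
      have "convergent (\<lambda>n. c n b)" if b: "b \<in> B" for b
      proof (rule rc_field_complete, unfold Cauchy_iff, intro allI impI)
        fix e :: real assume e: "0 < e"
        define e' where "e' = e / ((M + 1) * K) / 2"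
        have e': "0 < e'" using e M(1) Q.K_ge_1 by (simp add: e'_def)
        obtain N where N: "\<And>n. N \<le> n \<Longrightarrow> 1 / real (Suc n) < e'"
          using LIMSEQ_D[OF zero e'] by auto
        have "norm (c m b - c n b) < e" if mn: "N \<le> m" "N \<le> n" for m n
        proof -
          have "(\<Sum>b\<in>B. t (c m b - c n b) b) = (b\<^sub>0 - y n) - (b\<^sub>0 - y m)"
            by (simp add: y_def scale_left_diff_distrib sum_subtractf)
          then have "norm (c m b - c n b) \<le> M * q ((b\<^sub>0 - y n) - (b\<^sub>0 - y m))"
            using M(2)[OF b, of "\<lambda>b. c m b - c n b"] by simp
          also have "\<dots> \<le> M * (K * (q (b\<^sub>0 - y n) + q (b\<^sub>0 - y m)))"
            by (intro mult_left_mono Q.q_diff M)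
          also have "\<dots> \<le> (M + 1) * (K * (q (b\<^sub>0 - y n) + q (b\<^sub>0 - y m)))"
            using Q.K_ge_1 by (intro mult_right_mono) auto
          also have "\<dots> < (M + 1) * (K * (e' + e'))"
            using M(1) Q.K_ge_1 c[of n] c[of m] N[OF mn(1)] N[OF mn(2)]
            by (intro mult_strict_left_mono add_strict_mono) (auto simp: y_def)
          also have "\<dots> = ((M + 1) * K) * (e / ((M + 1) * K))" by (simp add: e'_def mult.assoc)
          also have "\<dots> = e" using M(1) Q.K_ge_1 by simp
          finally show ?thesis .
        qed
        then show "\<exists>N. \<forall>m\<ge>N. \<forall>n\<ge>N. norm (c m b - c n b) < e" by blast
      qed
      then have "\<exists>l. \<forall>b\<in>B. (\<lambda>n. c n b) \<longlonglongrightarrow> l b"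
        unfolding convergent_def by (intro bchoice) blast
      then obtain l where l: "\<And>b. b \<in> B \<Longrightarrow> (\<lambda>n. c n b) \<longlonglongrightarrow> l b" by blast
      define z where "z = (\<Sum>b\<in>B. t (l b) b)"
      have le: "(q (b\<^sub>0 - z))\<^sup>2 \<le> 2 * K\<^sup>2 * ((1 / real (Suc n))\<^sup>2 + (2 * K\<^sup>2) ^ card B * (\<Sum>b\<in>B. (norm (c n b - l b) * q b)\<^sup>2))" for n
      proof -
        have "b\<^sub>0 - z = (b\<^sub>0 - y n) + (\<Sum>b\<in>B. t (c n b - l b) b)"
          by (simp add: y_def z_def scale_left_diff_distrib sum_subtractf)
        then have "(q (b\<^sub>0 - z))\<^sup>2 \<le> 2 * K\<^sup>2 * ((q (b\<^sub>0 - y n))\<^sup>2 + (q (\<Sum>b\<in>B. t (c n b - l b) b))\<^sup>2)"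
          using Q.q_add_sq by metis
        also have "2 * K\<^sup>2 * ((q (b\<^sub>0 - y n))\<^sup>2 + (q (\<Sum>b\<in>B. t (c n b - l b) b))\<^sup>2) \<le>
           2 * K\<^sup>2 * ((1 / real (Suc n))\<^sup>2 + (2 * K\<^sup>2) ^ card B * (\<Sum>b\<in>B. (q (t (c n b - l b) b))\<^sup>2))"
          using c[of n] by (intro mult_left_mono add_mono power_mono Q.q_sum_sq insert.hyps) (auto simp: y_def intro: less_imp_le)
        finally show ?thesis by (simp add: q_scale)
      qed
      have "(\<lambda>n. 2 * K\<^sup>2 * ((1 / real (Suc n))\<^sup>2 + (2 * K\<^sup>2) ^ card B * (\<Sum>b\<in>B. (norm (c n b - l b) * q b)\<^sup>2))) \<longlonglongrightarrow>
          2 * K\<^sup>2 * (0\<^sup>2 + (2 * K\<^sup>2) ^ card B * (\<Sum>b\<in>B. (norm (l b - l b) * q b)\<^sup>2))"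
        by (intro tendsto_intros zero l)
      then have "(q (b\<^sub>0 - z))\<^sup>2 \<le> 2 * K\<^sup>2 * (0\<^sup>2 + (2 * K\<^sup>2) ^ card B * (\<Sum>b\<in>B. (norm (l b - l b) * q b)\<^sup>2))"
        by (rule LIMSEQ_le_const) (use le in blast)
      then have "b\<^sub>0 = z" by simp
      moreover have "z \<in> span B" unfolding z_def by (intro span_sum span_scale span_base)
      ultimately show False using b0 by simp
    qed
    then obtain d where d: "0 < d" "\<And>c. d \<le> q (b\<^sub>0 - (\<Sum>b\<in>B. t (c b) b))" by blast
    define M' where "M' = M * K * (1 + q b\<^sub>0 / d) + 1 / d"
    have M': "0 \<le> M'" using M(1) Q.K_ge_1 d(1) by (simp add: M'_def)
    have "norm (c b) \<le> M' * q (\<Sum>b\<in>insert b\<^sub>0 B. t (c b) b)" if b: "b \<in> insert b\<^sub>0 B" for c b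
    proof -
      define y where "y = (\<Sum>b\<in>insert b\<^sub>0 B. t (c b) b)"
      define y' where "y' = (\<Sum>b\<in>B. t (c b) b)"
      have y: "y = t (c b\<^sub>0) b\<^sub>0 + y'" using insert.hyps by (simp add: y_def y'_def)
      have "norm (c b\<^sub>0) * d \<le> q y"
      proof (cases "c b\<^sub>0 = 0")
        case False
        have "(\<Sum>b\<in>B. t (- c b / c b\<^sub>0) b) = t (- 1 / c b\<^sub>0) y'"
          by (simp add: y'_def scale_sum_right)
        then have "t (c b\<^sub>0) (b\<^sub>0 - (\<Sum>b\<in>B. t (- c b / c b\<^sub>0) b)) = y"
          using False by (simp add: y scale_right_diff_distrib scale_right_distrib)
        then have "q y = norm (c b\<^sub>0) * q (b\<^sub>0 - (\<Sum>b\<in>B. t (- c b / c b\<^sub>0) b))"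
          using q_scale by metis
        then show ?thesis using d(2)[of "\<lambda>b. - c b / c b\<^sub>0"] by (simp add: mult_left_mono)
      qed simp
      then have c0: "norm (c b\<^sub>0) \<le> q y / d" using d(1) by (simp add: field_simps)
      have M'_le: "a * q y \<le> M' * q y" if "a \<le> M'" for a using that by (intro mult_right_mono) auto
      show ?thesis
      proof (cases "b = b\<^sub>0")
        case True
        have "1 / d \<le> M'" using M(1) Q.K_ge_1 d(1) by (simp add: M'_def)
        from M'_le[OF this] show ?thesis using c0 True by (simp add: y_def)
      next
        case False
        have "q y' \<le> K * (q y + norm (c b\<^sub>0) * q b\<^sub>0)"
          using Q.q_diff[of y "t (c b\<^sub>0) b\<^sub>0"] by (simp add: y q_scale)
        also have "\<dots> \<le> K * (q y + q y / d * q b\<^sub>0)"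
          using c0 Q.K_ge_1 by (intro mult_left_mono add_left_mono mult_right_mono) auto
        finally have "M * q y' \<le> M * (K * (q y + q y / d * q b\<^sub>0))" using M(1) by (rule mult_left_mono)
        also have "\<dots> = (M * K * (1 + q b\<^sub>0 / d)) * q y" by (simp add: field_simps)
        also have "\<dots> \<le> M' * q y" using d(1) by (intro M'_le) (simp add: M'_def)
        finally show ?thesis using M(2)[of b c] b False by (simp add: y_def[symmetric] y'_def[symmetric])
      qed
    qed
    then show ?case using M' by blast
  qed
qed

text \<open>The coordinates of \<open>u x\<close> in a basis of the range are bounded functionals of \<open>x\<close>, and a multiple
  of the sum of the squares of their moduli is the form.\<close>

lemma finite_rank_form:
  fixes s :: "'k::rc_field \<Rightarrow> 'a::ab_group_add \<Rightarrow> 'a" and t :: "'k \<Rightarrow> 'b::ab_group_add \<Rightarrow> 'b"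
  assumes s: "vector_space s" "qnorm (\<lambda>r. s (of_real r)) p Kp"
    and t: "vector_space t" and q: "quasi_norm t q"
    and u: "u \<in> bounded_ops s p t q" and fin: "finite_rank t u"
  shows "\<exists>\<phi> \<gamma>. quadratic_form (\<lambda>r. s (of_real r)) p Kp \<phi> \<gamma> \<and> (\<forall>x. (q (u x))\<^sup>2 \<le> \<phi> x)"
proof -
  interpret S: vector_space s by (rule s)
  interpret T: vector_space t by (rule t)
  interpret P: qnorm "\<lambda>r. s (of_real r)" p Kp by (rule s)
  obtain K where "qnorm (\<lambda>r. t (of_real r)) q K" using quasi_norm_real[OF t q] .
  then interpret Q: qnorm "\<lambda>r. t (of_real r)" q K .
  have q_scale: "q (t c x) = norm c * q x" for c x using q by (simp add: quasi_norm_def)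
  have u_add: "u (x + y) = u x + u y" and u_scale: "u (s c x) = t c (u x)" for x y c
    using u by (auto simp: bounded_ops_def bounded_op_def)
  obtain U where U: "\<And>x. q (u x) \<le> U * p x" using u by (auto simp: bounded_ops_def bounded_op_def)
  obtain B\<^sub>0 where B0: "finite B\<^sub>0" "range u \<subseteq> T.span B\<^sub>0" using fin by (auto simp: finite_rank_def)
  obtain B where B: "B \<subseteq> B\<^sub>0" "T.independent B" "B\<^sub>0 \<subseteq> T.span B"
    using T.maximal_independent_subset[of B\<^sub>0] by blast
  have finB: "finite B" using B B0 finite_subset by blast
  have "range u \<subseteq> T.span B" using B0(2) B(3) T.span_minimal[OF B(3) T.subspace_span] by blast
  then have "\<exists>c. u x = (\<Sum>b\<in>B. t (c b) b)" for x
    unfolding T.span_finite[OF finB] by blast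
  then obtain f where f: "\<And>x. u x = (\<Sum>b\<in>B. t (f x b) b)" by metis
  obtain M where M: "0 \<le> M" "\<And>c b. b \<in> B \<Longrightarrow> norm (c b) \<le> M * q (\<Sum>b\<in>B. t (c b) b)"
    using coordinates_bounded[OF t q finB B(2)] by blast
  have unique: "c b = c' b" if "(\<Sum>b\<in>B. t (c b) b) = (\<Sum>b\<in>B. t (c' b) b)" "b \<in> B" for c c' b
  proof -
    have "(\<Sum>b\<in>B. t (c b - c' b) b) = 0"
      using that(1) by (simp add: T.scale_left_diff_distrib sum_subtractf)
    then show ?thesis using M(2)[OF that(2), of "\<lambda>b. c b - c' b"] by simp
  qed
  have f_add: "f (x + y) b = f x b + f y b" if "b \<in> B" for x y b
    by (rule unique[OF _ that]) (simp add: f[symmetric] u_add T.scale_left_distrib sum.distrib)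
  have f_diff: "f (x - y) b = f x b - f y b" if "b \<in> B" for x y b
    using f_add[OF that, of "x - y" y] by simp
  define c where "c = (2 * K\<^sup>2) ^ card B * (\<Sum>b\<in>B. (q b)\<^sup>2)"
  have c: "0 \<le> c" by (simp add: c_def sum_nonneg)
  define \<phi> where "\<phi> x = c * (\<Sum>b\<in>B. (norm (f x b))\<^sup>2)" for x
  have low: "(q (u x))\<^sup>2 \<le> \<phi> x" for x
  proof -
    have "(q (u x))\<^sup>2 \<le> (2 * K\<^sup>2) ^ card B * (\<Sum>b\<in>B. (q (t (f x b) b))\<^sup>2)"
      unfolding f by (rule Q.q_sum_sq[OF finB])
    also have "(\<Sum>b\<in>B. (q (t (f x b) b))\<^sup>2) \<le> (\<Sum>b\<in>B. (\<Sum>b\<in>B. (norm (f x b))\<^sup>2) * (q b)\<^sup>2)"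
      unfolding q_scale power_mult_distrib
      by (intro sum_mono mult_right_mono member_le_sum finB) auto
    finally have "(q (u x))\<^sup>2 \<le> (2 * K\<^sup>2) ^ card B * (\<Sum>b\<in>B. (\<Sum>b\<in>B. (norm (f x b))\<^sup>2) * (q b)\<^sup>2)"
      by (simp add: mult_left_mono)
    then show ?thesis by (simp add: \<phi>_def c_def sum_distrib_right[symmetric] mult_ac)
  qed
  define \<gamma> where "\<gamma> = sqrt (c * real (card B)) * M * \<bar>U\<bar>"
  have "quadratic_form (\<lambda>r. s (of_real r)) p Kp \<phi> \<gamma>"
  proof
    show "parallelogram_law \<phi>"
      unfolding parallelogram_law_def
    proof (intro allI)
      fix x y
      have "(\<Sum>b\<in>B. (norm (f (x + y) b))\<^sup>2) + (\<Sum>b\<in>B. (norm (f (x - y) b))\<^sup>2) =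
          2 * (\<Sum>b\<in>B. (norm (f x b))\<^sup>2) + 2 * (\<Sum>b\<in>B. (norm (f y b))\<^sup>2)"
        unfolding sum.distrib[symmetric] sum_distrib_left
        by (intro sum.cong refl) (simp only: f_add f_diff rc_field_parallelogram)
      then show "\<phi> (x + y) + \<phi> (x - y) = 2 * \<phi> x + 2 * \<phi> y"
        unfolding \<phi>_def by (simp only: distrib_left[symmetric])
    qed
    show "0 \<le> \<phi> x" for x using c by (simp add: \<phi>_def sum_nonneg)
    show "\<phi> x \<le> (\<gamma> * p x)\<^sup>2" for x
    proof -
      have "norm (f x b) \<le> M * (\<bar>U\<bar> * p x)" if b: "b \<in> B" for b
      proof -
        have "U * p x \<le> \<bar>U\<bar> * p x" by (intro mult_right_mono) auto
        then have U': "q (u x) \<le> \<bar>U\<bar> * p x" by (rule order_trans[OF U])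
        have "norm (f x b) \<le> M * q (u x)" using M(2)[OF b, of "f x"] by (simp add: f)
        also have "\<dots> \<le> M * (\<bar>U\<bar> * p x)" using U' M(1) by (rule mult_left_mono)
        finally show ?thesis .
      qed
      then have "(\<Sum>b\<in>B. (norm (f x b))\<^sup>2) \<le> (\<Sum>b\<in>B. (M * (\<bar>U\<bar> * p x))\<^sup>2)"
        by (intro sum_mono power_mono) auto
      then have "\<phi> x \<le> c * (\<Sum>b\<in>B. (M * (\<bar>U\<bar> * p x))\<^sup>2)" unfolding \<phi>_def using c by (rule mult_left_mono)
      also have "\<dots> = (\<gamma> * p x)\<^sup>2" using c by (simp add: \<gamma>_def power_mult_distrib)
      finally show ?thesis .
    qed
    show "0 \<le> \<gamma>" using c M(1) by (simp add: \<gamma>_def)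
  qed
  then show ?thesis using low by blast
qed

section \<open>Factorization of strongly approximable operators\<close>

lemma (in qnorm) has_cotype2_equivalent:
  assumes C: "has_cotype2 C" and q': "qnorm s q' K'"
    and le: "\<And>x. q' x \<le> q x" "\<And>x. q x \<le> c * q' x"
  shows "qnorm.has_cotype2 s q' (C * c)"
proof -
  interpret Q: qnorm s q' K' by (rule q')
  show ?thesis
    unfolding Q.has_cotype2_def
  proof (intro allI)
    fix N and x :: "nat \<Rightarrow> 'a"
    have "(\<Sum>i<N. (q' (x i))\<^sup>2) \<le> (\<Sum>i<N. (q (x i))\<^sup>2)" by (intro sum_mono power_mono le) simp
    also have "\<dots> \<le> C\<^sup>2 * rad_sq N x" using C by (simp add: has_cotype2_def)
    also have "\<dots> \<le> C\<^sup>2 * (c\<^sup>2 * Q.rad_sq N x)"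
    proof (rule mult_left_mono)
      have "(\<Sum>\<epsilon>\<in>sign_vectors N. (q (\<Sum>i<N. s (\<epsilon> i) (x i)))\<^sup>2) \<le> (\<Sum>\<epsilon>\<in>sign_vectors N. c\<^sup>2 * (q' (\<Sum>i<N. s (\<epsilon> i) (x i)))\<^sup>2)"
        unfolding power_mult_distrib[symmetric] by (intro sum_mono power_mono le) simp
      then show "rad_sq N x \<le> c\<^sup>2 * Q.rad_sq N x"
        unfolding rad_sq_def Q.rad_sq_def sum_distrib_left[symmetric] times_divide_eq_right
        by (rule divide_right_mono) simp
    qed simp
    finally show "(\<Sum>i<N. (q' (x i))\<^sup>2) \<le> (C * c)\<^sup>2 * Q.rad_sq N x" by (simp add: power_mult_distrib mult.assoc)
  qed
qed

lemma bounded_op_opnorm: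
  assumes u: "u \<in> bounded_ops s p t q" and s: "vector_space s" and p: "quasi_norm s p" and q: "quasi_norm t q"
  shows "0 \<le> opnorm UNIV p q u" and "q (u x) \<le> opnorm UNIV p q u * p x"
proof -
  interpret vector_space s by (rule s)
  have p_scale: "p (s c x) = norm c * p x" and p_nonneg: "0 \<le> p x" and p_zero: "p x = 0 \<longleftrightarrow> x = 0" for c x
    using p by (auto simp: quasi_norm_def)
  have q_scale: "q (t c y) = norm c * q y" and q_nonneg: "0 \<le> q y" for c y
    using q by (auto simp: quasi_norm_def)
  have u_scale: "u (s c x) = t c (u x)" for c x using u by (auto simp: bounded_ops_def bounded_op_def)
  obtain U where U: "\<And>x. q (u x) \<le> U * p x" using u by (auto simp: bounded_ops_def bounded_op_def)
  have bdd: "bdd_above ((\<lambda>x. q (u x)) ` {x \<in> UNIV. p x \<le> 1})"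
    by (rule opnorm_bdd_above[of _ q u U]) (use U p_nonneg in auto)
  have le: "q (u x) \<le> opnorm UNIV p q u" if "p x \<le> 1" for x
    unfolding opnorm_def using that by (intro cSUP_upper bdd) simp
  show "0 \<le> opnorm UNIV p q u" using le[of 0] q_nonneg[of "u 0"] p_zero[of 0] by simp
  show "q (u x) \<le> opnorm UNIV p q u * p x"
  proof (cases "x = 0")
    case True
    then show ?thesis using U[of 0] p_zero[of 0] q_nonneg[of "u 0"] by simp
  next
    case False
    then have px: "0 < p x" using p_zero[of x] p_nonneg[of x] by linarith
    have "q (u (s (of_real (1 / p x)) x)) \<le> opnorm UNIV p q u"
      using px by (intro le) (simp add: p_scale norm_divide)
    then have "q (u x) / p x \<le> opnorm UNIV p q u"
      using px by (simp add: u_scale q_scale norm_divide)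
    then show ?thesis using px by (simp add: field_simps)
  qed
qed

lemma real_operator_of_bounded:
  assumes u: "u \<in> bounded_ops s p t q"
    and X: "qnorm (\<lambda>r. s (of_real r)) p Kx" and Y: "qnorm (\<lambda>r. t (of_real r)) q' Ky"
  shows "real_operator (\<lambda>r. s (of_real r)) p Kx (\<lambda>r. t (of_real r)) q' Ky u"
  using u by (intro real_operator.intro real_operator_axioms.intro X Y)
    (auto simp: bounded_ops_def bounded_op_def)

theorem theorem6:
  fixes sX :: "'k::rc_field \<Rightarrow> 'a::ab_group_add \<Rightarrow> 'a" and normX :: "'a \<Rightarrow> real"
    and sY :: "'k \<Rightarrow> 'b::ab_group_add \<Rightarrow> 'b" and normY :: "'b \<Rightarrow> real"
  assumes "quasi_banach sX normX"
    and "quasi_banach sY normY"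
    and "cotype2 (fscale (*)) (dual sX normX) (dual_norm normX)"
    and "cotype2 sY UNIV normY"
  shows "\<exists>C::real. 0 \<le> C \<and>
    (\<forall>u \<in> strongly_approximable sX normX sY normY.
       gamma2 sX normX sY normY u \<le> ennreal (C * opnorm UNIV normX normY u))"
proof -
  have sX: "vector_space sX" and pX: "quasi_norm sX normX" and sY: "vector_space sY" and qY: "quasi_norm sY normY"
    using assms(1,2) by (auto simp: quasi_banach_def)
  interpret SX: vector_space sX by (rule sX)
  interpret SY: vector_space sY by (rule sY)
  let ?rX = "\<lambda>r. sX (of_real r)" and ?rY = "\<lambda>r. sY (of_real r)"
  obtain Kx where X: "qnorm ?rX normX Kx" using quasi_norm_real[OF sX pX] .
  obtain Ky where Y: "qnorm ?rY normY Ky" using quasi_norm_real[OF sY qY] .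
  interpret X: qnorm ?rX normX Kx by (rule X)
  interpret Y: qnorm ?rY normY Ky by (rule Y)
  obtain C\<^sub>X where CX: "0 < C\<^sub>X" "X.has_dual_cotype2 C\<^sub>X"
    using dual_cotype2_real[OF sX pX X assms(3)] by blast
  obtain C\<^sub>Y where CY: "Y.has_cotype2 C\<^sub>Y"
  proof (rule cotype2_constant[OF assms(4)])
    fix C\<^sub>Y
    assume "\<And>N x. (\<And>i. i < N \<Longrightarrow> x i \<in> UNIV) \<Longrightarrow> (\<Sum>i<N. (normY (x i))\<^sup>2) \<le>
      C\<^sub>Y\<^sup>2 * ((\<Sum>\<epsilon>\<in>sign_vectors N. (normY (\<Sum>i<N. ?rY (\<epsilon> i) (x i)))\<^sup>2) / 2 ^ N)"
    then have "Y.has_cotype2 C\<^sub>Y" by (simp add: Y.has_cotype2_def Y.rad_sq_def)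
    then show thesis by (rule that)
  qed
  obtain q c where c: "1 \<le> c" and q: "qnorm ?rY q c" and q_le: "\<And>y. q y \<le> normY y" "\<And>y. normY y \<le> c * q y"
    and cont: "qnorm.continuous_combinations ?rY q"
    by (rule Y.continuous_renorming) (rule that, assumption+)
  interpret Q: qnorm ?rY q c by (rule q)
  interpret pair: cotype_pair ?rX normX Kx ?rY q c C\<^sub>X "C\<^sub>Y * c"
    by (intro cotype_pair.intro cotype_pair_axioms.intro X q CX cont Y.has_cotype2_equivalent[OF CY q q_le])
  let ?L = "bounded_ops sX normX sY normY" and ?N = "opnorm UNIV normX normY"
  have op: "real_operator ?rX normX Kx ?rY q c u" if "u \<in> ?L" for u
    by (rule real_operator_of_bounded[OF that X q])
  have N_nonneg: "0 \<le> ?N u" and N_le: "q (u x) \<le> ?N u * normX x" if "u \<in> ?L" for u x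
    using bounded_op_opnorm[OF that sX pX qY] order_trans[OF q_le(1)] by auto
  obtain a where a: "0 \<le> a" and automatic: "\<And>u U T.
    \<lbrakk>real_operator ?rX normX Kx ?rY q c u; \<And>x. q (u x) \<le> U * normX x; 0 \<le> U; 0 \<le> T; pair.type2_bound u T\<rbrakk>
      \<Longrightarrow> pair.type2_bound u (a * U\<^sup>2)"
    using pair.type2_bound_automatic by blast
  \<comment> \<open>the linear space of operators with some finite type 2 bound; \<open>A_bound\<close> makes it closed under
    bounded nets\<close>
  define A where "A = {u \<in> ?L. \<exists>T\<ge>0. pair.type2_bound u T}"
  have A_bound: "pair.type2_bound u (a * (?N u)\<^sup>2)" if "u \<in> A" for u
    using that automatic[OF op N_le N_nonneg] by (auto simp: A_def)
  have A_I: "u \<in> A" if "u \<in> ?L" "0 \<le> T" "\<And>N x. Q.rad_sq N (\<lambda>i. u (x i)) \<le> T * (\<Sum>i<N. (normX (x i))\<^sup>2)" for u T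
    using that by (auto simp: A_def pair.type2_bound_def)
  have sub: "module.subspace (fscale sY) A"
  proof -
    interpret F: vector_space "fscale sY :: 'k \<Rightarrow> ('a \<Rightarrow> 'b) \<Rightarrow> _" by (rule vector_space_fscale[OF sY])
    show ?thesis
      unfolding F.subspace_def
    proof (intro conjI ballI allI)
      have "(0 :: 'a \<Rightarrow> 'b) \<in> ?L"
        by (auto simp: bounded_ops_def bounded_op_def intro!: exI[of _ 0])
      then show "0 \<in> A" by (rule A_I[of _ 0]) (simp_all add: Q.rad_sq_def)
    next
      fix u v assume u: "u \<in> A" and v: "v \<in> A"
      obtain T S where T: "0 \<le> T" "pair.type2_bound u T" and S: "0 \<le> S" "pair.type2_bound v S"
        using u v by (auto simp: A_def)
      have uL: "u \<in> ?L" and vL: "v \<in> ?L" using u v by (auto simp: A_def)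
      have "u + v \<in> ?L"
      proof -
        have "normY (u x + v x) \<le> Ky * (?N u + ?N v) * normX x" for x
        proof -
          have "normY (u x + v x) \<le> Ky * (normY (u x) + normY (v x))" by (rule Y.q_add)
          also have "\<dots> \<le> Ky * (?N u * normX x + ?N v * normX x)"
            using Y.K_ge_1 by (intro mult_left_mono add_mono bounded_op_opnorm(2)[OF _ sX pX qY] uL vL) auto
          finally show ?thesis by (simp add: algebra_simps)
        qed
        then have "\<exists>B. \<forall>x. normY (u x + v x) \<le> B * normX x" by blast
        then show ?thesis
          using uL vL by (simp add: bounded_ops_def bounded_op_def SY.scale_right_distrib add_ac)
      qed
      then show "u + v \<in> A"
      proof (rule A_I)
        show "0 \<le> 2 * c\<^sup>2 * (T + S)" using T S by simp
        fix N and x :: "nat \<Rightarrow> 'a"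
        have "Q.rad_sq N (\<lambda>i. (u + v) (x i)) \<le> 2 * c\<^sup>2 * (Q.rad_sq N (\<lambda>i. u (x i)) + Q.rad_sq N (\<lambda>i. v (x i)))"
          using Q.rad_sq_add[of N "\<lambda>i. u (x i)" "\<lambda>i. v (x i)"] by simp
        also have "\<dots> \<le> 2 * c\<^sup>2 * (T * (\<Sum>i<N. (normX (x i))\<^sup>2) + S * (\<Sum>i<N. (normX (x i))\<^sup>2))"
          using T S by (intro mult_left_mono add_mono) (auto simp: pair.type2_bound_def)
        finally show "Q.rad_sq N (\<lambda>i. (u + v) (x i)) \<le> 2 * c\<^sup>2 * (T + S) * (\<Sum>i<N. (normX (x i))\<^sup>2)"
          by (simp add: algebra_simps)
      qed
    next
      fix k u assume u: "u \<in> A"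
      then have uL: "u \<in> ?L" by (simp add: A_def)
      have normY_scale: "normY (sY k y) = norm k * normY y" for y using qY by (simp add: quasi_norm_def)
      have kL: "fscale sY k u \<in> ?L"
      proof -
        have "normY (sY k (u x)) \<le> norm k * ?N u * normX x" for x
          using bounded_op_opnorm(2)[OF uL sX pX qY, of x] by (simp add: normY_scale mult_left_mono mult.assoc)
        then have "\<exists>B. \<forall>x. normY (sY k (u x)) \<le> B * normX x" by blast
        then show ?thesis
          using uL by (simp add: bounded_ops_def bounded_op_def fscale_def SY.scale_right_distrib mult.commute)
      qed
      obtain T where T: "0 \<le> T" "pair.type2_bound u T" using u by (auto simp: A_def)
      show "fscale sY k u \<in> A"
      proof (rule A_I[OF kL])
        \<comment> \<open>the renorming is homogeneous for real scalars only, so the comparison goes through \<open>normY\<close>\<close>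
        have q_k: "q (sY k y) \<le> norm k * c * q y" for y
          using q_le(1)[of "sY k y"] mult_left_mono[OF q_le(2)[of y], of "norm k"] by (simp add: normY_scale mult.assoc)
        show "0 \<le> (norm k * c)\<^sup>2 * T" using T by simp
        fix N and x :: "nat \<Rightarrow> 'a"
        have "(q (\<Sum>i<N. ?rY (\<epsilon> i) (fscale sY k u (x i))))\<^sup>2 \<le> (norm k * c)\<^sup>2 * (q (\<Sum>i<N. ?rY (\<epsilon> i) (u (x i))))\<^sup>2" for \<epsilon>
        proof -
          have "(\<Sum>i<N. ?rY (\<epsilon> i) (fscale sY k u (x i))) = sY k (\<Sum>i<N. ?rY (\<epsilon> i) (u (x i)))"
            by (simp add: fscale_def SY.scale_sum_right mult.commute)
          then show ?thesis using q_k unfolding power_mult_distrib[symmetric] by (simp add: power_mono)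
        qed
        then have "(\<Sum>\<epsilon>\<in>sign_vectors N. (q (\<Sum>i<N. ?rY (\<epsilon> i) (fscale sY k u (x i))))\<^sup>2) \<le>
            (\<Sum>\<epsilon>\<in>sign_vectors N. (norm k * c)\<^sup>2 * (q (\<Sum>i<N. ?rY (\<epsilon> i) (u (x i))))\<^sup>2)"
          by (rule sum_mono)
        then have "Q.rad_sq N (\<lambda>i. fscale sY k u (x i)) \<le> (norm k * c)\<^sup>2 * Q.rad_sq N (\<lambda>i. u (x i))"
          unfolding Q.rad_sq_def sum_distrib_left[symmetric] times_divide_eq_right by (rule divide_right_mono) simp
        also have "\<dots> \<le> (norm k * c)\<^sup>2 * (T * (\<Sum>i<N. (normX (x i))\<^sup>2))"
          using T by (intro mult_left_mono) (auto simp: pair.type2_bound_def)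
        finally show "Q.rad_sq N (\<lambda>i. fscale sY k u (x i)) \<le> (norm k * c)\<^sup>2 * T * (\<Sum>i<N. (normX (x i))\<^sup>2)"
          by (simp add: mult.assoc)
      qed
    qed
  qed
  have finite_rank: "{u \<in> ?L. finite_rank sY u} \<subseteq> A"
  proof
    fix u assume "u \<in> {u \<in> ?L. finite_rank sY u}"
    then have u: "u \<in> ?L" "finite_rank sY u" by auto
    obtain \<phi> \<gamma> where \<phi>: "quadratic_form ?rX normX Kx \<phi> \<gamma>" "\<And>x. (normY (u x))\<^sup>2 \<le> \<phi> x"
      using finite_rank_form[OF sX X sY qY u] by blast
    have "(q (u x))\<^sup>2 \<le> \<phi> x" for x
      using order_trans[OF power_mono[OF q_le(1) Q.q_nonneg] \<phi>(2)] .
    then have "pair.type2_bound u (\<gamma>\<^sup>2)" by (rule pair.form_type2_bound[OF op[OF u(1)] \<phi>(1)])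
    then show "u \<in> A" using u(1) by (auto simp: A_def intro: exI[of _ "\<gamma>\<^sup>2"])
  qed
  have closed: "bounded_net_closed sX normX sY normY A"
    unfolding bounded_net_closed_def
  proof (intro allI ballI impI, elim conjE)
    fix F :: "('a \<Rightarrow> 'b) filter" and M u
    assume u: "u \<in> ?L" and F: "F \<noteq> bot" and ev: "\<forall>\<^sub>F v in F. v \<in> A \<and> ?N v \<le> M"
      and lim: "\<forall>x. ((\<lambda>v. normY (v x - u x)) \<longlongrightarrow> 0) F"
    show "u \<in> A"
    proof (rule A_I[OF u])
      show "0 \<le> 2 * c\<^sup>2 * (a * M\<^sup>2)" using a by simp
      fix N and x :: "nat \<Rightarrow> 'a"
      let ?S = "\<Sum>i<N. (normX (x i))\<^sup>2"
      \<comment> \<open>the crude factor exponential in \<open>N\<close> is harmless, since \<open>N\<close> is fixed along the net\<close>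
      define R where "R v = (2 * c\<^sup>2) ^ N * (\<Sum>i<N. (normY (v (x i) - u (x i)))\<^sup>2)" for v
      have "(R \<longlongrightarrow> (2 * c\<^sup>2) ^ N * (\<Sum>i<N. 0\<^sup>2)) F"
        unfolding R_def using lim by (intro tendsto_intros) auto
      then have "((\<lambda>v. 2 * c\<^sup>2 * (a * M\<^sup>2 * ?S + R v)) \<longlongrightarrow> 2 * c\<^sup>2 * (a * M\<^sup>2 * ?S + 0)) F"
        by (intro tendsto_intros) simp
      moreover have "\<forall>\<^sub>F v in F. Q.rad_sq N (\<lambda>i. u (x i)) \<le> 2 * c\<^sup>2 * (a * M\<^sup>2 * ?S + R v)"
        using ev
      proof eventually_elim
        case (elim v)
        then have v: "v \<in> A" "v \<in> ?L" "?N v \<le> M" by (auto simp: A_def)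
        have "(?N v)\<^sup>2 \<le> M\<^sup>2" using v(3) N_nonneg[OF v(2)] by (rule power_mono)
        then have "a * (?N v)\<^sup>2 * ?S \<le> a * M\<^sup>2 * ?S"
          using a by (intro mult_right_mono mult_left_mono) (auto simp: sum_nonneg)
        then have v_le: "Q.rad_sq N (\<lambda>i. v (x i)) \<le> a * M\<^sup>2 * ?S"
          using A_bound[OF v(1)] unfolding pair.type2_bound_def by (meson order_trans)
        have "Q.rad_sq N (\<lambda>i. u (x i) - v (x i)) \<le> (2 * c\<^sup>2) ^ N * (\<Sum>i<N. (q (u (x i) - v (x i)))\<^sup>2)"
          by (rule Q.rad_sq_le_sum)
        also have "\<dots> \<le> R v"
          unfolding R_def Y.q_minus_commute[of "v _" "u _"]
          by (intro mult_left_mono sum_mono power_mono q_le) auto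
        finally have d_le: "Q.rad_sq N (\<lambda>i. u (x i) - v (x i)) \<le> R v" .
        have "Q.rad_sq N (\<lambda>i. u (x i)) \<le> 2 * c\<^sup>2 * (Q.rad_sq N (\<lambda>i. v (x i)) + Q.rad_sq N (\<lambda>i. u (x i) - v (x i)))"
          using Q.rad_sq_add[of N "\<lambda>i. v (x i)" "\<lambda>i. u (x i) - v (x i)"] by simp
        also have "\<dots> \<le> 2 * c\<^sup>2 * (a * M\<^sup>2 * ?S + R v)"
          by (intro mult_left_mono add_mono v_le d_le) simp
        finally show ?case .
      qed
      ultimately have "Q.rad_sq N (\<lambda>i. u (x i)) \<le> 2 * c\<^sup>2 * (a * M\<^sup>2 * ?S + 0)"
        by (rule tendsto_lowerbound[OF _ _ F])
      then show "Q.rad_sq N (\<lambda>i. u (x i)) \<le> 2 * c\<^sup>2 * (a * M\<^sup>2) * ?S" by (simp add: mult.assoc)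
    qed
  qed
  have "A \<subseteq> ?L" by (auto simp: A_def)
  then have approx: "strongly_approximable sX normX sY normY \<subseteq> A"
    unfolding strongly_approximable_def using sub finite_rank closed by (intro Inter_lower) simp
  define D where "D = Ky * (c * (\<bar>C\<^sub>Y * c\<bar> * sqrt a))"
  have D: "0 \<le> D" using a c Y.K_ge_1 by (simp add: D_def)
  have "gamma2 sX normX sY normY u \<le> ennreal (D * ?N u)" if u: "u \<in> A" for u
  proof -
    have uL: "u \<in> ?L" using u by (simp add: A_def)
    have u_add: "u (x + y) = u x + u y" and u_scale: "u (sX k x) = sY k (u x)" for x y k
      using uL by (auto simp: bounded_ops_def bounded_op_def)
    obtain \<phi> where \<phi>: "quadratic_form ?rX normX Kx \<phi> (\<bar>C\<^sub>Y * c\<bar> * sqrt (a * (?N u)\<^sup>2))" "\<And>x. (q (u x))\<^sup>2 \<le> \<phi> x"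
      using pair.type2_bound_form[OF op[OF uL] A_bound[OF u]] a by auto
    interpret P: quadratic_form ?rX normX Kx \<phi> "\<bar>C\<^sub>Y * c\<bar> * sqrt (a * (?N u)\<^sup>2)" by (rule \<phi>)
    define \<gamma> where "\<gamma> = c * (\<bar>C\<^sub>Y * c\<bar> * sqrt (a * (?N u)\<^sup>2))"
    have "quadratic_form ?rX normX Kx (\<lambda>x. c\<^sup>2 * \<phi> x) \<gamma>"
    proof
      show "parallelogram_law (\<lambda>x. c\<^sup>2 * \<phi> x)"
        unfolding parallelogram_law_def distrib_left[symmetric] P.parallelogram by (simp add: algebra_simps)
      show "0 \<le> c\<^sup>2 * \<phi> x" for x by simp
      show "c\<^sup>2 * \<phi> x \<le> (\<gamma> * normX x)\<^sup>2" for x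
        using mult_left_mono[OF P.form_le[of x], of "c\<^sup>2"] by (simp add: \<gamma>_def power_mult_distrib mult_ac)
      show "0 \<le> \<gamma>" unfolding \<gamma>_def using c P.\<gamma>_nonneg by simp
    qed
    then obtain h \<psi> and j :: 'k where h: "semi_inner_product sX h \<psi>" and j: "norm j = 1"
      and \<psi>: "\<And>x. \<psi> x = (c\<^sup>2 * \<phi> x + c\<^sup>2 * \<phi> (sX j x)) / 2"
      using hermitian_form[OF sX] by blast
    interpret H: semi_inner_product sX h \<psi> by (rule h)
    have \<gamma>: "0 \<le> \<gamma>" unfolding \<gamma>_def using c P.\<gamma>_nonneg by simp
    have low: "(normY (u x))\<^sup>2 \<le> c\<^sup>2 * \<phi> x" for x
    proof -
      have "(normY (u x))\<^sup>2 \<le> (c * q (u x))\<^sup>2" by (intro power_mono q_le) simp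
      also have "\<dots> \<le> c\<^sup>2 * \<phi> x" unfolding power_mult_distrib by (intro mult_left_mono \<phi>(2)) simp
      finally show ?thesis .
    qed
    have up: "c\<^sup>2 * \<phi> x \<le> (\<gamma> * normX x)\<^sup>2" for x
      using mult_left_mono[OF P.form_le[of x], of "c\<^sup>2"] by (simp add: \<gamma>_def power_mult_distrib mult_ac)
    have j_inv: "normX (sX j x) = normX x" "normY (u (sX j x)) = normY (u x)" for x
      using pX qY j by (simp_all add: quasi_norm_def u_scale)
    have "gamma2 sX normX sY normY u \<le> ennreal (Ky * \<gamma>)"
    proof (rule H.gamma2_le[OF assms(2)])
      show "normY (x + y) \<le> Ky * (normY x + normY y)" for x y by (rule Y.q_add)
      show "1 \<le> Ky" by (rule Y.K_ge_1)
      show "normY (u x) \<le> H.seminorm x" for x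
      proof -
        have "(normY (u x))\<^sup>2 \<le> \<psi> x" using low[of x] low[of "sX j x"] unfolding \<psi> j_inv by simp
        then show ?thesis unfolding H.seminorm_def by (rule real_le_rsqrt)
      qed
      show "H.seminorm x \<le> \<gamma> * normX x" for x
      proof -
        have "\<psi> x \<le> (\<gamma> * normX x)\<^sup>2" using up[of x] up[of "sX j x"] unfolding \<psi> j_inv by simp
        then have "sqrt (\<psi> x) \<le> sqrt ((\<gamma> * normX x)\<^sup>2)" by (rule real_sqrt_le_mono)
        then show ?thesis using \<gamma> by (simp add: H.seminorm_def)
      qed
    qed (use u_add u_scale \<gamma> in auto)
    moreover have "Ky * \<gamma> = D * ?N u"
      using N_nonneg[OF uL] by (simp add: \<gamma>_def D_def real_sqrt_mult)
    ultimately show ?thesis by simp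
  qed
  then show ?thesis using D approx by blast
qed

end
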